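(* Let $(\rho_0,B_0,P_0)$ be a steady state of one of the four types (1)-(4) described in the context, and let $\Lambda^2$ be the associated number $$\Lambda^{2}=\sup_{v}\frac{\iint_{D}H(v,v_{x})\,dx\,dy}{\iint_D\rho_0v^2\,dx\,dy}$$ defined in the context. Suppose $\Lambda^2>0$ and let $\Lambda>0$ be its positive square root. Then for every integer $s\ge 0$ there is a constant $C=C(\Lambda,\rho_0,s)$ such that every solution $(\sigma,v,B)$ of the linearized MHD system (stated in the context) around this steady state satisfies, for all $t\ge 0$, $$\|(\sigma(t),v(t),B(t))\|_{s}\le C e^{\Lambda t}\,\|(\sigma(0),v(0),B(0))\|_{s+2}.$$
   Context: Domain: $D=\{0\le x\le 2\pi,\ 0\le y\le 2\pi\}$; velocity and magnetic field satisfy periodic boundary conditions, and Sobolev spaces of test functions are understood accordingly. All unknowns depend on $(t,x,y)$ only (with $\partial_z=0$), vector fields have three components. Gravity: $\vec g=(g,0,0)$ with $g$ constant. Steady state: zero velocity, smooth $\rho_0(x)$ with $\min\rho_0\ge c>0$, magnetic field $B_0$ and pressure $P_0=p_0(x)$ with $\frac{d}{dx}\left(P_0+\frac12|B_0|^2\right)=\rho_0 g$. In the compressible case $P=C_*\rho^{\gamma}$ with constants $C_*>0$ and adiabatic index $\gamma$, and $P_0=C_*\rho_0^\gamma$. Linearized system: $$\sigma_t+\nabla\cdot(\rho_0 v)=0,\qquad \rho_0v_t=(\nabla\times B_0)\times B+(\nabla\times B)\times B_0-\nabla p+\sigma\vec g,$$ $$B_t=\nabla\times(v\times B_0),\qquad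 \nabla\cdot B=0.$$ In the incompressible case one adds $\nabla\cdot v=0$ ($p$ being the unknown pressure). In the compressible case $p=C_*\gamma\rho_0^{\gamma-1}\sigma$, equivalently $p_t+v\cdot\nabla p_0+\gamma p_0\nabla\cdot v=0$. Types of steady states, and the corresponding quadratic expression $H$ and space over which the supremum defining $\Lambda^2$ is taken (over nonzero scalar functions $v$): (1) Incompressible, $B_0=(0,0,B_0(x))$: $H(v)=-g\rho_{0x}v^2$, $v\in L^2(D)$. (2) Compressible, $B_0=(0,0,B_0(x))$: $H(v)=\left(\frac{g^2\rho_0^2}{\gamma p_0+B_0^2}-g\rho_{0x}\right)v^2$, $v\in L^2(D)$. (3) Incompressible, $B_0=(B_0,0,0)$ with $B_0$ a nonzero constant, and perturbations with $v_3=B_3=0$: $H(v,v_x)=-g\rho_{0x}v^2-B_0^2v_x^2$, $v\in H^1(D)$. (4) Compressible, $B_0=(B_0,0,0)$ with $B_0$ a nonzero constant, and perturbations with $v_3=B_3=0$: $H(v,v_x)=\frac{1}{\gamma p_0+B_0^2}\left(g\rho_0v-B_0^2v_x\right)^2-g\rho_{0x}v^2-B_0^2v_x^2$, $v\in H^1(D)$. Norms: $\|f\|=\left(\iint_D\rho_0|f|^2\,dx\,dy\right)^{1/2}$ and $\|f\|_s=\left(\sum_{|\alpha|\le s}\|\partial^\alpha f\|^2\right)^{1/2}$, with $\partial^\alpha$ derivatives in $x,y$.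
   Formalization: Solutions are smooth and the total pressure perturbation p+B_0·B is also assumed periodic in x (with only v, B periodic the bound fails); C may depend on the whole fixed steady state and its constants, since independence of B_0 is false in type (1). *)

theory Defs
  imports "HOL-Analysis.Analysis"
begin

text \<open>
  All functions of space are functions of \<open>x \<in> [0, 2\<pi>]\<close> and \<open>y \<in> \<real>\<close>, the latter always
  combined with \<open>2\<pi>\<close>-periodicity in \<open>y\<close>; derivatives in \<open>x\<close> and \<open>t\<close> are one-sided at the
  end points.  The coefficients of the system depend on \<open>x\<close> and cannot in general be
  \<open>2\<pi>\<close>-periodic: in the compressible case \<open>P\<^sub>0 + |B\<^sub>0|\<^sup>2/2\<close> has derivative \<open>\<rho>\<^sub>0 g\<close> of constant sign.
  Periodicity in \<open>x\<close> is therefore a condition on values at \<open>x = 0\<close> and \<open>x = 2\<pi>\<close> only.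
\<close>

definition Dt :: "(real \<Rightarrow> real \<Rightarrow> real \<Rightarrow> 'a::real_normed_vector) \<Rightarrow> real \<Rightarrow> real \<Rightarrow> real \<Rightarrow> 'a" where
  "Dt f t x y = vector_derivative (\<lambda>r. f r x y) (at t within {0..})"

definition Dx :: "(real \<Rightarrow> real \<Rightarrow> 'a::real_normed_vector) \<Rightarrow> real \<Rightarrow> real \<Rightarrow> 'a" where
  "Dx f x y = vector_derivative (\<lambda>r. f r y) (at x within {0..2 * pi})"

definition Dy :: "(real \<Rightarrow> real \<Rightarrow> 'a::real_normed_vector) \<Rightarrow> real \<Rightarrow> real \<Rightarrow> 'a" where
  "Dy f x y = vector_derivative (\<lambda>r. f x r) (at y)"

text \<open>\<open>C\<^sup>k\<close> on \<open>[0,\<infinity>) \<times> [0,2\<pi>] \<times> \<real>\<close>, up to the boundary.\<close>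

primrec Ck :: "nat \<Rightarrow> (real \<Rightarrow> real \<Rightarrow> real \<Rightarrow> 'a::real_normed_vector) \<Rightarrow> bool" where
  "Ck 0 f \<longleftrightarrow> continuous_on ({0..} \<times> {0..2 * pi} \<times> UNIV) (\<lambda>(t, x, y). f t x y)"
| "Ck (Suc k) f \<longleftrightarrow>
     continuous_on ({0..} \<times> {0..2 * pi} \<times> UNIV) (\<lambda>(t, x, y). f t x y) \<and>
     (\<forall>t\<ge>0. \<forall>x\<in>{0..2 * pi}. \<forall>y.
        (\<lambda>r. f r x y) differentiable (at t within {0..}) \<and>
        (\<lambda>r. f t r y) differentiable (at x within {0..2 * pi}) \<and>
        (\<lambda>r. f t x r) differentiable (at y)) \<and>
     Ck k (Dt f) \<and> Ck k (\<lambda>t. Dx (f t)) \<and> Ck k (\<lambda>t. Dy (f t))"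

definition smooth :: "(real \<Rightarrow> real \<Rightarrow> real \<Rightarrow> 'a::real_normed_vector) \<Rightarrow> bool" where
  "smooth f \<longleftrightarrow> (\<forall>k. Ck k f)"

definition periodic_x :: "(real \<Rightarrow> real \<Rightarrow> 'a) \<Rightarrow> bool" where
  "periodic_x f \<longleftrightarrow> (\<forall>y. f 0 y = f (2 * pi) y)"

definition periodic_y :: "(real \<Rightarrow> real \<Rightarrow> 'a) \<Rightarrow> bool" where
  "periodic_y f \<longleftrightarrow> (\<forall>x\<in>{0..2 * pi}. \<forall>y. f x (y + 2 * pi) = f x y)"

text \<open>Vector calculus for fields independent of \<open>z\<close>.\<close>

definition grad :: "(real \<Rightarrow> real \<Rightarrow> real) \<Rightarrow> real \<Rightarrow> real \<Rightarrow> real^3" where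
  "grad f x y = vector [Dx f x y, Dy f x y, 0]"

definition divergence :: "(real \<Rightarrow> real \<Rightarrow> real^3) \<Rightarrow> real \<Rightarrow> real \<Rightarrow> real" where
  "divergence F x y = Dx F x y $ 1 + Dy F x y $ 2"

definition curl :: "(real \<Rightarrow> real \<Rightarrow> real^3) \<Rightarrow> real \<Rightarrow> real \<Rightarrow> real^3" where
  "curl F x y = vector [Dy F x y $ 3, - (Dx F x y $ 3), Dx F x y $ 2 - Dy F x y $ 1]"

definition D :: "(real \<times> real) set" where
  "D = {0..2 * pi} \<times> {0..2 * pi}"

definition integral_D :: "(real \<Rightarrow> real \<Rightarrow> real) \<Rightarrow> real" where
  "integral_D f = (LINT z:D|lborel. f (fst z) (snd z))"

datatype flow = Incompressible | Compressible

datatype orientation = Along_z | Along_x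

text \<open>
  \<open>bfield\<close> is the only nonzero component of \<open>B\<^sub>0\<close>.  The constants \<open>cstar\<close> and \<open>adiabatic\<close> are
  irrelevant when \<open>flow\<close> is \<open>Incompressible\<close>.
\<close>

record equilibrium =
  flow :: flow
  orientation :: orientation
  density :: "real \<Rightarrow> real"
  bfield :: "real \<Rightarrow> real"
  pressure :: "real \<Rightarrow> real"
  gravity :: real
  cstar :: real
  adiabatic :: real

definition B0 :: "equilibrium \<Rightarrow> real \<Rightarrow> real^3" where
  "B0 E x = (case orientation E of
      Along_z \<Rightarrow> vector [0, 0, bfield E x]
    | Along_x \<Rightarrow> vector [bfield E x, 0, 0])"

definition steady_state :: "equilibrium \<Rightarrow> bool" where
  "steady_state E \<longleftrightarrow>
     smooth (\<lambda>t x y. density E x) \<and> smooth (\<lambda>t x y. bfield E x) \<and> smooth (\<lambda>t x y. pressure E x) \<and>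
     (\<exists>c>0. \<forall>x\<in>{0..2 * pi}. c \<le> density E x) \<and>
     (\<forall>x\<in>{0..2 * pi}.
        ((\<lambda>x. pressure E x + 1/2 * (norm (B0 E x))\<^sup>2) has_real_derivative density E x * gravity E)
          (at x within {0..2 * pi})) \<and>
     (flow E = Compressible \<longrightarrow> cstar E > 0 \<and> adiabatic E > 0 \<and>
        (\<forall>x\<in>{0..2 * pi}. pressure E x = cstar E * density E x powr adiabatic E)) \<and>
     (orientation E = Along_x \<longrightarrow> (\<exists>b. b \<noteq> 0 \<and> (\<forall>x\<in>{0..2 * pi}. bfield E x = b)))"

definition linearized_mhd ::
  "equilibrium \<Rightarrow> (real \<Rightarrow> real \<Rightarrow> real \<Rightarrow> real) \<Rightarrow> (real \<Rightarrow> real \<Rightarrow> real \<Rightarrow> real^3) \<Rightarrow>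
   (real \<Rightarrow> real \<Rightarrow> real \<Rightarrow> real^3) \<Rightarrow> (real \<Rightarrow> real \<Rightarrow> real \<Rightarrow> real) \<Rightarrow> bool" where
  "linearized_mhd E \<sigma> v B p \<longleftrightarrow> (\<forall>t\<ge>0. \<forall>x\<in>{0..2 * pi}. \<forall>y.
     Dt \<sigma> t x y + divergence (\<lambda>x y. density E x *\<^sub>R v t x y) x y = 0 \<and>
     density E x *\<^sub>R Dt v t x y =
       cross3 (curl (\<lambda>x y. B0 E x) x y) (B t x y) + cross3 (curl (B t) x y) (B0 E x)
       - grad (p t) x y + \<sigma> t x y *\<^sub>R vector [gravity E, 0, 0] \<and>
     Dt B t x y = curl (\<lambda>x y. cross3 (v t x y) (B0 E x)) x y \<and>
     divergence (B t) x y = 0 \<and>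
     (case flow E of
        Incompressible \<Rightarrow> divergence (v t) x y = 0
      | Compressible \<Rightarrow>
          p t x y = cstar E * adiabatic E * density E x powr (adiabatic E - 1) * \<sigma> t x y))"

text \<open>
  Besides \<open>v\<close> and \<open>B\<close>, the perturbation \<open>p + B\<^sub>0 \<bullet> B\<close> of the total pressure has to be periodic
  in \<open>x\<close>; this is what makes the boundary terms of the energy identity cancel.  Without it the
  incompressible system is solved by \<open>v = (f(t), 0, 0)\<close> with an arbitrary function \<open>f\<close> and a suitable
  \<open>p(t, x)\<close>, so that no growth bound can hold.  The density perturbation need not be periodic in
  \<open>x\<close>, since \<open>\<rho>\<^sub>0\<close> is not.
\<close>

definition mhd_solution ::
  "equilibrium \<Rightarrow> (real \<Rightarrow> real \<Rightarrow> real \<Rightarrow> real) \<Rightarrow> (real \<Rightarrow> real \<Rightarrow> real \<Rightarrow> real^3) \<Rightarrow>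
   (real \<Rightarrow> real \<Rightarrow> real \<Rightarrow> real^3) \<Rightarrow> (real \<Rightarrow> real \<Rightarrow> real \<Rightarrow> real) \<Rightarrow> bool" where
  "mhd_solution E \<sigma> v B p \<longleftrightarrow>
     smooth \<sigma> \<and> smooth v \<and> smooth B \<and> smooth p \<and>
     (\<forall>t\<ge>0. periodic_y (\<sigma> t) \<and> periodic_y (v t) \<and> periodic_y (B t) \<and> periodic_y (p t)) \<and>
     (\<forall>t\<ge>0. periodic_x (v t) \<and> periodic_x (B t) \<and>
        periodic_x (\<lambda>x y. p t x y + B0 E x \<bullet> B t x y)) \<and>
     (orientation E = Along_x \<longrightarrow>
        (\<forall>t\<ge>0. \<forall>x\<in>{0..2 * pi}. \<forall>y. v t x y $ 3 = 0 \<and> B t x y $ 3 = 0)) \<and>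
     linearized_mhd E \<sigma> v B p"

text \<open>The quadratic expression \<open>H(v, w)\<close> at \<open>x\<close>, where \<open>w\<close> stands for \<open>v\<^sub>x\<close>.\<close>

definition H :: "equilibrium \<Rightarrow> real \<Rightarrow> real \<Rightarrow> real \<Rightarrow> real" where
  "H E x v w =
    (let g = gravity E; \<rho> = density E x; b = bfield E x;
         \<rho>x = vector_derivative (density E) (at x within {0..2 * pi});
         a = adiabatic E * pressure E x + b\<^sup>2
     in case (flow E, orientation E) of
        (Incompressible, Along_z) \<Rightarrow> - g * \<rho>x * v\<^sup>2
      | (Compressible, Along_z) \<Rightarrow> (g\<^sup>2 * \<rho>\<^sup>2 / a - g * \<rho>x) * v\<^sup>2
      | (Incompressible, Along_x) \<Rightarrow> - g * \<rho>x * v\<^sup>2 - b\<^sup>2 * w\<^sup>2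
      | (Compressible, Along_x) \<Rightarrow> 1 / a * (g * \<rho> * v - b\<^sup>2 * w)\<^sup>2 - g * \<rho>x * v\<^sup>2 - b\<^sup>2 * w\<^sup>2)"

definition L2_D :: "(real \<Rightarrow> real \<Rightarrow> real) set" where
  "L2_D = {v. set_borel_measurable lborel D (\<lambda>z. v (fst z) (snd z)) \<and>
              set_integrable lborel D (\<lambda>z. (v (fst z) (snd z))\<^sup>2)}"

text \<open>
  Testing against functions that do not vanish on the boundary but are periodic makes a function
  with weak derivatives in \<open>L\<^sup>2\<close> an element of the periodic Sobolev space \<open>H\<^sup>1\<close>.
\<close>

definition periodic_test :: "(real \<Rightarrow> real \<Rightarrow> real) set" where
  "periodic_test = {\<phi>. smooth (\<lambda>t. \<phi>) \<and> periodic_x \<phi> \<and> periodic_y \<phi>}"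

definition weak_Dx :: "(real \<Rightarrow> real \<Rightarrow> real) \<Rightarrow> (real \<Rightarrow> real \<Rightarrow> real) \<Rightarrow> bool" where
  "weak_Dx v w \<longleftrightarrow> w \<in> L2_D \<and>
     (\<forall>\<phi>\<in>periodic_test. integral_D (\<lambda>x y. v x y * Dx \<phi> x y) = - integral_D (\<lambda>x y. w x y * \<phi> x y))"

definition weak_Dy :: "(real \<Rightarrow> real \<Rightarrow> real) \<Rightarrow> (real \<Rightarrow> real \<Rightarrow> real) \<Rightarrow> bool" where
  "weak_Dy v w \<longleftrightarrow> w \<in> L2_D \<and>
     (\<forall>\<phi>\<in>periodic_test. integral_D (\<lambda>x y. v x y * Dy \<phi> x y) = - integral_D (\<lambda>x y. w x y * \<phi> x y))"

text \<open>
  The functions \<open>v\<close> over which the supremum is taken, paired with \<open>w = v\<^sub>x\<close> in the \<open>H\<^sup>1\<close> cases.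
  In the \<open>L\<^sup>2\<close> cases \<open>H\<close> does not depend on \<open>w\<close>, which is set to \<open>0\<close>.
\<close>

definition trial :: "equilibrium \<Rightarrow> ((real \<Rightarrow> real \<Rightarrow> real) \<times> (real \<Rightarrow> real \<Rightarrow> real)) set" where
  "trial E = {(v, w). v \<in> L2_D \<and> \<not> (AE z\<in>D in lborel. v (fst z) (snd z) = 0) \<and>
     (case orientation E of
        Along_z \<Rightarrow> w = (\<lambda>x y. 0)
      | Along_x \<Rightarrow> weak_Dx v w \<and> (\<exists>u. weak_Dy v u))}"

definition Lambda_sq :: "equilibrium \<Rightarrow> ereal" where
  "Lambda_sq E = (SUP (v, w)\<in>trial E.
     ereal (integral_D (\<lambda>x y. H E x (v x y) (w x y)) / integral_D (\<lambda>x y. density E x * (v x y)\<^sup>2)))"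

definition weighted_norm :: "equilibrium \<Rightarrow> (real \<Rightarrow> real \<Rightarrow> 'a::real_normed_vector) \<Rightarrow> real" where
  "weighted_norm E f = sqrt (integral_D (\<lambda>x y. density E x * (norm (f x y))\<^sup>2))"

definition sobolev_norm ::
  "equilibrium \<Rightarrow> nat \<Rightarrow> (real \<Rightarrow> real \<Rightarrow> 'a::real_normed_vector) \<Rightarrow> real" where
  "sobolev_norm E s f =
     sqrt (\<Sum>(i, j)\<in>{(i, j). i + j \<le> s}. (weighted_norm E ((Dx ^^ i) ((Dy ^^ j) f)))\<^sup>2)"

end

theory Submission
  imports Defs
begin

text \<open>
  The four equilibria are treated at once: writing \<open>r\<close> for the time derivative of the total pressure
  perturbation, \<open>\<kappa>\<close> for \<open>1 / (\<gamma> p\<^sub>0 + B\<^sub>0\<^sup>2)\<close> (or \<open>0\<close> in the incompressible case), \<open>b\<close> for the \<open>x\<close>-component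
  of \<open>B\<^sub>0\<close> and \<open>m = g \<rho>\<^sub>0 v\<^sub>1 - b\<^sup>2 \<partial>\<^sub>x v\<^sub>1\<close>, the system contains \<open>div v = - \<kappa> (r + m)\<close>, and the energy
  \<open>\<integral> \<rho>\<^sub>0 |v\<^sub>t|\<^sup>2 + \<kappa> r\<^sup>2 + b\<^sup>2 |\<partial>\<^sub>x v\<^sub>2|\<^sup>2 - H(v\<^sub>1, \<partial>\<^sub>x v\<^sub>1)\<close> with \<open>H = \<kappa> m\<^sup>2 - b\<^sup>2 (\<partial>\<^sub>x v\<^sub>1)\<^sup>2 - g \<rho>\<^sub>0' v\<^sub>1\<^sup>2\<close>
  is conserved.  The variational bound \<open>\<integral> H \<le> \<Lambda>\<^sup>2 \<integral> \<rho>\<^sub>0 v\<^sub>1\<^sup>2\<close> turns this into a differential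
  inequality for \<open>\<integral> \<rho>\<^sub>0 |v|\<^sup>2\<close>, whence growth at most \<open>exp (\<Lambda> t)\<close> of \<open>v\<close> and \<open>v\<^sub>t\<close>.  Since the
  coefficients depend on \<open>x\<close> only, the same holds for all derivatives in \<open>t\<close> and \<open>y\<close>.

  Derivatives in \<open>x\<close> are recovered from the equations.  The formula for \<open>div v\<close> gives \<open>\<partial>\<^sub>x v\<^sub>1\<close> and the
  momentum equation gives \<open>\<kappa> \<partial>\<^sub>x r\<close>.  For \<open>\<partial>\<^sub>x v\<^sub>2\<close> one uses the vorticity: if \<open>b = 0\<close> it is obtained by
  integration in time, and if \<open>b \<noteq> 0\<close> the vorticity equation expresses \<open>\<partial>\<^sub>x\<^sup>3 v\<^sub>2\<close> by derivatives of lower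
  order in \<open>x\<close>, while \<open>\<partial>\<^sub>x\<^sup>2 v\<^sub>2\<close> is controlled by \<open>\<partial>\<^sub>x\<^sup>3 v\<^sub>2\<close> because \<open>\<partial>\<^sub>x v\<^sub>2\<close> is periodic.  All
  this bounds \<open>s\<close> derivatives of \<open>v\<close> by \<open>s + 1\<close> derivatives of the data; one more derivative is lost
  when \<open>\<sigma>\<close> and \<open>B\<close> are found by integrating their equations in time.
\<close>


section \<open>Smooth functions up to the boundary\<close>

text \<open>One-sided derivatives are unique only at points that are not isolated in the domain;
  this justifies evaluating \<open>vector_derivative\<close> at the end points.\<close>

lemma within_nontrivial:
  fixes t x y :: real
  shows "t \<ge> 0 \<Longrightarrow> at t within {0..} \<noteq> bot"
    and "x \<in> {0..2 * pi} \<Longrightarrow> at x within {0..2 * pi} \<noteq> bot"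
proof -
  show "at t within {0..} \<noteq> bot" if "t \<ge> 0"
  proof -
    have "t islimpt {t..t + 1}"
      by (simp add: islimpt_Icc)
    then have "t islimpt {0..}"
      by (rule islimpt_subset) (use that in auto)
    then show ?thesis
      by (simp add: trivial_limit_within)
  qed
  show "at x within {0..2 * pi} \<noteq> bot" if "x \<in> {0..2 * pi}"
    using that by (simp add: trivial_limit_within islimpt_Icc)
qed

lemma Dt_eqI:
  assumes "((\<lambda>r. f r x y) has_vector_derivative d) (at t within {0..})" "t \<ge> 0"
  shows "Dt f t x y = d"
  unfolding Dt_def using assms by (intro vector_derivative_within within_nontrivial)

lemma Dx_eqI:
  assumes "((\<lambda>r. f r y) has_vector_derivative d) (at x within {0..2 * pi})" "x \<in> {0..2 * pi}"
  shows "Dx f x y = d"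
  unfolding Dx_def using assms by (intro vector_derivative_within within_nontrivial)

lemma Dy_eqI:
  assumes "((\<lambda>r. f x r) has_vector_derivative d) (at y)"
  shows "Dy f x y = d"
  unfolding Dy_def using assms by (rule vector_derivative_at)

lemma Ck_continuous:
  "Ck k f \<Longrightarrow> continuous_on ({0..} \<times> {0..2 * pi} \<times> UNIV) (\<lambda>(t, x, y). f t x y)"
  by (cases k) auto

lemma Ck_derivatives:
  assumes "Ck (Suc k) f" "t \<ge> 0" "x \<in> {0..2 * pi}"
  shows "((\<lambda>r. f r x y) has_vector_derivative Dt f t x y) (at t within {0..})"
    and "((\<lambda>r. f t r y) has_vector_derivative Dx (f t) x y) (at x within {0..2 * pi})"
    and "((\<lambda>r. f t x r) has_vector_derivative Dy (f t) x y) (at y)"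
  using assms by (auto simp: Dt_def Dx_def Dy_def vector_derivative_works)

lemma differentiable_iff_has_vector_derivative:
  "f differentiable F \<longleftrightarrow> (\<exists>d. (f has_vector_derivative d) F)"
  if "F = at x within S" for f :: "real \<Rightarrow> 'a::real_normed_vector"
  using that by (metis differentiableI_vector vector_derivative_works)

lemma has_derivative_congs:
  assumes "\<And>t x y. t \<ge> 0 \<Longrightarrow> x \<in> {0..2 * pi} \<Longrightarrow> f t x y = g t x y"
    and "t \<ge> 0" "x \<in> {0..2 * pi}"
  shows "((\<lambda>r. f r x y) has_vector_derivative d) (at t within {0..}) \<longleftrightarrow>
         ((\<lambda>r. g r x y) has_vector_derivative d) (at t within {0..})"
    and "((\<lambda>r. f t r y) has_vector_derivative d) (at x within {0..2 * pi}) \<longleftrightarrow>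
         ((\<lambda>r. g t r y) has_vector_derivative d) (at x within {0..2 * pi})"
    and "((\<lambda>r. f t x r) has_vector_derivative d) (at y) \<longleftrightarrow>
         ((\<lambda>r. g t x r) has_vector_derivative d) (at y)"
proof -
  have *: "(u has_vector_derivative d) (at z within S) \<longleftrightarrow> (w has_vector_derivative d) (at z within S)"
    if "z \<in> S" "\<And>s. s \<in> S \<Longrightarrow> u s = w s" for u w :: "real \<Rightarrow> 'a" and z S
    using that has_vector_derivative_transform[of z S u w d] has_vector_derivative_transform[of z S w u d]
    by metis
  show "((\<lambda>r. f r x y) has_vector_derivative d) (at t within {0..}) \<longleftrightarrow>
         ((\<lambda>r. g r x y) has_vector_derivative d) (at t within {0..})"
    using assms by (intro *) auto
  show "((\<lambda>r. f t r y) has_vector_derivative d) (at x within {0..2 * pi}) \<longleftrightarrow>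
         ((\<lambda>r. g t r y) has_vector_derivative d) (at x within {0..2 * pi})"
    using assms by (intro *) auto
  show "((\<lambda>r. f t x r) has_vector_derivative d) (at y) \<longleftrightarrow>
         ((\<lambda>r. g t x r) has_vector_derivative d) (at y)"
    using assms by simp
qed

lemma derivative_congs:
  assumes "\<And>t x y. t \<ge> 0 \<Longrightarrow> x \<in> {0..2 * pi} \<Longrightarrow> f t x y = g t x y"
    and "t \<ge> 0" "x \<in> {0..2 * pi}"
  shows "Dt f t x y = Dt g t x y" "Dx (f t) x y = Dx (g t) x y" "Dy (f t) x y = Dy (g t) x y"
  unfolding Dt_def Dx_def Dy_def vector_derivative_def
  using has_derivative_congs[of f g, OF assms] by auto

lemma Ck_cong:
  assumes "\<And>t x y. t \<ge> 0 \<Longrightarrow> x \<in> {0..2 * pi} \<Longrightarrow> f t x y = g t x y"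
  shows "Ck k f \<longleftrightarrow> Ck k g"
  using assms
proof (induction k arbitrary: f g)
  case 0
  then show ?case
    by (auto intro!: continuous_on_cong)
next
  case (Suc k)
  have "(\<lambda>r. f r x y) differentiable at t within {0..} \<longleftrightarrow>
        (\<lambda>r. g r x y) differentiable at t within {0..}"
    "(\<lambda>r. f t r y) differentiable at x within {0..2 * pi} \<longleftrightarrow>
     (\<lambda>r. g t r y) differentiable at x within {0..2 * pi}"
    "(\<lambda>r. f t x r) differentiable at y \<longleftrightarrow> (\<lambda>r. g t x r) differentiable at y"
    if "t \<ge> 0" "x \<in> {0..2 * pi}" for t x y
    unfolding differentiable_iff_has_vector_derivative[OF refl]
    using has_derivative_congs[of f g, OF Suc.prems that] by simp_all
  moreover have "Ck k (Dt f) \<longleftrightarrow> Ck k (Dt g)" "Ck k (\<lambda>t. Dx (f t)) \<longleftrightarrow> Ck k (\<lambda>t. Dx (g t))"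
    "Ck k (\<lambda>t. Dy (f t)) \<longleftrightarrow> Ck k (\<lambda>t. Dy (g t))"
    by (rule Suc.IH; rule derivative_congs[of f g]; use Suc.prems in blast)+
  moreover have "continuous_on ({0..} \<times> {0..2 * pi} \<times> UNIV) (\<lambda>(t, x, y). f t x y) \<longleftrightarrow>
      continuous_on ({0..} \<times> {0..2 * pi} \<times> UNIV) (\<lambda>(t, x, y). g t x y)"
    using Suc.prems by (intro continuous_on_cong) auto
  ultimately show ?case
    by auto
qed

text \<open>Any candidates for the three derivatives may be supplied; \<open>Ck_cong\<close>
  replaces \<open>Dt\<close>, \<open>Dx\<close> and \<open>Dy\<close> by them, since they agree on
  the domain.\<close>

lemma Ck_SucI:
  assumes "continuous_on ({0..} \<times> {0..2 * pi} \<times> UNIV) (\<lambda>(t, x, y). f t x y)"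
    and t: "\<And>t x y. t \<ge> 0 \<Longrightarrow> x \<in> {0..2 * pi} \<Longrightarrow>
      ((\<lambda>r. f r x y) has_vector_derivative ft t x y) (at t within {0..})"
    and x: "\<And>t x y. t \<ge> 0 \<Longrightarrow> x \<in> {0..2 * pi} \<Longrightarrow>
      ((\<lambda>r. f t r y) has_vector_derivative fx t x y) (at x within {0..2 * pi})"
    and y: "\<And>t x y. t \<ge> 0 \<Longrightarrow> x \<in> {0..2 * pi} \<Longrightarrow>
      ((\<lambda>r. f t x r) has_vector_derivative fy t x y) (at y)"
    and "Ck k ft" "Ck k fx" "Ck k fy"
  shows "Ck (Suc k) f"
proof -
  have "Ck k (Dt f)" "Ck k (\<lambda>t. Dx (f t))" "Ck k (\<lambda>t. Dy (f t))"
    using assms(5-7)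
      Ck_cong[of "Dt f" ft, OF Dt_eqI[OF t]] Ck_cong[of "\<lambda>t. Dx (f t)" fx, OF Dx_eqI[OF x]]
      Ck_cong[of "\<lambda>t. Dy (f t)" fy, OF Dy_eqI[OF y]] by blast+
  then show ?thesis
    unfolding Ck.simps using assms(1)
    by (intro conjI allI ballI impI differentiableI_vector[OF t] differentiableI_vector[OF x]
        differentiableI_vector[OF y])
qed

lemma Ck_less: "Ck (Suc k) f \<Longrightarrow> Ck k f"
proof (induction k arbitrary: f)
  case (Suc k)
  then have "Ck k (Dt f)" "Ck k (\<lambda>t. Dx (f t))" "Ck k (\<lambda>t. Dy (f t))"
    by (blast intro: Suc.IH dest: Ck.simps(2)[THEN iffD1])+
  then show ?case
    using Suc.prems by simp
qed simp

lemma Ck_continuous_compose: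
  assumes "Ck k f" "continuous_on S a" "continuous_on S b" "continuous_on S c"
    and "\<And>z. z \<in> S \<Longrightarrow> a z \<ge> 0" "\<And>z. z \<in> S \<Longrightarrow> b z \<in> {0..2 * pi}"
  shows "continuous_on S (\<lambda>z. f (a z) (b z) (c z))"
proof -
  have "continuous_on S (\<lambda>z. (a z, b z, c z))"
    by (intro continuous_on_Pair assms)
  moreover have "(\<lambda>z. (a z, b z, c z)) ` S \<subseteq> {0..} \<times> {0..2 * pi} \<times> UNIV"
    using assms(5,6) by auto
  ultimately have "continuous_on S (\<lambda>z. (\<lambda>(t, x, y). f t x y) (a z, b z, c z))"
    by (rule continuous_on_compose2[OF Ck_continuous[OF assms(1)]])
  then show ?thesis
    by simp
qed

lemma Ck_const: "Ck k (\<lambda>t x y. c)"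
proof (induction k arbitrary: c)
  case (Suc k)
  show ?case
    by (rule Ck_SucI[OF _ has_vector_derivative_const has_vector_derivative_const
          has_vector_derivative_const Suc Suc Suc]) (simp add: case_prod_beta)
qed auto

lemma Ck_x: "Ck k (\<lambda>t x y. x)"
proof -
  have cont: "continuous_on ({0..} \<times> {0..2 * pi} \<times> UNIV) (\<lambda>(t :: real, x :: real, y :: real). x)"
    unfolding case_prod_beta by (intro continuous_intros)
  show ?thesis
  proof (induction k)
    case (Suc k)
    show ?case
      by (rule Ck_SucI[where ft = "\<lambda>_ _ _. 0" and fx = "\<lambda>_ _ _. 1" and fy = "\<lambda>_ _ _. 0",
            OF cont has_vector_derivative_const has_vector_derivative_id
            has_vector_derivative_const Ck_const Ck_const Ck_const])
  qed (simp add: cont)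
qed

lemma Ck_bounded_linear:
  assumes "bounded_linear L" "Ck k f"
  shows "Ck k (\<lambda>t x y. L (f t x y))"
  using assms(2)
proof (induction k arbitrary: f)
  case 0
  then show ?case
    using bounded_linear.continuous_on[OF assms(1) Ck_continuous[OF 0]] by (simp add: case_prod_beta)
next
  case (Suc k)
  then have *: "Ck k (\<lambda>t x y. L (Dt f t x y))" "Ck k (\<lambda>t x y. L (Dx (f t) x y))"
    "Ck k (\<lambda>t x y. L (Dy (f t) x y))"
    by (intro Suc.IH; simp)+
  show ?case
    by (rule Ck_SucI[OF _
          bounded_linear.has_vector_derivative[OF assms(1) Ck_derivatives(1)[OF Suc.prems]]
          bounded_linear.has_vector_derivative[OF assms(1) Ck_derivatives(2)[OF Suc.prems]]
          bounded_linear.has_vector_derivative[OF assms(1) Ck_derivatives(3)[OF Suc.prems]] *])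
      (use bounded_linear.continuous_on[OF assms(1) Ck_continuous[OF Suc.prems]] in
        \<open>simp add: case_prod_beta\<close>)
qed

lemma Ck_add:
  assumes "Ck k f" "Ck k g"
  shows "Ck k (\<lambda>t x y. f t x y + g t x y)"
  using assms
proof (induction k arbitrary: f g)
  case 0
  then show ?case
    using continuous_on_add[OF 0[THEN Ck_continuous]] by (simp add: case_prod_beta)
next
  case (Suc k)
  note f = Ck_derivatives[OF Suc.prems(1)] and g = Ck_derivatives[OF Suc.prems(2)]
  show ?case
    by (rule Ck_SucI[OF _ has_vector_derivative_add[OF f(1) g(1)]
          has_vector_derivative_add[OF f(2) g(2)] has_vector_derivative_add[OF f(3) g(3)]])
      (use continuous_on_add[OF Suc.prems[THEN Ck_continuous]] Suc.prems Suc.IH in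
        \<open>simp_all add: case_prod_beta\<close>)
qed

lemma Ck_mult:
  fixes f g :: "real \<Rightarrow> real \<Rightarrow> real \<Rightarrow> real"
  assumes "Ck k f" "Ck k g"
  shows "Ck k (\<lambda>t x y. f t x y * g t x y)"
  using assms
proof (induction k arbitrary: f g)
  case 0
  then show ?case
    using continuous_on_mult[OF 0[THEN Ck_continuous]] by (simp add: case_prod_beta)
next
  case (Suc k)
  note f = Ck_derivatives[OF Suc.prems(1)] and g = Ck_derivatives[OF Suc.prems(2)]
  note fg = Suc.prems[THEN Ck_less]
  have D: "Ck k (Dt f)" "Ck k (\<lambda>t. Dx (f t))" "Ck k (\<lambda>t. Dy (f t))"
    "Ck k (Dt g)" "Ck k (\<lambda>t. Dx (g t))" "Ck k (\<lambda>t. Dy (g t))"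
    using Suc.prems by simp_all
  show ?case
    by (rule Ck_SucI[OF _ has_vector_derivative_mult[OF f(1) g(1)]
          has_vector_derivative_mult[OF f(2) g(2)] has_vector_derivative_mult[OF f(3) g(3)]
          Ck_add[OF Suc.IH[OF fg(1) D(4)] Suc.IH[OF D(1) fg(2)]]
          Ck_add[OF Suc.IH[OF fg(1) D(5)] Suc.IH[OF D(2) fg(2)]]
          Ck_add[OF Suc.IH[OF fg(1) D(6)] Suc.IH[OF D(3) fg(2)]]])
      (use continuous_on_mult[OF Suc.prems[THEN Ck_continuous]] in \<open>simp_all add: case_prod_beta\<close>)
qed

lemma Ck_inverse:
  fixes f :: "real \<Rightarrow> real \<Rightarrow> real \<Rightarrow> real"
  assumes "Ck k f" and nz: "\<And>t x y. t \<ge> 0 \<Longrightarrow> x \<in> {0..2 * pi} \<Longrightarrow> f t x y \<noteq> 0"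
  shows "Ck k (\<lambda>t x y. inverse (f t x y))"
  using assms(1)
proof (induction k)
  case 0
  then show ?case
    unfolding Ck.simps case_prod_beta
    by (intro continuous_on_inverse Ck_continuous_compose[OF 0] continuous_intros) (use nz in force)+
next
  case (Suc k)
  note f = Ck_derivatives[OF Suc.prems]
  \<comment> \<open>The derivative is written as a product of \<open>d\<close> and reciprocals,
    without powers or quotients, so that \<open>Ck_mult\<close> and the induction hypothesis
    apply.\<close>
  have inv: "((\<lambda>r. inverse (h r)) has_vector_derivative - 1 * (d * (inverse (h s) * inverse (h s))))
      (at s within S)"
    if "(h has_vector_derivative d) (at s within S)" "h s \<noteq> 0" for h :: "real \<Rightarrow> real" and d s S
    using that unfolding has_real_derivative_iff_has_vector_derivative[symmetric]
    by (auto intro!: derivative_eq_intros simp: power2_eq_square)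
  have *: "Ck k (\<lambda>t x y. - 1 * (g t x y * (inverse (f t x y) * inverse (f t x y))))"
    if "Ck k g" for g
    using Suc.IH[OF Ck_less[OF Suc.prems]] that by (intro Ck_mult Ck_const)
  have D: "Ck k (Dt f)" "Ck k (\<lambda>t. Dx (f t))" "Ck k (\<lambda>t. Dy (f t))"
    using Suc.prems by simp_all
  show ?case
  proof (rule Ck_SucI[OF _ inv[OF f(1)] inv[OF f(2)] inv[OF f(3)] *[OF D(1)] *[OF D(2)] *[OF D(3)]])
    show "continuous_on ({0..} \<times> {0..2 * pi} \<times> UNIV) (\<lambda>(t, x, y). inverse (f t x y))"
      unfolding case_prod_beta
      by (intro continuous_on_inverse Ck_continuous_compose[OF Suc.prems] continuous_intros)
        (use nz in force)+
  qed (use nz in force)+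
qed

lemma Ck_trace:
  assumes "Ck k f"
  shows "Ck k (\<lambda>t x y. f t 0 y)"
  using assms
proof (induction k arbitrary: f)
  case 0
  then show ?case
    unfolding Ck.simps case_prod_beta
    by (intro Ck_continuous_compose[OF 0] continuous_intros) auto
next
  case (Suc k)
  note f = Ck_derivatives[OF Suc.prems]
  have *: "Ck k (\<lambda>t x y. Dt f t 0 y)" "Ck k (\<lambda>t x y. Dy (f t) 0 y)"
    by (rule Suc.IH; use Suc.prems in simp)+
  show ?case
  proof (rule Ck_SucI[OF _ f(1) has_vector_derivative_const f(3) *(1) Ck_const *(2)])
    show "continuous_on ({0..} \<times> {0..2 * pi} \<times> UNIV) (\<lambda>(t, x, y). f t 0 y)"
      unfolding case_prod_beta
      by (intro Ck_continuous_compose[OF Suc.prems] continuous_intros) auto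
  qed auto
qed

text \<open>Recover \<open>h\<close> from \<open>hs\<close> by the fundamental theorem of calculus,
  differentiate under the integral sign in \<open>r\<close>, and differentiate the resulting formula
  for \<open>hr\<close> in \<open>s\<close>. A general convex \<open>U\<close> covers both the time
  half-line and the interval for \<open>x\<close>.\<close>

lemma mixed_partials:
  fixes h :: "real \<Rightarrow> real \<Rightarrow> real"
  assumes U: "convex U" "r \<in> U" "at r within U \<noteq> bot" and s: "s \<in> {a..b}"
    and hs: "\<And>r s. r \<in> U \<Longrightarrow> s \<in> {a..b} \<Longrightarrow> (h r has_vector_derivative hs r s) (at s within {a..b})"
    and hr: "\<And>s. s \<in> {a..b} \<Longrightarrow> ((\<lambda>r. h r s) has_vector_derivative hr s) (at r within U)"
    and hsr: "\<And>r s. r \<in> U \<Longrightarrow> s \<in> {a..b} \<Longrightarrow>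
      ((\<lambda>r. hs r s) has_vector_derivative hsr r s) (at r within U)"
    and hs_cont: "\<And>r. r \<in> U \<Longrightarrow> continuous_on {a..b} (hs r)"
    and hsr_cont: "continuous_on (U \<times> {a..b}) (\<lambda>(r, s). hsr r s)"
  shows "(hr has_vector_derivative hsr r s) (at s within {a..b})"
proof -
  have hr_eq: "hr q = hr a + integral {a..q} (hsr r)" if q: "q \<in> {a..b}" for q
  proof -
    have h_eq: "h p q = h p a + integral {a..q} (hs p)" if "p \<in> U" for p
    proof -
      have "(hs p has_integral h p q - h p a) {a..q}"
        by (rule fundamental_theorem_of_calculus)
          (use q that in \<open>auto intro!: has_vector_derivative_within_subset[OF hs]\<close>)
      then show ?thesis
        by (simp add: integral_unique)
    qed
    have "((\<lambda>p. integral (cbox a q) (hs p)) has_vector_derivative integral (cbox a q) (hsr r))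
        (at r within U)"
    proof (rule leibniz_rule_vector_derivative)
      show "hs p integrable_on cbox a q" if "p \<in> U" for p
        using continuous_on_subset[OF hs_cont[OF that]] q
        by (intro integrable_continuous) auto
      show "continuous_on (U \<times> cbox a q) (\<lambda>(p, s). hsr p s)"
        by (rule continuous_on_subset[OF hsr_cont]) (use q in auto)
    qed (use q U hsr in auto)
    then have "((\<lambda>p. h p a + integral {a..q} (hs p)) has_vector_derivative
        hr a + integral {a..q} (hsr r)) (at r within U)"
      using q by (intro has_vector_derivative_add hr) auto
    then have "((\<lambda>p. h p q) has_vector_derivative hr a + integral {a..q} (hsr r)) (at r within U)"
      by (rule has_vector_derivative_transform[OF U(2), rotated]) (simp add: h_eq)
    then show ?thesis
      by (rule vector_derivative_unique_within[OF U(3) hr[OF q]])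
  qed
  have "continuous_on {a..b} (\<lambda>s. (r, s))" "(\<lambda>s. (r, s)) ` {a..b} \<subseteq> U \<times> {a..b}"
    using U by (auto intro!: continuous_intros)
  then have "continuous_on {a..b} (\<lambda>s. (\<lambda>(r, s). hsr r s) (r, s))"
    by (rule continuous_on_compose2[OF hsr_cont])
  then have "continuous_on {a..b} (hsr r)"
    by simp
  then have "((\<lambda>q. integral {a..q} (hsr r)) has_vector_derivative hsr r s) (at s within {a..b})"
    using s by (rule integral_has_vector_derivative)
  then have "((\<lambda>q. hr a + integral {a..q} (hsr r)) has_vector_derivative hsr r s) (at s within {a..b})"
    using has_vector_derivative_add[OF has_vector_derivative_const[of "hr a"]] by simp
  then show ?thesis
    by (rule has_vector_derivative_transform[OF s, rotated]) (rule hr_eq)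
qed

section \<open>The ring of smooth scalar fields\<close>

definition clamp :: "(real \<Rightarrow> real \<Rightarrow> real \<Rightarrow> 'a) \<Rightarrow> real \<Rightarrow> real \<Rightarrow> real \<Rightarrow> 'a" where
  "clamp f = (\<lambda>t x y. f (max 0 t) (max 0 (min x (2 * pi))) y)"

lemma clamp_dom: "t \<ge> 0 \<Longrightarrow> x \<in> {0..2 * pi} \<Longrightarrow> clamp f t x y = f t x y"
  by (simp add: clamp_def)

lemma clamp_clamp: "clamp (clamp f) = clamp f"
  by (auto simp: clamp_def fun_eq_iff)

lemma clamp_point: "max 0 t \<ge> (0::real)" "max 0 (min x (2 * pi)) \<in> {0..2 * pi}"
  by auto

lemma Ck_clamp: "Ck k (clamp f) \<longleftrightarrow> Ck k f"
  by (rule Ck_cong) (rule clamp_dom)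

text \<open>
  A function counts only on \<open>[0,\<infinity>) \<times> [0,2\<pi>] \<times> \<real>\<close>.  Requiring that it be extended by clamping its arguments
  to this domain makes equality of scalar fields equality on the domain, so that the equations of motion
  become identities in a commutative ring with commuting derivations.
\<close>

typedef sfield = "{f :: real \<Rightarrow> real \<Rightarrow> real \<Rightarrow> real.
    smooth f \<and> clamp f = f \<and> (\<forall>t x y. f t x (y + 2 * pi) = f t x y)}"
  morphisms val Abs_sfield
  by (rule exI[of _ "\<lambda>_ _ _. 0"]) (simp add: smooth_def Ck_const clamp_def)

setup_lifting type_definition_sfield

text \<open>The default \<open>0\<close> only makes the map total: \<open>val_embed\<close>
  evaluates it for smooth functions that are periodic in \<open>y\<close>.\<close>

lift_definition embed :: "(real \<Rightarrow> real \<Rightarrow> real \<Rightarrow> real) \<Rightarrow> sfield" is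
  "\<lambda>f. if smooth f \<and> (\<forall>t\<ge>0. periodic_y (f t)) then clamp f else (\<lambda>_ _ _. 0)"
  by (auto simp: smooth_def Ck_const Ck_clamp clamp_clamp clamp_def[where f = "\<lambda>_ _ _. _"])
    (auto simp: clamp_def periodic_y_def)

lemma val_embed:
  assumes "smooth f" "\<And>t. t \<ge> 0 \<Longrightarrow> periodic_y (f t)" "t \<ge> 0" "x \<in> {0..2 * pi}"
  shows "val (embed f) t x y = f t x y"
  using assms by (simp add: embed.rep_eq clamp_dom)

lemma Ck_val: "Ck k (val f)"
  using val[of f] by (simp add: smooth_def)

lemma val_clamp: "val f t x y = val f (max 0 t) (max 0 (min x (2 * pi))) y"
proof -
  have "val f t x y = clamp (val f) t x y"
    using val[of f] by simp
  then show ?thesis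
    by (simp add: clamp_def)
qed

lemma val_periodic: "val f t x (y + 2 * pi) = val f t x y"
  using val[of f] by simp

lemma sfield_eqI:
  assumes "\<And>t x y. t \<ge> 0 \<Longrightarrow> x \<in> {0..2 * pi} \<Longrightarrow> val f t x y = val g t x y"
  shows "f = g"
proof -
  have "val f = val g"
  proof (intro ext)
    fix t x y
    show "val f t x y = val g t x y"
      using val_clamp[of f t x y] val_clamp[of g t x y] assms[OF clamp_point] by metis
  qed
  then show ?thesis
    by (simp add: val_inject)
qed

instantiation sfield :: "{comm_ring_1, real_algebra_1}"
begin

lift_definition zero_sfield :: sfield is "\<lambda>_ _ _. 0"
  by (simp add: smooth_def Ck_const clamp_def)

lift_definition one_sfield :: sfield is "\<lambda>_ _ _. 1"
  by (simp add: smooth_def Ck_const clamp_def)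

lift_definition plus_sfield :: "sfield \<Rightarrow> sfield \<Rightarrow> sfield" is "\<lambda>f g t x y. f t x y + g t x y"
  by (auto simp: smooth_def Ck_add clamp_def fun_eq_iff)

lift_definition times_sfield :: "sfield \<Rightarrow> sfield \<Rightarrow> sfield" is "\<lambda>f g t x y. f t x y * g t x y"
  by (auto simp: smooth_def Ck_mult clamp_def fun_eq_iff)

lift_definition scaleR_sfield :: "real \<Rightarrow> sfield \<Rightarrow> sfield" is "\<lambda>c f t x y. c * f t x y"
  by (auto simp: smooth_def Ck_mult Ck_const clamp_def fun_eq_iff)

definition uminus_sfield :: "sfield \<Rightarrow> sfield" where "uminus_sfield f = (- 1) *\<^sub>R f"

definition minus_sfield :: "sfield \<Rightarrow> sfield \<Rightarrow> sfield" where "minus_sfield f g = f + - g"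

lemma val_uminus: "val (- f) t x y = - val f t x y"
  by (simp add: uminus_sfield_def scaleR_sfield.rep_eq)

lemmas val_ring = zero_sfield.rep_eq one_sfield.rep_eq plus_sfield.rep_eq times_sfield.rep_eq
  scaleR_sfield.rep_eq val_uminus

instance
proof
  have "val (0::sfield) 0 0 0 \<noteq> val (1::sfield) 0 0 0"
    by (simp add: val_ring)
  then show "(0::sfield) \<noteq> 1"
    by auto
qed (rule sfield_eqI, simp add: val_ring minus_sfield_def algebra_simps)+

end

lemma val_minus: "val (f - g) t x y = val f t x y - val g t x y"
  unfolding minus_sfield_def val_ring by simp

lemma val_power: "val (f ^ n) t x y = val f t x y ^ n"
  by (induction n) (simp_all add: val_ring)

lemma val_of_nat: "val (of_nat n) t x y = of_nat n"
  by (induction n) (simp_all add: val_ring)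

lemma val_numeral: "val (numeral n) t x y = numeral n"
  using val_of_nat[of "numeral n"] by simp

lemmas val_simps = val_ring val_minus val_power val_numeral

lemma smooth_clamp: "smooth (clamp f) \<longleftrightarrow> smooth f"
  by (simp add: smooth_def Ck_clamp)

lemma smooth_derivatives:
  assumes "smooth f"
  shows "smooth (Dt f)" "smooth (\<lambda>t. Dx (f t))" "smooth (\<lambda>t. Dy (f t))"
  unfolding smooth_def using assms[unfolded smooth_def, THEN spec, of "Suc _"] by simp_all

lift_definition dt :: "sfield \<Rightarrow> sfield" is "\<lambda>f. clamp (Dt f)"
  by (simp add: smooth_clamp smooth_derivatives clamp_clamp) (simp add: clamp_def Dt_def)

lift_definition dx :: "sfield \<Rightarrow> sfield" is "\<lambda>f. clamp (\<lambda>t. Dx (f t))"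
  by (simp add: smooth_clamp smooth_derivatives clamp_clamp) (simp add: clamp_def Dx_def)

lemma Dy_shift:
  assumes "smooth f" "t \<ge> 0" "x \<in> {0..2 * pi}"
    and "\<And>y. f t x (y + 2 * pi) = f t x y"
  shows "Dy (f t) x (y + 2 * pi) = Dy (f t) x y"
proof -
  have "Ck (Suc 0) f"
    using assms(1) smooth_def by blast
  from Ck_derivatives(3)[OF this assms(2,3)]
  have "(f t x has_vector_derivative Dy (f t) x (y + 2 * pi)) (at (y + 2 * pi))" .
  moreover have "((\<lambda>r. r + 2 * pi) has_vector_derivative 1) (at y)"
    by (auto intro!: derivative_eq_intros)
  ultimately have "(f t x \<circ> (\<lambda>r. r + 2 * pi) has_vector_derivative 1 *\<^sub>R Dy (f t) x (y + 2 * pi)) (at y)"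
    by (intro vector_diff_chain_at)
  then show ?thesis
    using Dy_eqI[of "f t" x _ y] assms(4) by (simp add: o_def)
qed

lift_definition dy :: "sfield \<Rightarrow> sfield" is "\<lambda>f. clamp (\<lambda>t. Dy (f t))"
proof -
  fix f :: "real \<Rightarrow> real \<Rightarrow> real \<Rightarrow> real"
  assume f: "smooth f \<and> clamp f = f \<and> (\<forall>t x y. f t x (y + 2 * pi) = f t x y)"
  have "clamp (\<lambda>t. Dy (f t)) t x (y + 2 * pi) = clamp (\<lambda>t. Dy (f t)) t x y" for t x y
    unfolding clamp_def using f by (intro Dy_shift clamp_point) auto
  with f show "smooth (clamp (\<lambda>t. Dy (f t))) \<and> clamp (clamp (\<lambda>t. Dy (f t))) = clamp (\<lambda>t. Dy (f t)) \<and>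
      (\<forall>t x y. clamp (\<lambda>t. Dy (f t)) t x (y + 2 * pi) = clamp (\<lambda>t. Dy (f t)) t x y)"
    by (simp add: smooth_clamp smooth_derivatives clamp_clamp)
qed

lemma has_derivative_val:
  assumes "t \<ge> 0" "x \<in> {0..2 * pi}"
  shows "((\<lambda>r. val f r x y) has_real_derivative val (dt f) t x y) (at t within {0..})"
    and "((\<lambda>r. val f t r y) has_real_derivative val (dx f) t x y) (at x within {0..2 * pi})"
    and "((\<lambda>r. val f t x r) has_real_derivative val (dy f) t x y) (at y)"
  using Ck_derivatives[OF Ck_val[of "Suc 0" f] assms] assms
  by (simp_all add: has_real_derivative_iff_has_vector_derivative dt.rep_eq dx.rep_eq dy.rep_eq clamp_dom)

lemma val_derivative_eqI:
  assumes "t \<ge> 0" "x \<in> {0..2 * pi}"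
  shows "((\<lambda>r. val f r x y) has_real_derivative d) (at t within {0..}) \<Longrightarrow> val (dt f) t x y = d"
    and "((\<lambda>r. val f t r y) has_real_derivative d) (at x within {0..2 * pi}) \<Longrightarrow> val (dx f) t x y = d"
    and "((\<lambda>r. val f t x r) has_real_derivative d) (at y) \<Longrightarrow> val (dy f) t x y = d"
  using assms
  by (auto simp: has_real_derivative_iff_has_vector_derivative dt.rep_eq dx.rep_eq dy.rep_eq clamp_dom
      intro: Dt_eqI Dx_eqI Dy_eqI)

lemma derivation_add: "dt (f + g) = dt f + dt g" "dx (f + g) = dx f + dx g" "dy (f + g) = dy f + dy g"
  by (rule sfield_eqI, rule val_derivative_eqI;
      auto simp: val_ring intro!: derivative_eq_intros has_derivative_val)+

lemma derivation_mult: "dt (f * g) = dt f * g + f * dt g" "dx (f * g) = dx f * g + f * dx g"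
    "dy (f * g) = dy f * g + f * dy g"
  by (rule sfield_eqI, rule val_derivative_eqI;
      auto simp: val_ring intro!: derivative_eq_intros has_derivative_val)+

lemma derivation_scaleR: "dt (c *\<^sub>R f) = c *\<^sub>R dt f" "dx (c *\<^sub>R f) = c *\<^sub>R dx f" "dy (c *\<^sub>R f) = c *\<^sub>R dy f"
  by (rule sfield_eqI, rule val_derivative_eqI;
      auto simp: val_ring intro!: derivative_eq_intros has_derivative_val)+

lemma derivation_minus: "dt (- f) = - dt f" "dx (- f) = - dx f" "dy (- f) = - dy f"
  unfolding uminus_sfield_def derivation_scaleR by (rule refl)+

lemma derivation_diff: "dt (f - g) = dt f - dt g" "dx (f - g) = dx f - dx g" "dy (f - g) = dy f - dy g"
  unfolding minus_sfield_def derivation_add derivation_minus by (rule refl)+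

lemma derivation_zero: "dt 0 = 0" "dx 0 = 0" "dy 0 = 0"
  using derivation_scaleR[of 0] by simp_all

lemma derivation_one: "dt 1 = 0" "dx 1 = 0" "dy 1 = 0"
  using derivation_mult[of 1 1] unfolding mult_1 mult_1_right by (metis add_cancel_left_left)+

lemma derivation_numeral: "dt (numeral n) = 0" "dx (numeral n) = 0" "dy (numeral n) = 0"
proof -
  have "numeral n = numeral n *\<^sub>R (1 :: sfield)"
    by (simp add: scaleR_conv_of_real)
  then show "dt (numeral n) = 0" "dx (numeral n) = 0" "dy (numeral n) = 0"
    by (metis derivation_scaleR derivation_one scaleR_zero_right)+
qed

lemmas derivation_simps = derivation_add derivation_mult derivation_scaleR derivation_minus
  derivation_diff derivation_zero derivation_one derivation_numeral

lemma continuous_on_val: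
  assumes "continuous_on S a" "continuous_on S b" "continuous_on S c"
  shows "continuous_on S (\<lambda>z. val f (a z) (b z) (c z))"
proof -
  have "continuous_on S (\<lambda>z. val f (max 0 (a z)) (max 0 (min (b z) (2 * pi))) (c z))"
    by (intro Ck_continuous_compose[OF Ck_val] continuous_intros assms clamp_point)
  then show ?thesis
    by (simp flip: val_clamp)
qed

lemma has_vector_derivative_val:
  assumes "t \<ge> 0" "x \<in> {0..2 * pi}"
  shows "((\<lambda>r. val f r x y) has_vector_derivative val (dt f) t x y) (at t within {0..})"
    and "((\<lambda>r. val f t r y) has_vector_derivative val (dx f) t x y) (at x within {0..2 * pi})"
    and "((\<lambda>r. val f t x r) has_vector_derivative val (dy f) t x y) (at y within S)"
  using has_derivative_val[OF assms, unfolded has_real_derivative_iff_has_vector_derivative]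
  by (auto intro: has_vector_derivative_at_within)

lemma dx_dt: "dx (dt f) = dt (dx f)"
proof (rule sfield_eqI)
  fix t x y :: real assume t: "t \<ge> 0" and x: "x \<in> {0..2 * pi}"
  have "((\<lambda>x. val (dt f) t x y) has_vector_derivative val (dt (dx f)) t x y) (at x within {0..2 * pi})"
    by (rule mixed_partials[where U = "{0..}" and h = "\<lambda>t x. val f t x y" and hs = "\<lambda>t x. val (dx f) t x y"
          and hsr = "\<lambda>t x. val (dt (dx f)) t x y"])
      (use t x within_nontrivial in \<open>auto simp: case_prod_beta intro!: has_vector_derivative_val
        continuous_on_val continuous_intros\<close>)
  then show "val (dx (dt f)) t x y = val (dt (dx f)) t x y"
    using val_derivative_eqI(2)[OF t x] has_real_derivative_iff_has_vector_derivative by blast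
qed

lemma dy_dt: "dy (dt f) = dt (dy f)"
proof (rule sfield_eqI)
  fix t x y :: real assume t: "t \<ge> 0" and x: "x \<in> {0..2 * pi}"
  \<comment> \<open>\<open>mixed_partials\<close> works on a compact interval in the second
    variable; one with \<open>y\<close> in its interior gives the two-sided derivative.\<close>
  have "((\<lambda>y. val (dt f) t x y) has_vector_derivative val (dt (dy f)) t x y) (at y within {y - 1..y + 1})"
    by (rule mixed_partials[where U = "{0..}" and h = "\<lambda>t y. val f t x y" and hs = "\<lambda>t y. val (dy f) t x y"
          and hsr = "\<lambda>t y. val (dt (dy f)) t x y"])
      (use t x within_nontrivial in \<open>auto simp: case_prod_beta intro!: has_vector_derivative_val
        continuous_on_val continuous_intros\<close>)
  then have "((\<lambda>y. val (dt f) t x y) has_vector_derivative val (dt (dy f)) t x y) (at y)"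
    by (simp add: at_within_Icc_at)
  then show "val (dy (dt f)) t x y = val (dt (dy f)) t x y"
    using val_derivative_eqI(3)[OF t x] has_real_derivative_iff_has_vector_derivative by blast
qed

lemma dy_dx: "dy (dx f) = dx (dy f)"
proof (rule sfield_eqI)
  fix t x y :: real assume t: "t \<ge> 0" and x: "x \<in> {0..2 * pi}"
  have "((\<lambda>y. val (dx f) t x y) has_vector_derivative val (dx (dy f)) t x y) (at y within {y - 1..y + 1})"
    by (rule mixed_partials[where U = "{0..2 * pi}" and h = "\<lambda>x y. val f t x y" and hs = "\<lambda>x y. val (dy f) t x y"
          and hsr = "\<lambda>x y. val (dx (dy f)) t x y"])
      (use t x within_nontrivial in \<open>auto simp: case_prod_beta intro!: has_vector_derivative_val
        continuous_on_val continuous_intros\<close>)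
  then have "((\<lambda>y. val (dx f) t x y) has_vector_derivative val (dx (dy f)) t x y) (at y)"
    by (simp add: at_within_Icc_at)
  then show "val (dy (dx f)) t x y = val (dx (dy f)) t x y"
    using val_derivative_eqI(3)[OF t x] has_real_derivative_iff_has_vector_derivative by blast
qed

lift_definition coord_x :: sfield is "clamp (\<lambda>t x y. x)"
  by (simp add: smooth_def Ck_clamp clamp_clamp Ck_x) (simp add: clamp_def)

text \<open>The boundary value at \<open>x = 0\<close>, continued constantly in \<open>x\<close>.
  Subtracting it from a field periodic in \<open>x\<close> gives a field that vanishes at both
  ends.\<close>

lift_definition trace_x :: "sfield \<Rightarrow> sfield" is "\<lambda>f t x y. f t 0 y"
proof -
  fix f :: "real \<Rightarrow> real \<Rightarrow> real \<Rightarrow> real"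
  assume f: "smooth f \<and> clamp f = f \<and> (\<forall>t x y. f t x (y + 2 * pi) = f t x y)"
  then have "clamp f t 0 y = f t 0 y" for t y
    by (simp only:)
  then have "f (max 0 t) 0 y = f t 0 y" for t y
    unfolding clamp_def by simp
  with f show "smooth (\<lambda>t x y. f t 0 y) \<and> clamp (\<lambda>t x y. f t 0 y) = (\<lambda>t x y. f t 0 y) \<and>
      (\<forall>t x y. f t 0 (y + 2 * pi) = f t 0 y)"
    by (simp add: smooth_def Ck_trace clamp_def)
qed

lemma dx_coord_x: "dx coord_x = 1"
proof (rule sfield_eqI, rule val_derivative_eqI)
  fix t x y :: real assume *: "t \<ge> 0" "x \<in> {0..2 * pi}"
  have "((\<lambda>r. r) has_real_derivative 1) (at x within {0..2 * pi})"
    by (auto intro!: derivative_eq_intros)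
  then show "((\<lambda>r. val coord_x t r y) has_real_derivative val 1 t x y) (at x within {0..2 * pi})"
    unfolding val_ring
    by (rule has_field_derivative_transform_within[of _ _ _ _ 1])
      (use * in \<open>auto simp: coord_x.rep_eq clamp_dom\<close>)
qed

lemma dx_trace_x: "dx (trace_x f) = 0"
  by (rule sfield_eqI, rule val_derivative_eqI) (auto simp: trace_x.rep_eq val_ring)

section \<open>Coefficients that depend on x only\<close>

definition coef :: "sfield \<Rightarrow> bool" where
  "coef c \<longleftrightarrow> (\<forall>t x y. val c t x y = val c 0 x 0)"

lemma coef_ring:
  "coef 0" "coef 1" "coef (numeral k)"
  "coef c \<Longrightarrow> coef d \<Longrightarrow> coef (c + d)" "coef c \<Longrightarrow> coef d \<Longrightarrow> coef (c - d)"
  "coef c \<Longrightarrow> coef d \<Longrightarrow> coef (c * d)" "coef c \<Longrightarrow> coef (- c)" "coef c \<Longrightarrow> coef (r *\<^sub>R c)"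
  "coef c \<Longrightarrow> coef (c ^ n)"
  unfolding coef_def val_simps by metis+

lemma coef_derivatives:
  assumes "coef c"
  shows "dt c = 0" "dy c = 0"
proof -
  have *: "(\<lambda>r. val c r x y) = (\<lambda>r. val c 0 x 0)" "(\<lambda>r. val c t x r) = (\<lambda>r. val c 0 x 0)" for t x y
    using assms unfolding coef_def by blast+
  have "((\<lambda>r. val c r x y) has_real_derivative 0) (at t within {0..})"
    "((\<lambda>r. val c t x r) has_real_derivative 0) (at y)" for t x y
    by (subst *(1), simp) (subst *(2), simp)
  then show "dt c = 0" "dy c = 0"
    by (auto intro!: sfield_eqI val_derivative_eqI simp: val_ring)
qed

lemma coef_dx:
  assumes "coef c"
  shows "coef (dx c)"
proof -
  have "(\<lambda>r. val c t r y) = (\<lambda>r. val c 0 r 0)" for t y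
    using assms unfolding coef_def by blast
  then have "Dx (val c t) x y = Dx (val c 0) x 0" for t x y
    unfolding Dx_def by (rule arg_cong)
  then show ?thesis
    by (simp add: coef_def dx.rep_eq clamp_def)
qed

text \<open>Continuity on a compact interval gives the bound there, and clamping carries it to all
  arguments, so that later estimates are free of domain conditions.\<close>

lemma coef_bounded:
  assumes "coef c"
  obtains M where "M > 0" "\<And>t x y. \<bar>val c t x y\<bar> \<le> M"
proof -
  have "compact ((\<lambda>x. val c 0 x 0) ` {0..2 * pi})"
    by (intro compact_continuous_image continuous_on_val continuous_intros) auto
  then obtain M where M: "M > 0" "\<And>x. x \<in> {0..2 * pi} \<Longrightarrow> \<bar>val c 0 x 0\<bar> \<le> M"
    by (metis (no_types, lifting) bounded_pos compact_imp_bounded image_eqI real_norm_def)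
  have "\<bar>val c t x y\<bar> \<le> M" for t x y
  proof -
    have "val c t x y = val c 0 (max 0 (min x (2 * pi))) 0"
      using assms val_clamp coef_def by metis
    then show ?thesis
      using M(2)[OF clamp_point(2)] by simp
  qed
  with M(1) that show thesis
    by blast
qed

lemma coef_embed:
  assumes "smooth (\<lambda>t x y. h x)"
  shows "coef (embed (\<lambda>t x y. h x))"
  using assms by (simp add: coef_def embed.rep_eq periodic_y_def clamp_def)

definition recip :: "sfield \<Rightarrow> sfield" where
  "recip f = embed (\<lambda>t x y. inverse (val f t x y))"

lemma val_recip:
  assumes "\<And>t x y. t \<ge> 0 \<Longrightarrow> x \<in> {0..2 * pi} \<Longrightarrow> val f t x y \<noteq> 0"
  shows "val (recip f) t x y = inverse (val f t x y)"
proof -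
  have "smooth (\<lambda>t x y. inverse (val f t x y))"
    "\<And>t. t \<ge> 0 \<Longrightarrow> periodic_y (\<lambda>x y. inverse (val f t x y))"
    using Ck_inverse[OF Ck_val[of _ f]] assms by (auto simp: smooth_def periodic_y_def val_periodic)
  then have *: "val (recip f) t x y = inverse (val f t x y)" if "t \<ge> 0" "x \<in> {0..2 * pi}" for t x y
    unfolding recip_def using that by (intro val_embed)
  show ?thesis
    using val_clamp[of "recip f" t x y] val_clamp[of f t x y] *[OF clamp_point] by simp
qed

lemma recip_mult:
  assumes "\<And>t x y. t \<ge> 0 \<Longrightarrow> x \<in> {0..2 * pi} \<Longrightarrow> val f t x y \<noteq> 0"
  shows "recip f * f = 1"
proof (rule sfield_eqI)
  fix t x y :: real assume "t \<ge> 0" "x \<in> {0..2 * pi}"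
  moreover have "val (recip f) t x y = inverse (val f t x y)"
    using assms by (rule val_recip)
  ultimately show "val (recip f * f) t x y = val 1 t x y"
    using assms by (simp add: val_ring)
qed

lemma coef_recip:
  assumes "coef f" "\<And>t x y. t \<ge> 0 \<Longrightarrow> x \<in> {0..2 * pi} \<Longrightarrow> val f t x y \<noteq> 0"
  shows "coef (recip f)"
proof -
  have "val (recip f) t x y = inverse (val f t x y)" for t x y
    using assms(2) by (rule val_recip)
  then show ?thesis
    using assms(1) unfolding coef_def by simp
qed

text \<open>The upper bound for the reciprocal, which is again a coefficient, is a lower bound for
  the coefficient.\<close>

lemma coef_bounded_below:
  assumes "coef f" "\<And>t x y. t \<ge> 0 \<Longrightarrow> x \<in> {0..2 * pi} \<Longrightarrow> 0 < val f t x y"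
  shows "\<exists>c>0. \<forall>t x y. c \<le> val f t x y"
proof -
  have nz: "val f t x y \<noteq> 0" if "t \<ge> 0" "x \<in> {0..2 * pi}" for t x y
    using assms(2)[OF that, of y] by simp
  have recip: "val (recip f) t x y = inverse (val f t x y)" for t x y
    using nz by (rule val_recip)
  have "coef (recip f)"
    using assms(1) nz by (rule coef_recip)
  then obtain M where M: "M > 0" "\<And>t x y. \<bar>val (recip f) t x y\<bar> \<le> M"
    using coef_bounded by metis
  have "inverse M \<le> val f t x y" for t x y
  proof -
    have pos: "0 < val f t x y"
      using assms(2)[OF clamp_point, of t x y] val_clamp[of f t x y] by simp
    then have "inverse (val f t x y) \<le> M"
      using M(2)[of t x y] unfolding recip by (simp add: abs_le_iff)
    then have "inverse M \<le> inverse (inverse (val f t x y))"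
      using pos by (intro le_imp_inverse_le) auto
    then show ?thesis
      by simp
  qed
  then show ?thesis
    using M(1) by (intro exI[of _ "inverse M"]) auto
qed

section \<open>Integration over the cell\<close>

text \<open>The gauge integral is convenient for differentiation under the integral sign and for
  exchanging the order of integration; \<open>integral_D_val\<close> identifies it with the Lebesgue
  integral used in the norms and in the supremum.\<close>

definition integ :: "sfield \<Rightarrow> real \<Rightarrow> real" where
  "integ f t = integral (cbox (0, 0) (2 * pi, 2 * pi)) (\<lambda>z. val f t (fst z) (snd z))"

lemma integrable_val: "(\<lambda>z. val f t (fst z) (snd z)) integrable_on cbox a b"
  by (intro integrable_continuous continuous_on_val continuous_intros)

lemma integ_linear:
  "integ (f + g) t = integ f t + integ g t" "integ (f - g) t = integ f t - integ g t"
  "integ (c *\<^sub>R f) t = c * integ f t" "integ (- f) t = - integ f t" "integ 0 t = 0"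
  unfolding integ_def val_simps
  by (simp_all add: integral_add integral_diff integrable_val)

lemma integ_mono:
  assumes "\<And>x y. val f t x y \<le> val g t x y"
  shows "integ f t \<le> integ g t"
  unfolding integ_def by (intro integral_le integrable_val) (simp add: assms)

lemma integ_nonneg: "(\<And>x y. 0 \<le> val f t x y) \<Longrightarrow> 0 \<le> integ f t"
  using integ_mono[of 0 t f] by (simp add: val_simps integ_linear)

lemma integ_bound:
  assumes "\<And>x y. val f t x y \<le> c * val g t x y"
  shows "integ f t \<le> c * integ g t"
  using integ_mono[of f t "c *\<^sub>R g"] assms by (simp add: val_simps integ_linear)

lemma integ_derivative:
  assumes "t \<ge> 0"
  shows "(integ f has_real_derivative integ (dt f) t) (at t within {0..})"
  unfolding integ_def[abs_def] has_real_derivative_iff_has_vector_derivative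
proof (rule leibniz_rule_vector_derivative)
  fix s :: real and z assume "s \<in> {0..}" "z \<in> cbox (0, 0) (2 * pi, 2 * pi)"
  then show "((\<lambda>s. val f s (fst z) (snd z)) has_vector_derivative val (dt f) s (fst z) (snd z))
      (at s within {0..})"
    by (intro has_vector_derivative_val) (auto simp: cbox_Pair_eq)
next
  show "continuous_on ({0..} \<times> cbox (0, 0) (2 * pi, 2 * pi)) (\<lambda>(t, z). val (dt f) t (fst z) (snd z))"
    unfolding case_prod_beta by (intro continuous_on_val continuous_intros)
qed (use assms in \<open>auto intro: integrable_val\<close>)

lemma integ_iterated:
  "integ f t = integral {0..2 * pi} (\<lambda>x. integral {0..2 * pi} (\<lambda>y. val f t x y))"
  "integ f t = integral {0..2 * pi} (\<lambda>y. integral {0..2 * pi} (\<lambda>x. val f t x y))"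
proof -
  have c: "continuous_on (cbox (0, 0) (2 * pi, 2 * pi)) (\<lambda>z. val f t (fst z) (snd z))"
    by (intro continuous_on_val continuous_intros)
  show *: "integ f t = integral {0..2 * pi} (\<lambda>x. integral {0..2 * pi} (\<lambda>y. val f t x y))"
    using integral_prod_continuous[OF c] by (simp add: integ_def)
  have "continuous_on (cbox (0, 0) (2 * pi, 2 * pi)) (\<lambda>(x, y). val f t x y)"
    unfolding case_prod_beta by (rule c)
  from integral_swap_continuous[OF this]
  show "integ f t = integral {0..2 * pi} (\<lambda>y. integral {0..2 * pi} (\<lambda>x. val f t x y))"
    unfolding * by simp
qed

lemma integ_dy: "t \<ge> 0 \<Longrightarrow> integ (dy f) t = 0"
proof -
  assume t: "t \<ge> 0"
  have "integral {0..2 * pi} (\<lambda>y. val (dy f) t x y) = 0" if "x \<in> {0..2 * pi}" for x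
  proof (rule integral_unique)
    have "((\<lambda>y. val (dy f) t x y) has_integral val f t x (2 * pi) - val f t x 0) {0..2 * pi}"
      by (rule fundamental_theorem_of_calculus) (auto intro!: has_vector_derivative_val t that)
    then show "((\<lambda>y. val (dy f) t x y) has_integral 0) {0..2 * pi}"
      using val_periodic[of f t x 0] by simp
  qed
  then show "integ (dy f) t = 0"
    unfolding integ_iterated(1) by (metis (no_types, lifting) integral_cong integral_0)
qed

definition perx :: "sfield \<Rightarrow> bool" where
  "perx f \<longleftrightarrow> (\<forall>t y. val f t 0 y = val f t (2 * pi) y)"

lemma integ_dx: "t \<ge> 0 \<Longrightarrow> perx f \<Longrightarrow> integ (dx f) t = 0"
proof -
  assume t: "t \<ge> 0" and f: "perx f"
  have "integral {0..2 * pi} (\<lambda>x. val (dx f) t x y) = 0" for y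
  proof (rule integral_unique)
    have "((\<lambda>x. val (dx f) t x y) has_integral val f t (2 * pi) y - val f t 0 y) {0..2 * pi}"
      by (rule fundamental_theorem_of_calculus) (auto intro!: has_vector_derivative_val t)
    then show "((\<lambda>x. val (dx f) t x y) has_integral 0) {0..2 * pi}"
      using f by (simp add: perx_def)
  qed
  then show "integ (dx f) t = 0"
    by (simp add: integ_iterated(2))
qed

lemma perx_ring:
  "perx f \<Longrightarrow> perx g \<Longrightarrow> perx (f + g)" "perx f \<Longrightarrow> perx g \<Longrightarrow> perx (f - g)"
  "perx f \<Longrightarrow> perx g \<Longrightarrow> perx (f * g)" "perx f \<Longrightarrow> perx (c *\<^sub>R f)" "perx f \<Longrightarrow> perx (- f)"
  "perx 0"
  by (simp_all add: perx_def val_simps)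

lemma perx_derivatives:
  assumes "perx f"
  shows "perx (dt f)" "perx (dy f)"
proof -
  have f: "(\<lambda>r. val f r 0 y) = (\<lambda>r. val f r (2 * pi) y)" "(\<lambda>r. val f t 0 r) = (\<lambda>r. val f t (2 * pi) r)" for t y
    using assms by (auto simp: perx_def)
  show "perx (dt f)"
    using f(1) by (simp add: perx_def dt.rep_eq clamp_def Dt_def)
  show "perx (dy f)"
    using f(2) by (simp add: perx_def dy.rep_eq clamp_def Dy_def)
qed

section \<open>Inequalities of Young, Poincare and Gronwall\<close>

lemma young:
  fixes a b e :: real
  assumes "e > 0"
  shows "2 * a * b \<le> e * a\<^sup>2 + b\<^sup>2 / e"
proof -
  have "0 \<le> (e * a - b)\<^sup>2 / e"
    using assms by simp
  also have "\<dots> = e * a\<^sup>2 + b\<^sup>2 / e - 2 * a * b"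
    using assms by (simp add: power2_eq_square field_simps)
  finally show ?thesis
    by simp
qed

text \<open>Integrate by parts against \<open>f - f(0, y)\<close>, which vanishes at both ends.\<close>

lemma poincare_dx:
  assumes "perx f" "t \<ge> 0"
  shows "integ ((dx f)\<^sup>2) t \<le> 16 * pi\<^sup>2 * integ ((dx (dx f))\<^sup>2) t"
proof -
  define G where "G = f - trace_x f"
  have dG: "dx G = dx f"
    by (simp add: G_def derivation_simps dx_trace_x)
  have G0: "val G t 0 y = 0" "val G t (2 * pi) y = 0" for t y
    using assms(1) by (simp_all add: G_def val_simps trace_x.rep_eq perx_def)
  \<comment> \<open>Both fields vanish at the two ends. The weight \<open>coord_x\<close> has
    derivative \<open>1\<close>, so the first identity isolates the integral of the square of
    \<open>G\<close>; the second moves one derivative from \<open>dx f\<close> to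
    \<open>G\<close>.\<close>
  have "integ (dx (coord_x * G * G)) t = 0" "integ (dx (G * dx f)) t = 0"
    by (rule integ_dx[OF assms(2)]; simp add: perx_def val_simps G0)+
  then have eq: "integ (G\<^sup>2) t = integ (- 2 * coord_x * G * dx f) t"
    "integ ((dx f)\<^sup>2) t = integ (- G * dx (dx f)) t"
    by (simp_all add: derivation_simps dG dx_coord_x integ_linear power2_eq_square algebra_simps)
  have X: "\<bar>val coord_x t x y\<bar> \<le> 2 * pi" for x y
    by (simp add: coord_x.rep_eq clamp_def)
  have "integ (G\<^sup>2) t \<le> integ ((1/2) *\<^sub>R G\<^sup>2 + (8 * pi\<^sup>2) *\<^sub>R (dx f)\<^sup>2) t"
    unfolding eq
  proof (rule integ_mono)
    fix x y
    let ?g = "val G t x y" and ?f = "val (dx f) t x y" and ?X = "val coord_x t x y"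
    have "2 * ?g * (- ?X * ?f) \<le> 1/2 * ?g\<^sup>2 + (- ?X * ?f)\<^sup>2 / (1/2)"
      by (rule young) simp
    moreover have "?X\<^sup>2 * ?f\<^sup>2 \<le> (2 * pi)\<^sup>2 * ?f\<^sup>2"
      using X[of x y] abs_le_square_iff[of ?X "2 * pi"] by (intro mult_right_mono) simp_all
    ultimately show "val (- 2 * coord_x * G * dx f) t x y \<le> val ((1/2) *\<^sub>R G\<^sup>2 + (8 * pi\<^sup>2) *\<^sub>R (dx f)\<^sup>2) t x y"
      by (simp add: val_simps power_mult_distrib algebra_simps)
  qed
  then have 1: "integ (G\<^sup>2) t \<le> 16 * pi\<^sup>2 * integ ((dx f)\<^sup>2) t"
    by (simp add: integ_linear)
  \<comment> \<open>The weight \<open>1 / (32 * pi\<^sup>2)\<close> is chosen so that, by the bound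
    on \<open>G\<close>, the first term is at most half of the left side and can be
    absorbed.\<close>
  have "integ ((dx f)\<^sup>2) t \<le> integ ((1 / (32 * pi\<^sup>2)) *\<^sub>R G\<^sup>2 + (8 * pi\<^sup>2) *\<^sub>R (dx (dx f))\<^sup>2) t"
    unfolding eq(2)
  proof (rule integ_mono)
    fix x y
    let ?g = "val G t x y" and ?f = "val (dx (dx f)) t x y"
    have "2 * ?g * (- ?f / 2) \<le> (1 / (32 * pi\<^sup>2)) * ?g\<^sup>2 + (- ?f / 2)\<^sup>2 / (1 / (32 * pi\<^sup>2))"
      by (rule young) simp
    then show "val (- G * dx (dx f)) t x y \<le> val ((1 / (32 * pi\<^sup>2)) *\<^sub>R G\<^sup>2 + (8 * pi\<^sup>2) *\<^sub>R (dx (dx f))\<^sup>2) t x y"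
      by (simp add: val_simps power_divide algebra_simps)
  qed
  also have "\<dots> \<le> (1 / (32 * pi\<^sup>2)) * (16 * pi\<^sup>2 * integ ((dx f)\<^sup>2) t) + 8 * pi\<^sup>2 * integ ((dx (dx f))\<^sup>2) t"
    unfolding integ_linear by (intro add_right_mono mult_left_mono 1) simp
  finally show ?thesis
    by simp
qed

text \<open>The product with \<open>exp (- c * t)\<close> is nonincreasing. The function may have
  either sign: \<open>energy_eq\<close> applies the lemma with \<open>c = 0\<close> to the energy
  and to its negative, which gives conservation.\<close>

lemma gronwall:
  fixes \<phi> \<phi>' :: "real \<Rightarrow> real"
  assumes deriv: "\<And>t. t \<ge> 0 \<Longrightarrow> (\<phi> has_real_derivative \<phi>' t) (at t within {0..})"
    and bound: "\<And>t. t \<ge> 0 \<Longrightarrow> \<phi>' t \<le> c * \<phi> t"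
    and "t \<ge> 0"
  shows "\<phi> t \<le> \<phi> 0 * exp (c * t)"
proof (cases "t = 0")
  case False
  define h where "h = (\<lambda>s. \<phi> s * exp (- c * s))"
  have h': "(h has_real_derivative (\<phi>' s - c * \<phi> s) * exp (- c * s)) (at s within {0..})" if "s \<ge> 0" for s
    unfolding h_def by (rule derivative_eq_intros deriv that | simp add: algebra_simps)+
  have "h t \<le> h 0"
  proof (rule DERIV_nonpos_imp_decreasing_open[of 0 t h])
    show "0 \<le> t"
      by (rule assms)
    show "\<exists>y. (h has_real_derivative y) (at s) \<and> y \<le> 0" if "0 < s" "s < t" for s
    proof (intro exI conjI)
      show "(h has_real_derivative (\<phi>' s - c * \<phi> s) * exp (- c * s)) (at s)"
        using h'[of s] that at_within_interior[of s "{0..}"] by (simp add: interior_real_atLeast)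
      show "(\<phi>' s - c * \<phi> s) * exp (- c * s) \<le> 0"
        using bound[of s] that by (simp add: mult_nonpos_nonneg)
    qed
    have "continuous_on {0..} h"
      using h' by (intro DERIV_continuous_on) auto
    then show "continuous_on {0..t} h"
      by (rule continuous_on_subset) auto
  qed
  then show ?thesis
    by (simp add: h_def exp_minus field_simps)
qed simp

lemma D_box: "D = cbox (0, 0) (2 * pi, 2 * pi)"
  by (simp add: D_def cbox_Pair_eq)

lemma set_integrable_D_val: "set_integrable lborel D (\<lambda>z. val g t (fst z) (snd z))"
  unfolding set_integrable_def D_box
  by (intro borel_integrable_compact continuous_on_val continuous_intros) auto

lemma integral_D_val:
  assumes "\<And>x y. x \<in> {0..2 * pi} \<Longrightarrow> y \<in> {0..2 * pi} \<Longrightarrow> f x y = val g t x y"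
  shows "integral_D f = integ g t"
proof -
  have "integral_D f = (LINT z:D|lborel. val g t (fst z) (snd z))"
    unfolding integral_D_def
  proof (rule set_lebesgue_integral_cong)
    show "D \<in> sets lborel"
      unfolding D_box by simp
  qed (auto simp: D_def assms)
  also have "\<dots> = integ g t"
    using set_borel_integral_eq_integral(2)[OF set_integrable_D_val] by (simp add: integ_def D_box)
  finally show ?thesis .
qed

section \<open>The linear system\<close>

lemma funpow_commute:
  assumes "\<And>f. a (b f) = b (a f)"
  shows "a ((b ^^ n) f) = (b ^^ n) (a f)" "(a ^^ m) ((b ^^ n) f) = (b ^^ n) ((a ^^ m) f)"
proof -
  show *: "a ((b ^^ n) f) = (b ^^ n) (a f)" for f
    by (induction n) (simp_all add: assms)
  show "(a ^^ m) ((b ^^ n) f) = (b ^^ n) ((a ^^ m) f)"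
    by (induction m) (simp_all add: *)
qed

lemmas dt_dx = dx_dt[symmetric] and dt_dy = dy_dt[symmetric] and dx_dy = dy_dx[symmetric]

lemma funpow_derivation:
  fixes d :: "sfield \<Rightarrow> sfield"
  assumes "\<And>f g. d (f + g) = d f + d g" "\<And>f. d (- f) = - d f" "\<And>c f. d (c *\<^sub>R f) = c *\<^sub>R d f"
  shows "(d ^^ n) (f + g) = (d ^^ n) f + (d ^^ n) g" "(d ^^ n) (- f) = - (d ^^ n) f"
    "(d ^^ n) (c *\<^sub>R f) = c *\<^sub>R (d ^^ n) f"
proof -
  show "(d ^^ n) (f + g) = (d ^^ n) f + (d ^^ n) g"
    by (induction n) (simp_all add: assms)
  show "(d ^^ n) (- f) = - (d ^^ n) f"
    by (induction n) (simp_all add: assms)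
  show "(d ^^ n) (c *\<^sub>R f) = c *\<^sub>R (d ^^ n) f"
    by (induction n) (simp_all add: assms)
qed

lemmas funpow_dt = funpow_derivation[of dt, OF derivation_add(1) derivation_minus(1) derivation_scaleR(1)]
lemmas funpow_dx = funpow_derivation[of dx, OF derivation_add(2) derivation_minus(2) derivation_scaleR(2)]
lemmas funpow_dy = funpow_derivation[of dy, OF derivation_add(3) derivation_minus(3) derivation_scaleR(3)]

lemma funpow_coef:
  assumes "coef c"
  shows "(dt ^^ n) (c * f) = c * (dt ^^ n) f" "(dy ^^ n) (c * f) = c * (dy ^^ n) f"
proof -
  show "(dt ^^ n) (c * f) = c * (dt ^^ n) f"
    by (induction n) (simp_all add: derivation_simps coef_derivatives[OF assms])
  show "(dy ^^ n) (c * f) = c * (dy ^^ n) f"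
    by (induction n) (simp_all add: derivation_simps coef_derivatives[OF assms])
qed

text \<open>\<open>M1\<close>, \<open>M2\<close>, \<open>M3\<close> are the components of \<open>B\<close>, and \<open>Q\<close> is the perturbation \<open>p + B\<^sub>0 \<bullet> B\<close> of the total pressure.\<close>

datatype var = Sigma | V1 | V2 | V3 | M1 | M2 | M3 | Q

lemma vars_except_Q: "- {Q} = {Sigma, V1, V2, V3, M1, M2, M3}"
proof (rule set_eqI)
  show "v \<in> - {Q} \<longleftrightarrow> v \<in> {Sigma, V1, V2, V3, M1, M2, M3}" for v
    by (cases v) auto
qed

type_synonym state = "var \<Rightarrow> sfield"

text \<open>
  \<open>\<kappa> = 0\<close> means incompressible flow; otherwise \<open>\<kappa> = 1 / (\<gamma> p\<^sub>0 + B\<^sub>0\<^sup>2)\<close> and \<open>c2 = \<gamma> p\<^sub>0 / \<rho>\<^sub>0\<close> is the square of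
  the speed of sound.  The equilibrium field is \<open>(b1, 0, bz)\<close>, where \<open>b1 = 0\<close> or \<open>bz = 0\<close>.
\<close>

locale linear_mhd =
  fixes rho irho kappa mu lam c2 bz w :: sfield and g b1 \<Lambda> :: real
  assumes coefs: "coef rho" "coef irho" "coef kappa" "coef mu" "coef lam" "coef c2" "coef bz" "coef w"
    and rho_pos: "\<exists>c>0. \<forall>t x y. c \<le> val rho t x y"
    and irho: "irho * rho = 1"
    and kappa_nonneg: "0 \<le> val kappa t x y"
    and mu: "mu * kappa * kappa = kappa"
    and lam: "dx kappa = lam * kappa"
    and w: "w * (1 - b1\<^sup>2 *\<^sub>R kappa) = 1"
    and w_pos: "\<exists>c>0. \<forall>t x y. c \<le> 1 - b1\<^sup>2 * val kappa t x y"
    and Lambda_pos: "\<Lambda> > 0"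
    and sup: "perx f \<Longrightarrow> t \<ge> 0 \<Longrightarrow>
      integ (kappa * (g *\<^sub>R (rho * f) - b1\<^sup>2 *\<^sub>R dx f)\<^sup>2 - b1\<^sup>2 *\<^sub>R (dx f)\<^sup>2 - g *\<^sub>R (dx rho * f\<^sup>2)) t
        \<le> \<Lambda>\<^sup>2 * integ (rho * f\<^sup>2) t"
begin

definition \<delta> :: "state \<Rightarrow> sfield" where "\<delta> u = dx (u V1) + dy (u V2)"

text \<open>This is the quantity \<open>m\<close> of the overview, whose square enters the density
  \<open>H\<close> with weight \<open>kappa\<close>.\<close>

definition pot :: "state \<Rightarrow> sfield" where "pot u = g *\<^sub>R (rho * u V1) - b1\<^sup>2 *\<^sub>R dx (u V1)"

text \<open>One system for all four types. With \<open>kappa = 0\<close> the fourth equation says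
  that the flow is divergence-free; otherwise it is the time derivative of the pressure law, solved
  for the divergence. The pressure law itself is kept because it bounds \<open>u Q\<close> by the
  data at time \<open>0\<close>.\<close>

definition sol :: "state \<Rightarrow> bool" where
  "sol u \<longleftrightarrow>
    rho * dt (u V1) = - dx (u Q) + b1 *\<^sub>R dx (u M1) + g *\<^sub>R u Sigma \<and>
    rho * dt (u V2) = - dy (u Q) + b1 *\<^sub>R dx (u M2) \<and>
    dt (u Sigma) = - (dx rho * u V1) - rho * \<delta> u \<and>
    \<delta> u = - (kappa * (dt (u Q) + pot u)) \<and>
    dt (u M1) = - (b1 *\<^sub>R dy (u V2)) \<and>
    dt (u M2) = b1 *\<^sub>R dx (u V2) \<and>
    rho * dt (u V3) = dx bz * u M1 \<and>
    dt (u M3) = - (dx bz * u V1) - bz * \<delta> u \<and>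
    (kappa = 0 \<or> u Q = c2 * u Sigma + bz * u M3 + b1 *\<^sub>R u M1) \<and>
    perx (u V1) \<and> perx (u V2) \<and> perx (u Q) \<and> perx (u M1) \<and> perx (u M2)"

lemmas coef_simps = coef_derivatives[OF coefs(1)] coef_derivatives[OF coefs(2)] coef_derivatives[OF coefs(3)]
  coef_derivatives[OF coefs(4)] coef_derivatives[OF coefs(5)] coef_derivatives[OF coefs(6)]
  coef_derivatives[OF coefs(7)] coef_derivatives[OF coefs(8)]
  coef_derivatives[OF coef_dx[OF coefs(1)]] coef_derivatives[OF coef_dx[OF coefs(7)]]

lemma solD:
  assumes "sol u"
  shows "rho * dt (u V1) = - dx (u Q) + b1 *\<^sub>R dx (u M1) + g *\<^sub>R u Sigma"
    and "rho * dt (u V2) = - dy (u Q) + b1 *\<^sub>R dx (u M2)"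
    and "dt (u Sigma) = - (dx rho * u V1) - rho * \<delta> u"
    and "\<delta> u = - (kappa * (dt (u Q) + pot u))"
    and "dt (u M1) = - (b1 *\<^sub>R dy (u V2))"
    and "dt (u M2) = b1 *\<^sub>R dx (u V2)"
    and "rho * dt (u V3) = dx bz * u M1"
    and "dt (u M3) = - (dx bz * u V1) - bz * \<delta> u"
    and "kappa \<noteq> 0 \<Longrightarrow> u Q = c2 * u Sigma + bz * u M3 + b1 *\<^sub>R u M1"
    and "perx (u V1)" "perx (u V2)" "perx (u Q)" "perx (u M1)" "perx (u M2)"
  using assms unfolding sol_def by blast+

text \<open>The coefficients depend on \<open>x\<close> only, so both derivations commute with the
  system, and they preserve periodicity in \<open>x\<close>. Every estimate thereby extends to
  derivatives in \<open>t\<close> and \<open>y\<close>.\<close>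

lemma sol_derivation:
  assumes "sol u" and D: "E \<in> {dt, dy}"
  shows "sol (\<lambda>i. E (u i))"
proof -
  have d: "E (f + f') = E f + E f'" "E (f - f') = E f - E f'" "E (- f) = - E f" "E (c *\<^sub>R f) = c *\<^sub>R E f"
    "E (f * f') = E f * f' + f * E f'" "E (dt f) = dt (E f)" "E (dx f) = dx (E f)" "E (dy f) = dy (E f)"
    "perx f \<Longrightarrow> perx (E f)" for f f' c
    using D by (auto simp: derivation_simps dx_dt dy_dt dx_dy perx_derivatives)
  have coef: "E rho = 0" "E kappa = 0" "E c2 = 0" "E bz = 0"
    using D coef_simps by auto
  have e: "E (\<delta> u) = \<delta> (\<lambda>i. E (u i))" "E (pot u) = pot (\<lambda>i. E (u i))"
    by (simp_all add: \<delta>_def pot_def d coef)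
  note eqs = solD(1-9)[OF assms(1), THEN arg_cong[where f = E],
      unfolded d(1-8) coef e derivation_zero mult_zero_left add_0_left]
  show ?thesis
    unfolding sol_def using eqs(1-8) eqs(9) solD(10-14)[OF assms(1), THEN d(9)] by blast
qed

lemma sol_dt: "sol u \<Longrightarrow> sol (\<lambda>i. dt (u i))" and sol_dy: "sol u \<Longrightarrow> sol (\<lambda>i. dy (u i))"
  by (rule sol_derivation; simp)+

lemma sol_funpow: "sol u \<Longrightarrow> sol (\<lambda>i. (dy ^^ j) ((dt ^^ m) (u i)))"
proof -
  assume "sol u"
  then have "sol (\<lambda>i. (dt ^^ m) (u i))" for m
    by (induction m) (auto dest: sol_dt)
  then show ?thesis
    by (induction j) (auto dest: sol_dy)
qed

section \<open>Weighted norms and uniform bounds by the data\<close>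

definition N :: "sfield \<Rightarrow> real \<Rightarrow> real" where "N f t = integ (rho * f\<^sup>2) t"

text \<open>The square of the Sobolev norm of the initial values. \<open>Q\<close> is left out
  because the right side of the final estimate contains only density, velocity and magnetic
  field.\<close>

definition dat :: "nat \<Rightarrow> state \<Rightarrow> real" where
  "dat k u = (\<Sum>(i, j)\<in>{(i, j). i + j \<le> k}. \<Sum>v\<in>- {Q}.
     N ((dx ^^ i) ((dy ^^ j) (u v))) 0)"

lemma rho_nonneg: "0 \<le> val rho t x y"
  using rho_pos by (meson less_imp_le order_trans)

lemma N_nonneg: "0 \<le> N f t"
  unfolding N_def by (rule integ_nonneg) (simp add: val_simps rho_nonneg)

lemma N_add: "N (f + f') t \<le> 2 * N f t + 2 * N f' t"
proof -
  have "N (f + f') t \<le> integ (2 *\<^sub>R (rho * f\<^sup>2) + 2 *\<^sub>R (rho * f'\<^sup>2)) t"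
    unfolding N_def
  proof (rule integ_mono)
    fix x y
    have "(val f t x y + val f' t x y)\<^sup>2 \<le> 2 * (val f t x y)\<^sup>2 + 2 * (val f' t x y)\<^sup>2"
      using zero_le_power2[of "val f t x y - val f' t x y"] by (simp add: power2_eq_square algebra_simps)
    from mult_left_mono[OF this rho_nonneg[of t x y]]
    show "val (rho * (f + f')\<^sup>2) t x y \<le> val (2 *\<^sub>R (rho * f\<^sup>2) + 2 *\<^sub>R (rho * f'\<^sup>2)) t x y"
      by (simp add: val_simps algebra_simps)
  qed
  then show ?thesis
    by (simp add: integ_linear N_def)
qed

lemma N_scaleR: "N (c *\<^sub>R f) t = c\<^sup>2 * N f t"
proof -
  have "rho * (c *\<^sub>R f)\<^sup>2 = c\<^sup>2 *\<^sub>R (rho * f\<^sup>2)"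
    by (simp add: power2_eq_square algebra_simps)
  then show ?thesis
    by (simp add: N_def integ_linear)
qed

lemma N_minus: "N (- f) t = N f t"
  by (simp add: N_def)

lemma N_coef:
  assumes "coef c"
  obtains M where "M \<ge> 0" "\<And>f t. N (c * f) t \<le> M * N f t"
proof -
  obtain M where M: "M > 0" "\<And>t x y. \<bar>val c t x y\<bar> \<le> M"
    using coef_bounded[OF assms] by metis
  have "N (c * f) t \<le> M\<^sup>2 * N f t" for f t
    unfolding N_def
  proof (rule integ_bound)
    fix x y
    have "(val c t x y)\<^sup>2 \<le> M\<^sup>2"
      using M abs_le_square_iff[of "val c t x y" M] by (simp add: abs_of_pos)
    then have "(val c t x y)\<^sup>2 * (val rho t x y * (val f t x y)\<^sup>2) \<le> M\<^sup>2 * (val rho t x y * (val f t x y)\<^sup>2)"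
      by (intro mult_right_mono) (auto simp: rho_nonneg)
    then show "val (rho * (c * f)\<^sup>2) t x y \<le> M\<^sup>2 * val (rho * f\<^sup>2) t x y"
      by (simp add: val_simps power_mult_distrib algebra_simps)
  qed
  then show thesis
    using that[of "M\<^sup>2"] by simp
qed

lemma N_derivative:
  assumes "t \<ge> 0"
  shows "(N f has_real_derivative 2 * integ (rho * f * dt f) t) (at t within {0..})"
proof -
  have "dt (rho * f\<^sup>2) = 2 *\<^sub>R (rho * f * dt f)"
    by (simp add: derivation_simps coef_simps power2_eq_square scaleR_2 algebra_simps)
  with integ_derivative[OF assms, of "rho * f\<^sup>2"] show ?thesis
    by (simp add: integ_linear N_def[abs_def])
qed

text \<open>The weight \<Lambda> is the one for which the two terms balance when the norm of
  \<open>h\<close> is \<Lambda> times that of \<open>f\<close>. This is why the final rate is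
  exactly \<Lambda>.\<close>

lemma N_young: "2 * integ (rho * f * h) t \<le> \<Lambda> * N f t + N h t / \<Lambda>"
proof -
  have "integ (2 *\<^sub>R (rho * f * h)) t \<le> integ (\<Lambda> *\<^sub>R (rho * f\<^sup>2) + (1 / \<Lambda>) *\<^sub>R (rho * h\<^sup>2)) t"
  proof (rule integ_mono)
    fix x y
    from mult_left_mono[OF young[OF Lambda_pos, of "val f t x y" "val h t x y"] rho_nonneg[of t x y]]
    show "val (2 *\<^sub>R (rho * f * h)) t x y \<le> val (\<Lambda> *\<^sub>R (rho * f\<^sup>2) + (1 / \<Lambda>) *\<^sub>R (rho * h\<^sup>2)) t x y"
      by (simp add: val_simps algebra_simps)
  qed
  then show ?thesis
    by (simp add: integ_linear N_def)
qed

text \<open>By \<open>N_young\<close> the homogeneous part of the inequality for \<open>N f\<close>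
  has rate only \<Lambda>, which is below the rate 2 \<Lambda> of the forcing. Integration in time
  therefore preserves the rate and produces no power of \<open>t\<close>.\<close>

lemma N_time_integration:
  assumes "t \<ge> 0" and bound: "\<And>t. t \<ge> 0 \<Longrightarrow> N (dt f) t \<le> A * exp (2 * \<Lambda> * t)"
  shows "N f t \<le> (N f 0 + A / \<Lambda>\<^sup>2) * exp (2 * \<Lambda> * t)"
proof -
  have "0 \<le> A"
    using N_nonneg[of "dt f" 0] bound[of 0] by simp
  have *: "2 * integ (rho * f * dt f) t \<le> \<Lambda> * N f t + A / \<Lambda> * exp (2 * \<Lambda> * t)" if "t \<ge> 0" for t
    using N_young[of f "dt f" t] divide_right_mono[OF bound[OF that], of \<Lambda>] Lambda_pos by simp
  \<comment> \<open>A particular solution is subtracted: the derivative of the subtracted term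
    exceeds \<Lambda> times that term by exactly the forcing
    \<open>A / \<Lambda> * exp (2 * \<Lambda> * t)\<close>.\<close>
  define \<psi> where "\<psi> = (\<lambda>t. N f t - A / \<Lambda>\<^sup>2 * exp (2 * \<Lambda> * t))"
  have "\<psi> t \<le> \<psi> 0 * exp (\<Lambda> * t)"
  proof (rule gronwall[OF _ _ assms(1)])
    fix t :: real assume t: "t \<ge> 0"
    show "(\<psi> has_real_derivative 2 * integ (rho * f * dt f) t - A / \<Lambda>\<^sup>2 * (exp (2 * \<Lambda> * t) * (2 * \<Lambda>))) (at t within {0..})"
      unfolding \<psi>_def by (rule derivative_eq_intros N_derivative t refl | simp)+
    show "2 * integ (rho * f * dt f) t - A / \<Lambda>\<^sup>2 * (exp (2 * \<Lambda> * t) * (2 * \<Lambda>)) \<le> \<Lambda> * \<psi> t"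
    proof -
      have "A / \<Lambda>\<^sup>2 * (exp (2 * \<Lambda> * t) * (2 * \<Lambda>)) = 2 * (A / \<Lambda> * exp (2 * \<Lambda> * t))"
        "\<Lambda> * \<psi> t = \<Lambda> * N f t - A / \<Lambda> * exp (2 * \<Lambda> * t)"
        using Lambda_pos by (simp_all add: \<psi>_def power2_eq_square field_simps)
      with *[OF t] show ?thesis
        by linarith
    qed
  qed
  also have "\<dots> \<le> N f 0 * exp (\<Lambda> * t)"
    using \<open>0 \<le> A\<close> by (intro mult_right_mono) (simp_all add: \<psi>_def)
  also have "\<dots> \<le> N f 0 * exp (2 * \<Lambda> * t)"
    using assms(1) Lambda_pos by (intro mult_left_mono N_nonneg) simp
  finally show ?thesis
    by (simp add: \<psi>_def algebra_simps)
qed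

lemma finite_le_pairs: "finite {(i, j). i + j \<le> (k :: nat)}"
  by (rule finite_subset[of _ "{..k} \<times> {..k}"]) auto

lemma dat_nonneg: "0 \<le> dat k u"
  unfolding dat_def by (intro sum_nonneg) (auto intro: sum_nonneg N_nonneg)

lemma dat_mono: "k \<le> l \<Longrightarrow> dat k u \<le> dat l u"
  unfolding dat_def
  by (rule sum_mono2[OF finite_le_pairs]) (auto intro: sum_nonneg N_nonneg)

lemma N_le_dat:
  assumes "i + j \<le> k" "v \<noteq> Q"
  shows "N ((dx ^^ i) ((dy ^^ j) (u v))) 0 \<le> dat k u"
proof -
  have "N ((dx ^^ i) ((dy ^^ j) (u v))) 0 \<le>
      (\<Sum>v\<in>- {Q}. N ((dx ^^ i) ((dy ^^ j) (u v))) 0)"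
    by (rule member_le_sum) (use assms vars_except_Q in \<open>auto intro: N_nonneg\<close>)
  also have "\<dots> \<le> dat k u"
    unfolding dat_def
    using member_le_sum[of "(i, j)" "{(i, j). i + j \<le> k}"
        "\<lambda>(i, j). \<Sum>v\<in>- {Q}. N ((dx ^^ i) ((dy ^^ j) (u v))) 0"]
      assms(1) finite_le_pairs by (auto intro: sum_nonneg N_nonneg)
  finally show ?thesis .
qed

text \<open>
  All estimates are for squared norms.  \<open>T\<close> is \<open>{0..}\<close>, or \<open>{0}\<close> for estimates of the initial values, and \<open>k\<close> is
  the number of derivatives of the data on which a bound depends.  In \<open>Bds\<close> and \<open>Bdx\<close> below, \<open>k\<close> counts only
  those in excess of the derivatives being estimated, of which at most \<open>n\<close> are in \<open>x\<close>.
\<close>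

definition Bd :: "real set \<Rightarrow> nat \<Rightarrow> (state \<Rightarrow> sfield) \<Rightarrow> bool" where
  "Bd T k F \<longleftrightarrow> (\<exists>C\<ge>0. \<forall>u. sol u \<longrightarrow> (\<forall>t\<in>T. N (F u) t \<le> C * exp (2 * \<Lambda> * t) * dat k u))"

lemma Bd_cong: "(\<And>u. sol u \<Longrightarrow> F u = G u) \<Longrightarrow> Bd T k F \<longleftrightarrow> Bd T k G"
  by (auto simp: Bd_def)

lemma Bd_mono:
  assumes "Bd T k F" "k \<le> l"
  shows "Bd T l F"
proof -
  obtain C where C: "C \<ge> 0" "\<And>u t. sol u \<Longrightarrow> t \<in> T \<Longrightarrow> N (F u) t \<le> C * exp (2 * \<Lambda> * t) * dat k u"
    using assms(1) by (auto simp: Bd_def)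
  then have "N (F u) t \<le> C * exp (2 * \<Lambda> * t) * dat l u" if "sol u" "t \<in> T" for u t
    using C(2)[OF that] mult_left_mono[OF dat_mono[OF assms(2), of u], of "C * exp (2 * \<Lambda> * t)"] C(1)
    by simp
  with C(1) show ?thesis
    by (auto simp: Bd_def)
qed

lemma Bd_add:
  assumes "Bd T k F" "Bd T k G"
  shows "Bd T k (\<lambda>u. F u + G u)"
proof -
  obtain C C' where C: "C \<ge> 0" "\<And>u t. sol u \<Longrightarrow> t \<in> T \<Longrightarrow> N (F u) t \<le> C * exp (2 * \<Lambda> * t) * dat k u"
    "C' \<ge> 0" "\<And>u t. sol u \<Longrightarrow> t \<in> T \<Longrightarrow> N (G u) t \<le> C' * exp (2 * \<Lambda> * t) * dat k u"
    using assms by (auto simp: Bd_def)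
  have "N (F u + G u) t \<le> (2 * C + 2 * C') * exp (2 * \<Lambda> * t) * dat k u" if "sol u" "t \<in> T" for u t
    using N_add[of "F u" "G u" t] C(2)[OF that] C(4)[OF that] by (simp add: algebra_simps)
  with C(1,3) show ?thesis
    unfolding Bd_def by (intro exI[of _ "2 * C + 2 * C'"]) auto
qed

lemma Bd_le:
  assumes "Bd T k F" "K \<ge> 0" "\<And>u t. sol u \<Longrightarrow> t \<in> T \<Longrightarrow> N (G u) t \<le> K * N (F u) t"
  shows "Bd T k G"
proof -
  obtain C where C: "C \<ge> 0" "\<And>u t. sol u \<Longrightarrow> t \<in> T \<Longrightarrow> N (F u) t \<le> C * exp (2 * \<Lambda> * t) * dat k u"
    using assms(1) by (auto simp: Bd_def)
  have "N (G u) t \<le> (K * C) * exp (2 * \<Lambda> * t) * dat k u" if "sol u" "t \<in> T" for u t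
    using assms(3)[OF that] mult_left_mono[OF C(2)[OF that] assms(2)] by (simp add: algebra_simps)
  then show ?thesis
    unfolding Bd_def using C(1) assms(2) by (intro exI[of _ "K * C"]) auto
qed

lemma Bd_coef: "coef c \<Longrightarrow> Bd T k F \<Longrightarrow> Bd T k (\<lambda>u. c * F u)"
  by (erule N_coef) (rule Bd_le; blast)

lemma Bd_scaleR: "Bd T k F \<Longrightarrow> Bd T k (\<lambda>u. r *\<^sub>R F u)"
  by (erule Bd_le[where K = "r\<^sup>2"]) (simp_all add: N_scaleR)

lemma Bd_minus: "Bd T k F \<Longrightarrow> Bd T k (\<lambda>u. - F u)"
  by (erule Bd_le[where K = 1]) (simp_all add: N_minus)

lemma Bd_time_integration:
  assumes "Bd {0..} k (\<lambda>u. dt (F u))" "Bd {0} k F"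
  shows "Bd {0..} k F"
proof -
  obtain C where C: "C \<ge> 0" "\<And>u t. sol u \<Longrightarrow> t \<ge> 0 \<Longrightarrow> N (dt (F u)) t \<le> C * exp (2 * \<Lambda> * t) * dat k u"
    using assms(1) by (auto simp: Bd_def)
  obtain C' where C': "C' \<ge> 0" "\<And>u. sol u \<Longrightarrow> N (F u) 0 \<le> C' * dat k u"
    using assms(2) by (auto simp: Bd_def)
  have "N (F u) t \<le> (C' + C / \<Lambda>\<^sup>2) * exp (2 * \<Lambda> * t) * dat k u" if "sol u" "t \<ge> 0" for u t
  proof -
    have "N (F u) t \<le> (N (F u) 0 + C * dat k u / \<Lambda>\<^sup>2) * exp (2 * \<Lambda> * t)"
      by (rule N_time_integration) (use C(2)[OF that(1)] that in \<open>auto simp: algebra_simps\<close>)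
    also have "\<dots> \<le> (C' * dat k u + C * dat k u / \<Lambda>\<^sup>2) * exp (2 * \<Lambda> * t)"
      by (intro mult_right_mono add_right_mono C' that) auto
    finally show ?thesis
      by (simp add: algebra_simps)
  qed
  then show ?thesis
    unfolding Bd_def using C(1) C'(1) by (intro exI[of _ "C' + C / \<Lambda>\<^sup>2"]) auto
qed

definition Bds :: "real set \<Rightarrow> nat \<Rightarrow> nat \<Rightarrow> (state \<Rightarrow> sfield) \<Rightarrow> bool" where
  "Bds T n k F \<longleftrightarrow> (\<forall>i j. i \<le> n \<longrightarrow> Bd T (i + j + k) (\<lambda>u. (dx ^^ i) ((dy ^^ j) (F u))))"

definition Bdx :: "real set \<Rightarrow> nat \<Rightarrow> nat \<Rightarrow> (state \<Rightarrow> sfield) \<Rightarrow> bool" where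
  "Bdx T n k F \<longleftrightarrow> (\<forall>m. Bds T n (k + m) (\<lambda>u. (dt ^^ m) (F u)))"

lemma Bds_cong: "(\<And>u. sol u \<Longrightarrow> F u = G u) \<Longrightarrow> Bds T n k F \<longleftrightarrow> Bds T n k G"
  unfolding Bds_def using Bd_cong[of "\<lambda>u. (dx ^^ _) ((dy ^^ _) (F u))" "\<lambda>u. (dx ^^ _) ((dy ^^ _) (G u))"]
  by simp

lemma Bds_mono: "Bds T n k F \<Longrightarrow> k \<le> l \<Longrightarrow> n' \<le> n \<Longrightarrow> Bds T n' l F"
  unfolding Bds_def by (meson Bd_mono add_left_mono order_trans)

lemma Bds_add: "Bds T n k F \<Longrightarrow> Bds T n k G \<Longrightarrow> Bds T n k (\<lambda>u. F u + G u)"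
  unfolding Bds_def by (simp add: funpow_dx funpow_dy Bd_add)

lemma Bds_scaleR: "Bds T n k F \<Longrightarrow> Bds T n k (\<lambda>u. r *\<^sub>R F u)"
  unfolding Bds_def by (simp add: funpow_dx funpow_dy Bd_scaleR)

lemma Bds_minus: "Bds T n k F \<Longrightarrow> Bds T n k (\<lambda>u. - F u)"
  unfolding Bds_def by (simp add: funpow_dx funpow_dy Bd_minus)

text \<open>Induction with the product rule. The count \<open>k\<close> stays fixed, because
  derivatives that fall on the coefficient only lower the order of those on
  \<open>F u\<close>.\<close>

lemma Bd_leibniz:
  assumes "coef c" "\<And>i'. i' \<le> i \<Longrightarrow> Bd T k (\<lambda>u. (dx ^^ i') (F u))"
  shows "Bd T k (\<lambda>u. (dx ^^ i) (c * F u))"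
  using assms
proof (induction i arbitrary: c F)
  case 0
  then show ?case
    using Bd_coef by force
next
  case (Suc i)
  have "Bd T k (\<lambda>u. (dx ^^ i) (dx c * F u))"
    using Suc.prems by (intro Suc.IH coef_dx) auto
  moreover have "Bd T k (\<lambda>u. (dx ^^ i) (c * dx (F u)))"
    using Suc.prems(2)[of "Suc _"] by (intro Suc.IH Suc.prems) (simp add: funpow_swap1)
  ultimately show ?case
    using Bd_add[of T k] by (simp add: funpow_Suc_right derivation_simps funpow_dx del: funpow.simps)
qed

lemma Bds_coef: "coef c \<Longrightarrow> Bds T n k F \<Longrightarrow> Bds T n k (\<lambda>u. c * F u)"
  unfolding Bds_def funpow_coef(2)
  by (intro allI impI Bd_leibniz) (meson Bd_mono add_right_mono order_trans)+

lemma Bds_diff: "Bds T n k F \<Longrightarrow> Bds T n k G \<Longrightarrow> Bds T n k (\<lambda>u. F u - G u)"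
  using Bds_add[of T n k F "\<lambda>u. - G u"] Bds_minus by simp

lemma Bds_dy:
  assumes "Bds T n k F"
  shows "Bds T n (Suc k) (\<lambda>u. dy (F u))"
  unfolding Bds_def
proof (intro allI impI)
  fix i j assume "i \<le> n"
  then have "Bd T (i + Suc j + k) (\<lambda>u. (dx ^^ i) ((dy ^^ Suc j) (F u)))"
    using assms unfolding Bds_def by blast
  then show "Bd T (i + j + Suc k) (\<lambda>u. (dx ^^ i) ((dy ^^ j) (dy (F u))))"
    by (simp add: funpow_swap1)
qed

lemma funpow_dx_dy_dx: "(dx ^^ i) ((dy ^^ j) (dx f)) = (dx ^^ Suc i) ((dy ^^ j) f)"
  using funpow_commute(1)[of dx dy j f, OF dx_dy] by (simp add: funpow_swap1)

lemma Bds_dx: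
  assumes "Bds T (Suc n) k F"
  shows "Bds T n (Suc k) (\<lambda>u. dx (F u))"
  unfolding Bds_def
proof (intro allI impI)
  fix i j assume "i \<le> n"
  then have "Bd T (Suc i + j + k) (\<lambda>u. (dx ^^ Suc i) ((dy ^^ j) (F u)))"
    using assms unfolding Bds_def by (meson Suc_le_mono)
  then show "Bd T (i + j + Suc k) (\<lambda>u. (dx ^^ i) ((dy ^^ j) (dx (F u))))"
    by (simp only: funpow_dx_dy_dx add_Suc add_Suc_right)
qed

text \<open>This is the induction step for regularity in \<open>x\<close>: once the tangential bound
  is known, it suffices to express \<open>dx (F u)\<close> by quantities already bounded.\<close>

lemma Bds_Suc:
  assumes "Bds T 0 k F" "Bds T n (Suc k) (\<lambda>u. dx (F u))"
  shows "Bds T (Suc n) k F"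
  unfolding Bds_def
proof (intro allI impI)
  fix i j assume i: "i \<le> Suc n"
  show "Bd T (i + j + k) (\<lambda>u. (dx ^^ i) ((dy ^^ j) (F u)))"
  proof (cases i)
    case 0
    then show ?thesis
      using assms(1) unfolding Bds_def by blast
  next
    case (Suc l)
    then have "Bd T (l + j + Suc k) (\<lambda>u. (dx ^^ l) ((dy ^^ j) (dx (F u))))"
      using assms(2) i unfolding Bds_def by (meson Suc_le_mono)
    then show ?thesis
      by (simp only: Suc funpow_dx_dy_dx add_Suc add_Suc_right)
  qed
qed

end

section \<open>Initial time derivatives\<close>

lemma sum_uniform_bound:
  fixes f :: "'a \<Rightarrow> 'b \<Rightarrow> real"
  assumes "finite A" "\<And>a. a \<in> A \<Longrightarrow> \<exists>C\<ge>0. \<forall>u. P u \<longrightarrow> f a u \<le> C * h u"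
  shows "\<exists>C\<ge>0. \<forall>u. P u \<longrightarrow> (\<Sum>a\<in>A. f a u) \<le> C * h u"
proof -
  obtain C where C: "\<And>a. a \<in> A \<Longrightarrow> C a \<ge> 0" "\<And>a u. a \<in> A \<Longrightarrow> P u \<Longrightarrow> f a u \<le> C a * h u"
    using assms(2) by metis
  have "(\<Sum>a\<in>A. f a u) \<le> (\<Sum>a\<in>A. C a) * h u" if "P u" for u
    unfolding sum_distrib_right using C(2) that by (intro sum_mono) auto
  moreover have "(\<Sum>a\<in>A. C a) \<ge> 0"
    using C(1) by (rule sum_nonneg)
  ultimately show ?thesis
    by blast
qed

context linear_mhd
begin

lemma rho_cancel: "rho * f = h \<Longrightarrow> f = irho * h"
  using irho by (metis mult.assoc mult_1)

lemma coef_rules: "coef c \<Longrightarrow> coef (dx c)" "coef rho" "coef irho" "coef kappa" "coef mu" "coef lam" "coef c2"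
  "coef bz" "coef w" "coef c \<Longrightarrow> coef d \<Longrightarrow> coef (c + d)" "coef c \<Longrightarrow> coef d \<Longrightarrow> coef (c - d)"
  "coef c \<Longrightarrow> coef d \<Longrightarrow> coef (c * d)" "coef c \<Longrightarrow> coef (- c)" "coef c \<Longrightarrow> coef (r *\<^sub>R c)"
  using coefs coef_ring coef_dx by auto

lemma Bdx_cong: "(\<And>u. sol u \<Longrightarrow> F u = G u) \<Longrightarrow> Bdx T n k F \<longleftrightarrow> Bdx T n k G"
  unfolding Bdx_def using Bds_cong[of "\<lambda>u. (dt ^^ _) (F u)" "\<lambda>u. (dt ^^ _) (G u)"] by simp

lemma Bdx_mono: "Bdx T n k F \<Longrightarrow> k \<le> l \<Longrightarrow> n' \<le> n \<Longrightarrow> Bdx T n' l F"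
  unfolding Bdx_def by (meson Bds_mono add_right_mono)

lemma Bdx_add: "Bdx T n k F \<Longrightarrow> Bdx T n k G \<Longrightarrow> Bdx T n k (\<lambda>u. F u + G u)"
  unfolding Bdx_def by (simp add: funpow_dt Bds_add)

lemma Bdx_scaleR: "Bdx T n k F \<Longrightarrow> Bdx T n k (\<lambda>u. r *\<^sub>R F u)"
  unfolding Bdx_def by (simp add: funpow_dt Bds_scaleR)

lemma Bdx_minus: "Bdx T n k F \<Longrightarrow> Bdx T n k (\<lambda>u. - F u)"
  unfolding Bdx_def by (simp add: funpow_dt Bds_minus)

lemma Bdx_diff: "Bdx T n k F \<Longrightarrow> Bdx T n k G \<Longrightarrow> Bdx T n k (\<lambda>u. F u - G u)"
  using Bdx_add[of T n k F "\<lambda>u. - G u"] Bdx_minus by simp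

lemma Bdx_coef: "coef c \<Longrightarrow> Bdx T n k F \<Longrightarrow> Bdx T n k (\<lambda>u. c * F u)"
  unfolding Bdx_def by (simp add: funpow_coef Bds_coef)

lemma Bdx_dt:
  assumes "Bdx T n k F"
  shows "Bdx T n (Suc k) (\<lambda>u. dt (F u))"
  unfolding Bdx_def
proof
  fix m
  have "Bds T n (k + Suc m) (\<lambda>u. (dt ^^ Suc m) (F u))"
    using assms unfolding Bdx_def by blast
  then show "Bds T n (Suc k + m) (\<lambda>u. (dt ^^ m) (dt (F u)))"
    by (simp add: funpow_swap1)
qed

lemma Bdx_dy:
  assumes "Bdx T n k F"
  shows "Bdx T n (Suc k) (\<lambda>u. dy (F u))"
  unfolding Bdx_def
proof
  fix m
  have "Bds T n (Suc (k + m)) (\<lambda>u. dy ((dt ^^ m) (F u)))"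
    using assms[unfolded Bdx_def, rule_format, of m] by (rule Bds_dy)
  then show "Bds T n (Suc k + m) (\<lambda>u. (dt ^^ m) (dy (F u)))"
    by (simp add: funpow_commute(1)[of dy dt, OF dy_dt])
qed

lemma Bdx_dx:
  assumes "Bdx T (Suc n) k F"
  shows "Bdx T n (Suc k) (\<lambda>u. dx (F u))"
  unfolding Bdx_def
proof
  fix m
  have "Bds T n (Suc (k + m)) (\<lambda>u. dx ((dt ^^ m) (F u)))"
    using assms[unfolded Bdx_def, rule_format, of m] by (rule Bds_dx)
  then show "Bds T n (Suc k + m) (\<lambda>u. (dt ^^ m) (dx (F u)))"
    by (simp add: funpow_commute(1)[of dx dt, OF dx_dt])
qed

lemma Bdx_Suc:
  assumes "Bdx T 0 k F" "Bdx T n (Suc k) (\<lambda>u. dx (F u))"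
  shows "Bdx T (Suc n) k F"
  unfolding Bdx_def
proof
  fix m
  have "Bds T n (Suc k + m) (\<lambda>u. (dt ^^ m) (dx (F u)))"
    using assms(2) unfolding Bdx_def by blast
  then show "Bds T (Suc n) (k + m) (\<lambda>u. (dt ^^ m) (F u))"
    using assms(1) unfolding Bdx_def
    by (intro Bds_Suc) (simp_all add: funpow_commute(1)[of dx dt, OF dx_dt])
qed

lemma dt_dx_dy_dt: "dt ((dx ^^ i) ((dy ^^ j) ((dt ^^ m) f))) = (dx ^^ i) ((dy ^^ j) ((dt ^^ m) (dt f)))"
  by (simp add: funpow_commute(1)[of dt dx, OF dt_dx] funpow_commute(1)[of dt dy, OF dt_dy]
      funpow_swap1)

lemma Bdx_time_integration:
  assumes "Bdx {0..} n k (\<lambda>u. dt (F u))" "Bdx {0} n k F"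
  shows "Bdx {0..} n k F"
  unfolding Bdx_def Bds_def
proof (intro allI impI)
  fix i j m assume "i \<le> n"
  then have "Bd {0..} (i + j + (k + m)) (\<lambda>u. dt ((dx ^^ i) ((dy ^^ j) ((dt ^^ m) (F u)))))"
    "Bd {0} (i + j + (k + m)) (\<lambda>u. (dx ^^ i) ((dy ^^ j) ((dt ^^ m) (F u))))"
    using assms unfolding Bdx_def Bds_def dt_dx_dy_dt by blast+
  then show "Bd {0..} (i + j + (k + m)) (\<lambda>u. (dx ^^ i) ((dy ^^ j) ((dt ^^ m) (F u))))"
    by (rule Bd_time_integration)
qed

lemma N_le_integ:
  obtains M where "M \<ge> 0" "\<And>f t. N f t \<le> M * integ (f\<^sup>2) t"
proof -
  obtain M where M: "M > 0" "\<And>t x y. \<bar>val rho t x y\<bar> \<le> M"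
    using coef_bounded[OF coefs(1)] by metis
  have "N f t \<le> M * integ (f\<^sup>2) t" for f t
    unfolding N_def by (rule integ_bound)
      (use M(2)[of t] in \<open>auto simp: val_simps abs_le_iff intro: mult_right_mono\<close>)
  with M(1) that show thesis
    by (meson less_imp_le)
qed

lemma N_poincare: "\<exists>C\<ge>0. \<forall>f. perx f \<longrightarrow> (\<forall>t\<ge>0. N (dx f) t \<le> C * N (dx (dx f)) t)"
proof -
  obtain M where M: "M \<ge> 0" "\<And>f t. N f t \<le> M * integ (f\<^sup>2) t"
    using N_le_integ by metis
  obtain c where c: "c > 0" "\<And>t x y. c \<le> val rho t x y"
    using rho_pos by blast
  have "N (dx f) t \<le> (M * (16 * pi\<^sup>2) / c) * N (dx (dx f)) t" if "perx f" "t \<ge> 0" for f t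
  proof -
    have "N (dx f) t \<le> M * integ ((dx f)\<^sup>2) t"
      by (rule M(2))
    also have "\<dots> \<le> M * (16 * pi\<^sup>2 * integ ((dx (dx f))\<^sup>2) t)"
      using M(1) poincare_dx[OF that] by (intro mult_left_mono) auto
    also have "c * integ ((dx (dx f))\<^sup>2) t \<le> N (dx (dx f)) t"
      using integ_mono[of "c *\<^sub>R (dx (dx f))\<^sup>2" t "rho * (dx (dx f))\<^sup>2"] c(2)[of t]
      by (simp add: val_simps integ_linear N_def mult_right_mono)
    then have "M * (16 * pi\<^sup>2 * integ ((dx (dx f))\<^sup>2) t) \<le> M * (16 * pi\<^sup>2 * (N (dx (dx f)) t / c))"
      using M(1) c(1) by (intro mult_left_mono) (auto simp: field_simps)
    finally show ?thesis
      by simp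
  qed
  then show ?thesis
    using M(1) c(1) by (intro exI[of _ "M * (16 * pi\<^sup>2) / c"]) auto
qed

lemma Bdx_poincare:
  assumes "\<And>u. sol u \<Longrightarrow> perx (F u)" "Bdx {0..} 0 k (\<lambda>u. dx (dx (F u)))"
  shows "Bdx {0..} 0 k (\<lambda>u. dx (F u))"
proof -
  obtain C where C: "C \<ge> 0" "\<And>f t. perx f \<Longrightarrow> t \<ge> 0 \<Longrightarrow> N (dx f) t \<le> C * N (dx (dx f)) t"
    using N_poincare by blast
  have eq: "(dy ^^ j) ((dt ^^ m) (dx f)) = dx ((dy ^^ j) ((dt ^^ m) f))" for j m f
    by (simp add: funpow_commute(1)[of dx dt, OF dx_dt] funpow_commute(1)[of dx dy, OF dx_dy])
  have per: "perx ((dy ^^ j) ((dt ^^ m) (F u)))" if "sol u" for j m u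
  proof -
    have "perx ((dt ^^ m) (F u))"
      by (induction m) (simp_all add: assms(1) that perx_derivatives)
    then show ?thesis
      by (induction j) (simp_all add: perx_derivatives)
  qed
  show ?thesis
    unfolding Bdx_def Bds_def
  proof (intro allI impI)
    fix i j m :: nat assume "i \<le> 0"
    then have "Bd {0..} (i + j + (k + m)) (\<lambda>u. dx (dx ((dy ^^ j) ((dt ^^ m) (F u)))))"
      using assms(2) unfolding Bdx_def Bds_def by (auto simp: eq)
    then have "Bd {0..} (i + j + (k + m)) (\<lambda>u. dx ((dy ^^ j) ((dt ^^ m) (F u))))"
      by (rule Bd_le[OF _ C(1)]) (use C(2) per in auto)
    then show "Bd {0..} (i + j + (k + m)) (\<lambda>u. (dx ^^ i) ((dy ^^ j) ((dt ^^ m) (dx (F u)))))"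
      using \<open>i \<le> 0\<close> by (simp add: eq)
  qed
qed

lemma Bds_congI: "(\<And>u. sol u \<Longrightarrow> F u = G u) \<Longrightarrow> Bds T n k G \<Longrightarrow> Bds T n k F"
  and Bdx_congI: "(\<And>u. sol u \<Longrightarrow> F u = G u) \<Longrightarrow> Bdx T n k G \<Longrightarrow> Bdx T n k F"
  using Bds_cong Bdx_cong by blast+

lemma Bds_initial: "v \<noteq> Q \<Longrightarrow> Bds {0} n k (\<lambda>u. u v)"
  unfolding Bds_def Bd_def by (auto intro!: exI[of _ 1] N_le_dat)

lemma Bd_le_sum:
  assumes "Bd T k F" "Bd T k G" "\<And>u t. sol u \<Longrightarrow> t \<in> T \<Longrightarrow> N (E u) t \<le> N (F u) t + N (G u) t"
  shows "Bd T k E"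
proof -
  obtain C C' where C: "C \<ge> 0" "\<And>u t. sol u \<Longrightarrow> t \<in> T \<Longrightarrow> N (F u) t \<le> C * exp (2 * \<Lambda> * t) * dat k u"
    "C' \<ge> 0" "\<And>u t. sol u \<Longrightarrow> t \<in> T \<Longrightarrow> N (G u) t \<le> C' * exp (2 * \<Lambda> * t) * dat k u"
    using assms(1,2) by (auto simp: Bd_def)
  have "N (E u) t \<le> (C + C') * exp (2 * \<Lambda> * t) * dat k u" if "sol u" "t \<in> T" for u t
    using assms(3)[OF that] C(2)[OF that] C(4)[OF that] by (simp add: algebra_simps)
  with C(1,3) show ?thesis
    unfolding Bd_def by (intro exI[of _ "C + C'"]) auto
qed

text \<open>A divergence-free field is orthogonal to the pressure gradient, so it is bounded by the
  remaining force.\<close>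

lemma incompressible_acceleration:
  assumes "kappa = 0" "sol u" "t \<ge> 0"
  shows "N (dt (u V1)) t + N (dt (u V2)) t \<le>
    N (irho * (b1 *\<^sub>R dx (u M1) + g *\<^sub>R u Sigma)) t + N (irho * (b1 *\<^sub>R dx (u M2))) t"
proof -
  note u = solD[OF assms(2)]
  define w1 w2 q where "w1 = dt (u V1)" and "w2 = dt (u V2)" and "q = u Q"
  define G1 G2 where "G1 = b1 *\<^sub>R dx (u M1) + g *\<^sub>R u Sigma" and "G2 = b1 *\<^sub>R dx (u M2)"
  have div: "dx w1 + dy w2 = 0"
    using arg_cong[OF u(4), of dt] assms(1)
    by (simp add: w1_def w2_def \<delta>_def derivation_simps dx_dt dy_dt)
  have mom: "rho * w1 = G1 - dx q" "rho * w2 = G2 - dy q"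
    using u(1,2) by (simp_all add: w1_def w2_def q_def G1_def G2_def algebra_simps)
  have "perx (w1 * q)"
    using u(10,12) by (simp add: w1_def q_def perx_ring perx_derivatives)
  then have "integ (dx (w1 * q) + dy (w2 * q)) t = 0"
    by (simp add: integ_linear integ_dx integ_dy assms(3))
  moreover have "rho * w1\<^sup>2 + rho * w2\<^sup>2 = w1 * G1 + w2 * G2 - (dx (w1 * q) + dy (w2 * q))"
  proof -
    have "rho * w1\<^sup>2 + rho * w2\<^sup>2 = w1 * (rho * w1) + w2 * (rho * w2)"
      by (simp add: power2_eq_square algebra_simps)
    also have "\<dots> = w1 * G1 + w2 * G2 - (dx (w1 * q) + dy (w2 * q)) + (dx w1 + dy w2) * q"
      unfolding mom by (simp add: derivation_simps algebra_simps)
    finally show ?thesis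
      by (simp add: div)
  qed
  ultimately have 1: "N w1 t + N w2 t = integ (w1 * G1 + w2 * G2) t"
    by (metis N_def diff_zero integ_linear(1) integ_linear(2))
  \<comment> \<open>Half of twice the integral of \<open>w1 * G1 + w2 * G2\<close> is absorbed on
    the left, which leaves the constant \<open>1\<close>. The weights \<open>rho\<close> and
    \<open>irho\<close> cancel in the mixed term.\<close>
  have cs: "2 * integ (w * G) t \<le> N w t + N (irho * G) t" for w G
  proof -
    have "integ (2 *\<^sub>R (w * G)) t \<le> integ (rho * w\<^sup>2 + rho * (irho * G)\<^sup>2) t"
    proof (rule integ_mono)
      fix x y
      have "val irho t x y * val rho t x y = 1"
        using irho by (metis times_sfield.rep_eq one_sfield.rep_eq)
      then have r: "val rho t x y * (2 * val w t x y * (val irho t x y * val G t x y)) =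
          2 * val w t x y * val G t x y"
        by algebra
      have "2 * val w t x y * (val irho t x y * val G t x y) \<le>
          1 * (val w t x y)\<^sup>2 + (val irho t x y * val G t x y)\<^sup>2 / 1"
        by (rule young) simp
      from mult_left_mono[OF this rho_nonneg[of t x y]]
      show "val (2 *\<^sub>R (w * G)) t x y \<le> val (rho * w\<^sup>2 + rho * (irho * G)\<^sup>2) t x y"
        unfolding r by (simp add: val_simps distrib_left)
    qed
    then show ?thesis
      by (simp add: integ_linear N_def)
  qed
  have "N w1 t + N w2 t \<le> N (irho * G1) t + N (irho * G2) t"
    using 1 cs[of w1 G1] cs[of w2 G2] by (simp add: integ_linear)
  then show ?thesis
    by (simp add: w1_def w2_def G1_def G2_def)
qed

lemma Bds_initial_dx: "v \<noteq> Q \<Longrightarrow> Bds {0} n (Suc 0) (\<lambda>u. dx (u v))"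
  and Bds_initial_dy: "v \<noteq> Q \<Longrightarrow> Bds {0} n (Suc 0) (\<lambda>u. dy (u v))"
  by (intro Bds_dx Bds_dy Bds_initial; simp)+

lemmas Bds_rules = Bds_add Bds_diff Bds_minus Bds_scaleR Bds_coef coef_rules
lemmas Bdx_rules = Bdx_add Bdx_diff Bdx_minus Bdx_scaleR Bdx_coef coef_rules

text \<open>For incompressible flow the pressure is not determined pointwise by the data. Tangential
  derivatives of the initial acceleration are bounded by \<open>incompressible_acceleration\<close>,
  applied to \<open>y\<close>-derivatives of the solution. Each derivative in \<open>x\<close> then
  follows from the divergence of the acceleration, which vanishes, and from the curl of the momentum
  equation, in which the pressure cancels.\<close>

lemma Bds_dt_incompressible:
  assumes "kappa = 0"
  shows "Bds {0} n 1 (\<lambda>u. dt (u V1)) \<and> Bds {0} n 1 (\<lambda>u. dt (u V2))"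
proof (induction n)
  case 0
  define F where "F = (\<lambda>u :: state. irho * (b1 *\<^sub>R dx (u M1) + g *\<^sub>R u Sigma))"
  define G where "G = (\<lambda>u :: state. irho * (b1 *\<^sub>R dx (u M2)))"
  have FG: "Bds {0} 0 1 F" "Bds {0} 0 1 G"
    unfolding F_def G_def One_nat_def
    by (intro Bds_rules Bds_initial_dx Bds_initial; simp)+
  have "Bd {0} (j + 1) (\<lambda>u. (dy ^^ j) (dt (u v)))" if "v \<in> {V1, V2}" for j v
  proof (rule Bd_le_sum)
    show "Bd {0} (j + 1) (\<lambda>u. (dy ^^ j) (F u))" "Bd {0} (j + 1) (\<lambda>u. (dy ^^ j) (G u))"
      using FG unfolding Bds_def by force+
  next
    fix u and t :: real assume u: "sol u" "t \<in> {0}"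
    have *: "sol (\<lambda>i. (dy ^^ j) (u i))"
      using sol_funpow[OF u(1), of j 0] by simp
    have "F (\<lambda>i. (dy ^^ j) (u i)) = (dy ^^ j) (F u)" "G (\<lambda>i. (dy ^^ j) (u i)) = (dy ^^ j) (G u)"
      by (simp_all add: F_def G_def funpow_dy funpow_coef coefs funpow_commute(1)[of dx dy, OF dx_dy])
    with incompressible_acceleration[OF assms *, of t] u(2)
    have "N (dt ((dy ^^ j) (u V1))) t + N (dt ((dy ^^ j) (u V2))) t \<le> N ((dy ^^ j) (F u)) t + N ((dy ^^ j) (G u)) t"
      by (simp add: F_def G_def)
    then show "N ((dy ^^ j) (dt (u v))) t \<le> N ((dy ^^ j) (F u)) t + N ((dy ^^ j) (G u)) t"
      using that N_nonneg[of "(dy ^^ j) (dt (u V1))" t] N_nonneg[of "(dy ^^ j) (dt (u V2))" t]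
      by (auto simp: funpow_commute(1)[of dt dy, OF dt_dy])
  qed
  then show ?case
    unfolding Bds_def by simp
next
  case (Suc n)
  have 1: "dx (dt (u V1)) = - dy (dt (u V2))" if "sol u" for u
    using arg_cong[OF solD(4)[OF that], of dt] assms
    by (simp add: \<delta>_def derivation_simps dx_dt dy_dt eq_neg_iff_add_eq_0)
  have 2: "dx (dt (u V2)) = dy (dt (u V1)) +
      irho * (- (dx rho * dt (u V2)) + b1 *\<^sub>R dx (dx (u M2)) - b1 *\<^sub>R dy (dx (u M1)) - g *\<^sub>R dy (u Sigma))"
    if "sol u" for u
  proof -
    have "rho * (dx (dt (u V2)) - dy (dt (u V1))) =
        - (dx rho * dt (u V2)) + b1 *\<^sub>R dx (dx (u M2)) - b1 *\<^sub>R dy (dx (u M1)) - g *\<^sub>R dy (u Sigma)"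
    proof -
      have "rho * dx (dt (u V2)) = b1 *\<^sub>R dx (dx (u M2)) - dx (dy (u Q)) - dx rho * dt (u V2)"
        using arg_cong[OF solD(2)[OF that], of dx]
        by (simp add: derivation_simps eq_diff_eq add.commute)
      moreover have "rho * dy (dt (u V1)) = g *\<^sub>R dy (u Sigma) + b1 *\<^sub>R dy (dx (u M1)) - dx (dy (u Q))"
        using arg_cong[OF solD(1)[OF that], of dy]
        by (simp add: derivation_simps coef_simps dy_dx algebra_simps)
      ultimately show ?thesis
        by (simp add: right_diff_distrib)
    qed
    from rho_cancel[OF this] show ?thesis
      by (simp add: algebra_simps)
  qed
  have "Bds {0} n (Suc 1) (\<lambda>u. dx (dt (u V1)))"
    by (rule Bds_congI, erule 1, intro Bds_rules Bds_dy) (use Suc in auto)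
  moreover have "Bds {0} n (Suc 1) (\<lambda>u. dx (dt (u V2)))"
  proof (rule Bds_congI, erule 2, intro Bds_rules)
    show "Bds {0} n (Suc 1) (\<lambda>u. dy (dt (u V1)))"
      using Suc by (intro Bds_dy) auto
    show "Bds {0} n (Suc 1) (\<lambda>u. dt (u V2))"
      using Suc by (auto intro: Bds_mono)
    show "Bds {0} n (Suc 1) (\<lambda>u. dx (dx (u M2)))" "Bds {0} n (Suc 1) (\<lambda>u. dy (dx (u M1)))"
      unfolding One_nat_def by (intro Bds_dx Bds_dy Bds_initial; simp)+
    show "Bds {0} n (Suc 1) (\<lambda>u. dy (u Sigma))"
      by (rule Bds_mono[OF Bds_initial_dy]) auto
  qed
  ultimately show ?case
    using Bds_Suc Bds_mono[of "{0}" n 1 _ 1 0] Suc by auto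
qed

text \<open>Most equations express the time derivative directly by first derivatives of the data.
  The pressure in the momentum equations needs a distinction: for \<open>kappa \<noteq> 0\<close> it
  is a combination of the data, and for \<open>kappa = 0\<close> the preceding lemma
  applies.\<close>

lemma Bds_dt_field:
  assumes "v \<noteq> Q"
  shows "Bds {0} n 1 (\<lambda>u. dt (u v))"
proof -
  have \<delta>: "Bds {0} n (Suc 0) \<delta>"
    unfolding \<delta>_def[abs_def] by (intro Bds_rules Bds_initial_dx Bds_initial_dy; simp)
  have V: "Bds {0} n 1 (\<lambda>u. dt (u V1))" "Bds {0} n 1 (\<lambda>u. dt (u V2))" 
  proof (atomize(full), cases "kappa = 0")
    case True
    then show "Bds {0} n 1 (\<lambda>u. dt (u V1)) \<and> Bds {0} n 1 (\<lambda>u. dt (u V2))"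
      by (rule Bds_dt_incompressible)
  next
    case False
    have Q: "Bds {0} m 0 (\<lambda>u. u Q)" for m
      by (rule Bds_congI, erule solD(9)[OF _ False], intro Bds_rules Bds_initial; simp)
    have "Bds {0} n 1 (\<lambda>u. dt (u V1))" "Bds {0} n 1 (\<lambda>u. dt (u V2))"
      unfolding One_nat_def
      by (rule Bds_congI, erule rho_cancel[OF solD(1)], intro Bds_rules Bds_dx Bds_dy Bds_initial Q; simp)
        (rule Bds_congI, erule rho_cancel[OF solD(2)], intro Bds_rules Bds_dx Bds_dy Bds_initial Q; simp)
    then show "Bds {0} n 1 (\<lambda>u. dt (u V1)) \<and> Bds {0} n 1 (\<lambda>u. dt (u V2))"
      by simp
  qed
  show ?thesis
  proof (cases v)
    case Sigma
    show ?thesis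
      unfolding Sigma One_nat_def
      by (rule Bds_congI, erule solD(3), intro Bds_rules \<delta> Bds_initial; simp)
  next
    case V3
    show ?thesis
      unfolding V3 One_nat_def
      by (rule Bds_congI, erule rho_cancel[OF solD(7)], intro Bds_rules Bds_initial; simp)
  next
    case M1
    show ?thesis
      unfolding M1 One_nat_def
      by (rule Bds_congI, erule solD(5), intro Bds_rules Bds_initial_dy; simp)
  next
    case M2
    show ?thesis
      unfolding M2 One_nat_def
      by (rule Bds_congI, erule solD(6), intro Bds_rules Bds_initial_dx; simp)
  next
    case M3
    show ?thesis
      unfolding M3 One_nat_def
      by (rule Bds_congI, erule solD(8), intro Bds_rules \<delta> Bds_initial; simp)
  qed (use V assms in auto)
qed

section \<open>Data of solutions differentiated in t and y\<close>

lemma dat_dt: "\<exists>C\<ge>0. \<forall>u. sol u \<longrightarrow> dat k (\<lambda>i. dt (u i)) \<le> C * dat (Suc k) u"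
  unfolding dat_def[of k] case_prod_beta
proof (intro sum_uniform_bound finite_le_pairs[unfolded case_prod_beta])
  fix p v assume "p \<in> {p. fst p + snd p \<le> k}" "v \<in> - {Q}"
  then have "Bd {0} (fst p + snd p + 1) (\<lambda>u. (dx ^^ fst p) ((dy ^^ snd p) (dt (u v))))"
    "fst p + snd p + 1 \<le> Suc k"
    using Bds_dt_field[of v "fst p"] unfolding Bds_def by auto
  then have "Bd {0} (Suc k) (\<lambda>u. (dx ^^ fst p) ((dy ^^ snd p) (dt (u v))))"
    by (rule Bd_mono)
  then show "\<exists>C\<ge>0. \<forall>u. sol u \<longrightarrow> N ((dx ^^ fst p) ((dy ^^ snd p) (dt (u v)))) 0 \<le> C * dat (Suc k) u"
    unfolding Bd_def by auto
qed (simp add: vars_except_Q)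

lemma dat_dy: "\<exists>C\<ge>0. \<forall>u. sol u \<longrightarrow> dat k (\<lambda>i. dy (u i)) \<le> C * dat (Suc k) u"
  unfolding dat_def[of k] case_prod_beta
proof (intro sum_uniform_bound finite_le_pairs[unfolded case_prod_beta])
  fix p v assume "p \<in> {p. fst p + snd p \<le> k}" "v \<in> - {Q}"
  then have "N ((dx ^^ fst p) ((dy ^^ snd p) (dy (u v)))) 0 \<le> dat (Suc k) u" for u
    using N_le_dat[of "fst p" "Suc (snd p)" "Suc k" v u] by (auto simp: funpow_swap1)
  then show "\<exists>C\<ge>0. \<forall>u. sol u \<longrightarrow> N ((dx ^^ fst p) ((dy ^^ snd p) (dy (u v)))) 0 \<le> C * dat (Suc k) u"
    by (intro exI[of _ 1]) auto
qed (simp add: vars_except_Q)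

lemma dat_tangential: "\<exists>C\<ge>0. \<forall>u. sol u \<longrightarrow> dat k (\<lambda>i. (dy ^^ j) ((dt ^^ m) (u i))) \<le> C * dat (j + (m + k)) u"
proof -
  have iterate: "\<exists>C\<ge>0. \<forall>u. sol u \<longrightarrow> dat k (\<lambda>i. (E ^^ n) (u i)) \<le> C * dat (n + k) u"
    if step: "\<And>k. \<exists>C\<ge>0. \<forall>u. sol u \<longrightarrow> dat k (\<lambda>i. E (u i)) \<le> C * dat (Suc k) u"
      and E: "\<And>u. sol u \<Longrightarrow> sol (\<lambda>i. E (u i))" for E n k
  proof (induction n arbitrary: k)
    case 0
    show ?case
      by (auto intro: exI[of _ 1])
  next
    case (Suc n)
    obtain C C' where C: "C \<ge> 0" "\<And>u. sol u \<Longrightarrow> dat k (\<lambda>i. (E ^^ n) (u i)) \<le> C * dat (n + k) u"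
      "C' \<ge> 0" "\<And>u. sol u \<Longrightarrow> dat (n + k) (\<lambda>i. E (u i)) \<le> C' * dat (Suc (n + k)) u"
      using Suc[of k] step[of "n + k"] by blast
    have "dat k (\<lambda>i. (E ^^ Suc n) (u i)) \<le> (C * C') * dat (Suc n + k) u" if "sol u" for u
      using C(2)[OF E[OF that]] mult_left_mono[OF C(4)[OF that] C(1)] by (simp add: funpow_swap1)
    with C(1,3) show ?case
      by (intro exI[of _ "C * C'"]) auto
  qed
  obtain C C' where C: "C \<ge> 0" "\<And>u. sol u \<Longrightarrow> dat k (\<lambda>i. (dy ^^ j) (u i)) \<le> C * dat (j + k) u"
    "C' \<ge> 0" "\<And>u. sol u \<Longrightarrow> dat (j + k) (\<lambda>i. (dt ^^ m) (u i)) \<le> C' * dat (m + (j + k)) u"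
    using iterate[of dy k j, OF dat_dy sol_dy] iterate[of dt "j + k" m, OF dat_dt sol_dt] by blast
  have "dat k (\<lambda>i. (dy ^^ j) ((dt ^^ m) (u i))) \<le> (C * C') * dat (j + (m + k)) u" if "sol u" for u
  proof -
    have "sol (\<lambda>i. (dt ^^ m) (u i))"
      using sol_funpow[OF that, of 0 m] by simp
    from C(2)[OF this] mult_left_mono[OF C(4)[OF that] C(1)] show ?thesis
      by (simp add: ac_simps)
  qed
  with C(1,3) show ?thesis
    by (intro exI[of _ "C * C'"]) auto
qed

text \<open>Derivatives of a solution in \<open>t\<close> and \<open>y\<close> are again solutions.
  The bound on \<open>F\<close> is applied to them, and \<open>dat_tangential\<close> measures their
  data by those of the original solution.\<close>

lemma tangential_lift:
  assumes "Bd T k F"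
    and nat: "\<And>u. F (\<lambda>i. dt (u i)) = dt (F u)" "\<And>u. F (\<lambda>i. dy (u i)) = dy (F u)"
  shows "Bdx T 0 k F"
  unfolding Bdx_def Bds_def
proof (intro allI impI)
  fix i j m :: nat assume "i \<le> 0"
  have F: "F (\<lambda>i. (dy ^^ j) ((dt ^^ m) (u i))) = (dy ^^ j) ((dt ^^ m) (F u))" for u
  proof -
    have "F (\<lambda>i. (dt ^^ m) (u i)) = (dt ^^ m) (F u)"
      by (induction m) (simp_all add: nat)
    then show ?thesis
      by (induction j) (simp_all add: nat)
  qed
  obtain C where C: "C \<ge> 0" "\<And>u t. sol u \<Longrightarrow> t \<in> T \<Longrightarrow> N (F u) t \<le> C * exp (2 * \<Lambda> * t) * dat k u"
    using assms(1) by (auto simp: Bd_def)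
  obtain C' where C': "C' \<ge> 0"
    "\<And>u. sol u \<Longrightarrow> dat k (\<lambda>i. (dy ^^ j) ((dt ^^ m) (u i))) \<le> C' * dat (j + (m + k)) u"
    using dat_tangential[of k j m] by blast
  have "N ((dy ^^ j) ((dt ^^ m) (F u))) t \<le> (C * C') * exp (2 * \<Lambda> * t) * dat (j + (m + k)) u"
    if "sol u" "t \<in> T" for u t
    using C(2)[OF sol_funpow[OF that(1), of j m] that(2)] mult_left_mono[OF C'(2)[OF that(1)], of "C * exp (2 * \<Lambda> * t)"] C(1)
    by (simp add: F algebra_simps)
  then show "Bd T (i + j + (k + m)) (\<lambda>u. (dx ^^ i) ((dy ^^ j) ((dt ^^ m) (F u))))"
    unfolding Bd_def using C(1) C'(1) \<open>i \<le> 0\<close> by (intro exI[of _ "C * C'"]) (simp add: ac_simps)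
qed

lemma Bdx_initial:
  assumes "v \<noteq> Q"
  shows "Bdx {0} n 0 (\<lambda>u. u v)"
  unfolding Bdx_def Bds_def
proof (intro allI impI)
  fix i j m
  obtain C where C: "C \<ge> 0" "\<And>u. sol u \<Longrightarrow> dat (i + j) (\<lambda>i. (dt ^^ m) (u i)) \<le> C * dat (m + (i + j)) u"
    using dat_tangential[of "i + j" 0 m] by auto
  have "N ((dx ^^ i) ((dy ^^ j) ((dt ^^ m) (u v)))) 0 \<le> C * dat (m + (i + j)) u" if "sol u" for u
    using N_le_dat[of i j "i + j" v "\<lambda>i. (dt ^^ m) (u i)"] C(2)[OF that] assms by simp
  with C(1) show "Bd {0} (i + j + (0 + m)) (\<lambda>u. (dx ^^ i) ((dy ^^ j) ((dt ^^ m) (u v))))"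
    unfolding Bd_def by (intro exI[of _ C]) (simp add: ac_simps)
qed

end

section \<open>Energy estimate\<close>

context linear_mhd
begin

lemma coef_quadratic:
  assumes "coef c"
  obtains M where "M \<ge> 0" "\<And>f t. \<bar>integ (c * f\<^sup>2) t\<bar> \<le> M * N f t"
proof -
  obtain M where M: "M > 0" "\<And>t x y. \<bar>val (c * irho) t x y\<bar> \<le> M"
    using coef_bounded[of "c * irho"] assms coefs(2) coef_ring(6) by metis
  have "\<bar>integ (c * f\<^sup>2) t\<bar> \<le> M * N f t" for f t
  proof -
    have c: "c * f\<^sup>2 = (c * irho) * (rho * f\<^sup>2)"
      using irho by (metis mult.assoc mult.right_neutral)
    have *: "0 \<le> val (rho * f\<^sup>2) t x y" for x y
      by (simp add: val_simps rho_nonneg)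
    have "\<bar>val (c * f\<^sup>2) t x y\<bar> \<le> M * val (rho * f\<^sup>2) t x y" for x y
      unfolding c times_sfield.rep_eq[of "c * irho"] abs_mult abs_of_nonneg[OF *]
      by (intro mult_right_mono M(2) *)
    then have "val (c * f\<^sup>2) t x y \<le> M * val (rho * f\<^sup>2) t x y"
      "val (- (c * f\<^sup>2)) t x y \<le> M * val (rho * f\<^sup>2) t x y" for x y
      unfolding val_uminus by (meson abs_le_D1 abs_le_D2)+
    then have "integ (c * f\<^sup>2) t \<le> M * N f t" "integ (- (c * f\<^sup>2)) t \<le> M * N f t"
      unfolding N_def by (blast intro: integ_bound)+
    then show ?thesis
      by (simp add: integ_linear)
  qed
  with M(1) that show thesis
    by (meson less_imp_le)
qed

text \<open>The density \<open>H\<close> of the variational problem at \<open>u V1\<close>. The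
  conserved energy is the nonnegative \<open>kinetic\<close> part defined below minus this
  term.\<close>

definition growth :: "state \<Rightarrow> sfield" where
  "growth u = kappa * (pot u)\<^sup>2 - b1\<^sup>2 *\<^sub>R (dx (u V1))\<^sup>2 - g *\<^sub>R (dx rho * (u V1)\<^sup>2)"

definition kinetic :: "state \<Rightarrow> sfield" where
  "kinetic u = rho * (dt (u V1))\<^sup>2 + rho * (dt (u V2))\<^sup>2 + kappa * (dt (u Q))\<^sup>2 + b1\<^sup>2 *\<^sub>R (dx (u V2))\<^sup>2"

text \<open>One time derivative of the momentum equation removes \<open>Sigma\<close>,
  \<open>M1\<close> and \<open>M2\<close> and leaves a system for the velocity and
  \<open>dt (u Q)\<close>.\<close>

lemma second_order:
  assumes "sol u"
  shows "rho * dt (dt (u V1)) =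
      - dx (dt (u Q)) - b1\<^sup>2 *\<^sub>R dx (dy (u V2)) - g *\<^sub>R (dx rho * u V1 + rho * \<delta> u)"
    and "rho * dt (dt (u V2)) = - dy (dt (u Q)) + b1\<^sup>2 *\<^sub>R dx (dx (u V2))"
proof -
  have m: "dt (dx (u M1)) = - (b1 *\<^sub>R dx (dy (u V2)))" "dt (dx (u M2)) = b1 *\<^sub>R dx (dx (u V2))"
    using arg_cong[OF solD(5)[OF assms], of dx] arg_cong[OF solD(6)[OF assms], of dx]
    by (simp_all add: derivation_simps dx_dt)
  have a: "rho * dt (dt (u V1)) = - dx (dt (u Q)) + b1 *\<^sub>R dt (dx (u M1)) + g *\<^sub>R dt (u Sigma)"
    "rho * dt (dt (u V2)) = - dy (dt (u Q)) + b1 *\<^sub>R dt (dx (u M2))"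
    using arg_cong[OF solD(1)[OF assms], of dt] arg_cong[OF solD(2)[OF assms], of dt]
    by (simp_all add: derivation_simps coef_simps dx_dt dy_dt)
  show "rho * dt (dt (u V1)) =
      - dx (dt (u Q)) - b1\<^sup>2 *\<^sub>R dx (dy (u V2)) - g *\<^sub>R (dx rho * u V1 + rho * \<delta> u)"
    unfolding a m solD(3)[OF assms] by (simp add: power2_eq_square scaleR_diff_right scaleR_add_right)
  show "rho * dt (dt (u V2)) = - dy (dt (u Q)) + b1\<^sup>2 *\<^sub>R dx (dx (u V2))"
    unfolding a m by (simp add: power2_eq_square)
qed

text \<open>Periodicity of \<open>u V2\<close> says nothing about its derivative in
  \<open>x\<close>. The induction equation identifies this multiple of the derivative with
  \<open>dt (u M2)\<close>, which is periodic.\<close>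

lemma perx_b1_dx_V2: "sol u \<Longrightarrow> perx (b1 *\<^sub>R dx (u V2))"
  using perx_derivatives(1)[OF solD(14)] solD(6) by metis

text \<open>The algebra of energy conservation, with derivatives replaced by independent letters.
  \<open>a1\<close>, \<open>a2\<close> are the time derivatives of the velocity components,
  \<open>A1\<close>, \<open>A2\<close> are \<open>rho\<close> times the second ones, and
  \<open>X1\<close>, \<open>X2\<close>, \<open>Y2\<close> stand for \<open>dx (dt v1)\<close>,
  \<open>dx (dt v2)\<close>, \<open>dy (dt v2)\<close>. The two groups on the right are a derivative
  in \<open>x\<close> and a derivative in \<open>y\<close>.\<close>

lemma energy_identity:
  fixes A1 A2 a1 a2 r rx ry rt v v1x v2x v2y v2xx v2xy X1 X2 Y2 \<rho> \<rho>x \<kappa> \<beta> \<gamma> m mt d :: "'a::comm_ring_1"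
  assumes "A1 = - rx - \<beta> * v2xy - \<gamma> * (\<rho>x * v + \<rho> * d)" "A2 = - ry + \<beta> * v2xx"
    and "v1x + v2y = d" "d = - (\<kappa> * (r + m))" "X1 + Y2 = - (\<kappa> * (rt + mt))"
    and "m = \<gamma> * (\<rho> * v) - \<beta> * v1x" "mt = \<gamma> * (\<rho> * a1) - \<beta> * X1"
  shows "a1 * A1 + a2 * A2 + \<kappa> * r * rt + \<beta> * v2x * X2 - (\<kappa> * m * mt - \<beta> * v1x * X1 - \<gamma> * (\<rho>x * v * a1)) =
    (- rx * a1 - r * X1 - \<beta> * v2xy * a1 - \<beta> * v2y * X1 + \<beta> * v2xx * a2 + \<beta> * v2x * X2)
    + (- ry * a2 - r * Y2)"
proof -
  have 1: "v2y = d - v1x" "Y2 = - (\<kappa> * (rt + mt)) - X1"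
    using assms(3,5) by (simp_all add: algebra_simps flip: eq_diff_eq')
  have "a1 * A1 + a2 * A2 + \<kappa> * r * rt + \<beta> * v2x * X2 - (\<kappa> * m * mt - \<beta> * v1x * X1 - \<gamma> * (\<rho>x * v * a1)) -
    ((- rx * a1 - r * X1 - \<beta> * v2xy * a1 - \<beta> * v2y * X1 + \<beta> * v2xx * a2 + \<beta> * v2x * X2) + (- ry * a2 - r * Y2))
    = - (d * mt) - \<kappa> * m * mt - r * \<kappa> * mt"
    unfolding assms(1,2) 1 by (simp add: assms(7) algebra_simps)
  also have "\<dots> = 0"
    unfolding assms(4) by (simp add: algebra_simps)
  finally show ?thesis
    by (rule eq_iff_diff_eq_0[THEN iffD2])
qed

lemma energy_conserved:
  assumes "sol u" "t \<ge> 0"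
  shows "integ (dt (kinetic u - growth u)) t = 0"
proof -
  \<comment> \<open>The real constants become ring elements, because \<open>energy_identity\<close>
    lives in a commutative ring without scalars.\<close>
  define \<beta> \<gamma> :: sfield where "\<beta> = of_real (b1\<^sup>2)" and "\<gamma> = of_real g"
  define v1 v2 r where "v1 = u V1" and "v2 = u V2" and "r = dt (u Q)"
  have const: "dt \<beta> = 0" "dx \<beta> = 0" "dy \<beta> = 0" "dt \<gamma> = 0"
    by (simp_all add: \<beta>_def \<gamma>_def of_real_def derivation_simps)
  have beta: "b1\<^sup>2 *\<^sub>R f = \<beta> * f" "g *\<^sub>R f = \<gamma> * f" for f :: sfield
    by (simp_all add: \<beta>_def \<gamma>_def scaleR_conv_of_real)
  note eqs = second_order[OF assms(1), folded v1_def v2_def r_def, unfolded beta]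
    solD(4)[OF assms(1), folded r_def]
  have eq4: "dx (dt v1) + dy (dt v2) = - (kappa * (dt r + dt (pot u)))"
    using arg_cong[OF eqs(3), of dt]
    by (simp add: \<delta>_def v1_def v2_def derivation_simps coef_simps dx_dt dy_dt)
  have pot: "pot u = \<gamma> * (rho * v1) - \<beta> * dx v1" "dt (pot u) = \<gamma> * (rho * dt v1) - \<beta> * dx (dt v1)"
    by (simp_all add: pot_def beta v1_def derivation_simps const coef_simps dx_dt)
  \<comment> \<open>\<open>A\<close> is half the energy flux in the direction of \<open>x\<close>;
    its periodicity rests on that of the velocity, of the total pressure and of
    \<open>\<beta> * dx v2\<close>.\<close>
  define A where "A = - r * dt v1 - \<beta> * dy v2 * dt v1 + \<beta> * dx v2 * dt v2"
  have "dt (kinetic u - growth u) = 2 * (dt v1 * (rho * dt (dt v1)) + dt v2 * (rho * dt (dt v2)) + kappa * r * dt r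
      + \<beta> * dx v2 * dx (dt v2) - (kappa * pot u * dt (pot u) - \<beta> * dx v1 * dx (dt v1) - \<gamma> * (dx rho * v1 * dt v1)))"
    unfolding kinetic_def growth_def beta v1_def[symmetric] v2_def[symmetric] r_def[symmetric]
    unfolding power2_eq_square
    by (simp add: derivation_simps const coef_simps dx_dt algebra_simps)
  also have "\<dots> = 2 * ((- dx r * dt v1 - r * dx (dt v1) - \<beta> * dx (dy v2) * dt v1 - \<beta> * dy v2 * dx (dt v1)
      + \<beta> * dx (dx v2) * dt v2 + \<beta> * dx v2 * dx (dt v2)) + (- dy r * dt v2 - r * dy (dt v2)))"
    by (rule arg_cong[of _ _ "(*) 2"], rule energy_identity[OF eqs(1,2) _ eqs(3) eq4 pot])
      (simp add: \<delta>_def v1_def v2_def)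
  also have "\<dots> = 2 *\<^sub>R (dx A + dy (- r * dt v2))"
    by (simp add: A_def derivation_simps const scaleR_conv_of_real algebra_simps)
  finally have eq: "dt (kinetic u - growth u) = 2 *\<^sub>R (dx A + dy (- r * dt v2))" .
  have "perx (\<beta> * dx v2)"
  proof -
    have "\<beta> * dx v2 = b1 *\<^sub>R (b1 *\<^sub>R dx (u V2))"
      by (simp add: v2_def power2_eq_square flip: beta)
    then show ?thesis
      using perx_ring(4)[OF perx_b1_dx_V2[OF assms(1)]] by metis
  qed
  moreover have "perx \<beta>"
    by (simp add: perx_def \<beta>_def of_real_def val_simps)
  moreover have "perx v1" "perx v2" "perx (- r)"
    unfolding v1_def v2_def r_def using solD(10-12)[OF assms(1)]
    by (simp_all only: perx_ring(5) perx_derivatives)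
  ultimately have "perx (- r * dt v1)" "perx (\<beta> * dy v2 * dt v1)" "perx (\<beta> * dx v2 * dt v2)"
    by (simp_all only: perx_ring(3) perx_derivatives)
  then have "perx A"
    unfolding A_def by (intro perx_ring(1,2))
  then show ?thesis
    unfolding eq by (simp add: integ_linear integ_dx integ_dy assms(2))
qed

lemma energy_eq:
  assumes "sol u" "t \<ge> 0"
  shows "integ (kinetic u) t = integ (kinetic u - growth u) 0 + integ (growth u) t"
proof -
  let ?e = "kinetic u - growth u"
  have "integ ?e t \<le> integ ?e 0 * exp (0 * t)"
    by (rule gronwall[OF integ_derivative _ assms(2)]) (simp_all add: energy_conserved assms(1))
  moreover have "- integ ?e t \<le> - integ ?e 0 * exp (0 * t)"
    by (rule gronwall[OF DERIV_minus[OF integ_derivative] _ assms(2)]) (simp_all add: energy_conserved assms(1))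
  ultimately show ?thesis
    by (simp add: integ_linear)
qed

lemma initial_energy_bound: "\<exists>C\<ge>0. \<forall>u. sol u \<longrightarrow> \<bar>integ (kinetic u - growth u) 0\<bar> \<le> C * dat 1 u"
proof -
  let ?P = "\<lambda>F :: state \<Rightarrow> real. \<exists>C\<ge>0. \<forall>u. sol u \<longrightarrow> \<bar>F u\<bar> \<le> C * dat 1 u"
  have add: "?P (\<lambda>u. F u + G u)" if F: "?P F" and G: "?P G" for F G
  proof -
    obtain C C' where C: "C \<ge> 0" "\<And>u. sol u \<Longrightarrow> \<bar>F u\<bar> \<le> C * dat 1 u"
      "C' \<ge> 0" "\<And>u. sol u \<Longrightarrow> \<bar>G u\<bar> \<le> C' * dat 1 u"
      using F G by blast
    have "\<bar>F u + G u\<bar> \<le> (C + C') * dat 1 u" if "sol u" for u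
      unfolding distrib_right
      using C(2)[OF that] C(4)[OF that] abs_triangle_ineq[of "F u" "G u"] by linarith
    with C(1,3) show ?thesis
      by (intro exI[of _ "C + C'"]) auto
  qed
  have minus: "?P (\<lambda>u. - F u)" if "?P F" for F
    using that unfolding abs_minus_cancel .
  have quad: "?P (\<lambda>u. integ (c * (F u)\<^sup>2) 0)" if c: "coef c" and F: "Bds {0} 0 1 F" for c F
  proof -
    obtain M where M: "M \<ge> 0" "\<And>f t. \<bar>integ (c * f\<^sup>2) t\<bar> \<le> M * N f t"
      using coef_quadratic[OF c] by blast
    have "Bd {0} (0 + 0 + 1) (\<lambda>u. (dx ^^ 0) ((dy ^^ 0) (F u)))"
      using F unfolding Bds_def by blast
    then obtain C where C: "C \<ge> 0" "\<And>u. sol u \<Longrightarrow> N (F u) 0 \<le> C * dat 1 u"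
      by (auto simp: Bd_def)
    have "\<bar>integ (c * (F u)\<^sup>2) 0\<bar> \<le> (M * C) * dat 1 u" if "sol u" for u
      using M(2)[of "F u" 0] mult_left_mono[OF C(2)[OF that] M(1)] by simp
    with C(1) M(1) show ?thesis
      by (intro exI[of _ "M * C"]) auto
  qed
  \<comment> \<open>The data do not bound \<open>dt (u Q)\<close> directly. By the divergence
    equation \<open>R u\<close> is \<open>kappa * dt (u Q)\<close>, it is of first order in the
    data, and \<open>mu\<close> turns its square into the required term.\<close>
  define R where "R = (\<lambda>u. - \<delta> u - kappa * pot u)"
  have R: "kappa * (dt (u Q))\<^sup>2 = mu * (R u)\<^sup>2" if "sol u" for u
  proof -
    have "R u = kappa * dt (u Q)"
      using solD(4)[OF that] by (simp add: R_def distrib_left)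
    then have "mu * (R u)\<^sup>2 = (mu * kappa * kappa) * (dt (u Q))\<^sup>2"
      by (simp only: power2_eq_square ac_simps)
    then show ?thesis
      unfolding mu by (rule sym)
  qed
  have sc: "coef (c *\<^sub>R 1)" for c :: real
    by (intro coef_ring)
  define F where "F u = integ (rho * (dt (u V1))\<^sup>2) 0 + integ (rho * (dt (u V2))\<^sup>2) 0 + integ (mu * (R u)\<^sup>2) 0
    + integ ((b1\<^sup>2 *\<^sub>R 1) * (dx (u V2))\<^sup>2) 0 + - integ (kappa * (pot u)\<^sup>2) 0
    + integ ((b1\<^sup>2 *\<^sub>R 1) * (dx (u V1))\<^sup>2) 0 + integ ((g *\<^sub>R dx rho) * (u V1)\<^sup>2) 0" for u
  have pot: "Bds {0} 0 1 pot"
    unfolding pot_def[abs_def] One_nat_def by (intro Bds_rules Bds_initial Bds_initial_dx; simp)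
  have R': "Bds {0} 0 1 R"
    unfolding R_def \<delta>_def One_nat_def
    by (intro Bds_rules Bds_initial_dx Bds_initial_dy pot[unfolded One_nat_def]; simp)
  have V: "Bds {0} 0 1 (\<lambda>u. dx (u V2))" "Bds {0} 0 1 (\<lambda>u. dx (u V1))" "Bds {0} 0 1 (\<lambda>u. u V1)"
    unfolding One_nat_def by (rule Bds_initial_dx Bds_initial, simp)+
  have "?P F"
    unfolding F_def[abs_def]
    by (rule add[OF add[OF add[OF add[OF add[OF add[OF quad quad] quad] quad] minus[OF quad]] quad] quad])
      (rule coefs sc coef_rules(14) coef_rules(1) Bds_dt_field R' V pot | simp)+
  then obtain C where C: "C \<ge> 0" "\<And>u. sol u \<Longrightarrow> \<bar>F u\<bar> \<le> C * dat 1 u"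
    by blast
  have "integ (kinetic u - growth u) 0 = F u" if "sol u" for u
    unfolding kinetic_def growth_def F_def R[OF that] by (simp add: integ_linear)
  with C show ?thesis
    by (intro exI[of _ C]) simp
qed

lemma N_le_kinetic:
  "N (dt (u V1)) t + N (dt (u V2)) t \<le> integ (kinetic u) t"
  "integ (kappa * (dt (u Q))\<^sup>2) t \<le> integ (kinetic u) t"
  "b1\<^sup>2 * integ ((dx (u V2))\<^sup>2) t \<le> integ (kinetic u) t"
  "0 \<le> integ (kinetic u) t"
proof -
  have "0 \<le> integ (kappa * (dt (u Q))\<^sup>2) t" "0 \<le> integ ((dx (u V2))\<^sup>2) t"
    by (intro integ_nonneg; simp add: val_simps kappa_nonneg)+
  then have pos: "0 \<le> integ (kappa * (dt (u Q))\<^sup>2) t" "0 \<le> b1\<^sup>2 * integ ((dx (u V2))\<^sup>2) t"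
    by simp_all
  note N = N_nonneg[of "dt (u V1)" t] N_nonneg[of "dt (u V2)" t]
  show "N (dt (u V1)) t + N (dt (u V2)) t \<le> integ (kinetic u) t"
    "integ (kappa * (dt (u Q))\<^sup>2) t \<le> integ (kinetic u) t"
    "b1\<^sup>2 * integ ((dx (u V2))\<^sup>2) t \<le> integ (kinetic u) t"
    "0 \<le> integ (kinetic u) t"
    using pos N by (simp_all add: kinetic_def integ_linear N_def)
qed

text \<open>Conservation and the variational bound give
  \<open>kinetic \<le> K + \<Lambda>\<^sup>2 * \<phi>\<close> for the integrals. Together with
  \<open>N_young\<close> this makes the derivative of \<phi> at most
  \<open>2 * \<Lambda> * \<phi> + K / \<Lambda>\<close>. The resulting bound on \<phi> is then put
  back into the bound on the kinetic part.\<close>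

lemma energy_bound:
  "\<exists>C\<ge>0. \<forall>u t. sol u \<longrightarrow> t \<ge> 0 \<longrightarrow>
     N (u V1) t + N (u V2) t \<le> C * exp (2 * \<Lambda> * t) * dat 1 u \<and>
     integ (kinetic u) t \<le> C * exp (2 * \<Lambda> * t) * dat 1 u"
proof -
  obtain C where C: "C \<ge> 0" "\<And>u. sol u \<Longrightarrow> \<bar>integ (kinetic u - growth u) 0\<bar> \<le> C * dat 1 u"
    using initial_energy_bound by blast
  define C1 where "C1 = 2 + C / (2 * \<Lambda>\<^sup>2)"
  have C1: "C1 \<ge> 0"
    using C(1) by (simp add: C1_def)
  have *: "N (u V1) t + N (u V2) t \<le> C1 * exp (2 * \<Lambda> * t) * dat 1 u"
    "integ (kinetic u) t \<le> (C + \<Lambda>\<^sup>2 * C1) * exp (2 * \<Lambda> * t) * dat 1 u" if u: "sol u" and t: "t \<ge> 0" for u t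
  proof -
    define \<phi> where "\<phi> = (\<lambda>t. N (u V1) t + N (u V2) t)"
    define K where "K = C * dat 1 u"
    have K: "0 \<le> K"
      using C(1) by (simp add: K_def dat_nonneg)
    have kin: "integ (kinetic u) t \<le> K + \<Lambda>\<^sup>2 * \<phi> t" if "t \<ge> 0" for t
    proof -
      have "integ (growth u) t \<le> \<Lambda>\<^sup>2 * N (u V1) t"
        using sup[OF solD(10)[OF u] that] by (simp add: growth_def pot_def N_def)
      also have "\<dots> \<le> \<Lambda>\<^sup>2 * \<phi> t"
        by (intro mult_left_mono) (simp_all add: \<phi>_def N_nonneg)
      finally show ?thesis
        using energy_eq[OF u that] C(2)[OF u] by (simp add: K_def)
    qed
    \<comment> \<open>The shift turns the affine inequality into a linear one, since
      \<open>2 * \<Lambda>\<close> times it is \<open>K / \<Lambda>\<close>. It also accounts for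
      the summand \<open>C / (2 * \<Lambda>\<^sup>2)\<close> in \<open>C1\<close>; the summand
      \<open>2\<close> comes from the two velocity components.\<close>
    define \<psi> where "\<psi> = (\<lambda>t. \<phi> t + K / (2 * \<Lambda>\<^sup>2))"
    have "\<psi> t \<le> \<psi> 0 * exp ((2 * \<Lambda>) * t)"
    proof (rule gronwall[OF _ _ t])
      fix t :: real assume t: "t \<ge> 0"
      let ?d = "2 * integ (rho * u V1 * dt (u V1)) t + 2 * integ (rho * u V2 * dt (u V2)) t"
      show "(\<psi> has_real_derivative ?d) (at t within {0..})"
        unfolding \<psi>_def \<phi>_def by (rule derivative_eq_intros N_derivative t refl | simp)+
      have "?d \<le> \<Lambda> * \<phi> t + (N (dt (u V1)) t + N (dt (u V2)) t) / \<Lambda>"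
        using N_young[of "u V1" "dt (u V1)" t] N_young[of "u V2" "dt (u V2)" t]
        by (simp add: \<phi>_def distrib_left add_divide_distrib)
      also have "\<dots> \<le> \<Lambda> * \<phi> t + (K + \<Lambda>\<^sup>2 * \<phi> t) / \<Lambda>"
        using N_le_kinetic(1)[of u t] kin[OF t] Lambda_pos by (intro add_left_mono divide_right_mono) auto
      also have "\<dots> = 2 * \<Lambda> * \<psi> t"
        using Lambda_pos by (simp add: \<psi>_def field_simps power2_eq_square)
      finally show "?d \<le> 2 * \<Lambda> * \<psi> t" .
    qed
    moreover have "\<phi> t \<le> \<psi> t"
      using K by (simp add: \<psi>_def)
    moreover have "\<psi> 0 \<le> C1 * dat 1 u"
    proof -
      have "\<phi> 0 \<le> 2 * dat 1 u"
        using N_le_dat[of 0 0 1 V1 u] N_le_dat[of 0 0 1 V2 u] by (simp add: \<phi>_def)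
      then show ?thesis
        by (simp add: \<psi>_def C1_def K_def algebra_simps)
    qed
    then have "\<psi> 0 * exp (2 * \<Lambda> * t) \<le> C1 * dat 1 u * exp (2 * \<Lambda> * t)"
      by (rule mult_right_mono) simp
    ultimately have \<phi>: "\<phi> t \<le> C1 * exp (2 * \<Lambda> * t) * dat 1 u"
      by (simp only: ac_simps)
    then show "N (u V1) t + N (u V2) t \<le> C1 * exp (2 * \<Lambda> * t) * dat 1 u"
      by (simp add: \<phi>_def)
    have "K \<le> C * exp (2 * \<Lambda> * t) * dat 1 u"
    proof -
      have "K * 1 \<le> K * exp (2 * \<Lambda> * t)"
        using K t Lambda_pos by (intro mult_left_mono) auto
      then show ?thesis
        by (simp add: K_def ac_simps)
    qed
    moreover have "\<Lambda>\<^sup>2 * \<phi> t \<le> \<Lambda>\<^sup>2 * (C1 * exp (2 * \<Lambda> * t) * dat 1 u)"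
      by (intro mult_left_mono \<phi>) simp
    ultimately show "integ (kinetic u) t \<le> (C + \<Lambda>\<^sup>2 * C1) * exp (2 * \<Lambda> * t) * dat 1 u"
      using kin[OF t] by (simp add: algebra_simps)
  qed
  define C2 where "C2 = C1 + (C + \<Lambda>\<^sup>2 * C1)"
  have "C1 \<le> C2" "C + \<Lambda>\<^sup>2 * C1 \<le> C2" "0 \<le> C2"
    using C1 C(1) by (simp_all add: C2_def)
  then have "C1 * exp (2 * \<Lambda> * t) * dat 1 u \<le> C2 * exp (2 * \<Lambda> * t) * dat 1 u"
    "(C + \<Lambda>\<^sup>2 * C1) * exp (2 * \<Lambda> * t) * dat 1 u \<le> C2 * exp (2 * \<Lambda> * t) * dat 1 u" for t u
    by (intro mult_right_mono; simp add: dat_nonneg)+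
  with * \<open>0 \<le> C2\<close> show ?thesis
    by (intro exI[of _ C2]) (meson order_trans)
qed

text \<open>The time derivatives and \<open>dx (u V2)\<close> occur in the kinetic part.
  \<open>dx (u V1)\<close> does not; it is controlled because, for \<open>b1 \<noteq> 0\<close>,
  \<open>growth\<close> is negative definite in it up to multiples of the square of
  \<open>u V1\<close>.\<close>

lemma Bd_base:
  "Bd {0..} 1 (\<lambda>u. u V1)" "Bd {0..} 1 (\<lambda>u. u V2)"
  "Bd {0..} 1 (\<lambda>u. dt (u V1))" "Bd {0..} 1 (\<lambda>u. dt (u V2))"
  "Bd {0..} 1 (\<lambda>u. kappa * dt (u Q))"
  "b1 \<noteq> 0 \<Longrightarrow> Bd {0..} 1 (\<lambda>u. dx (u V1))" "b1 \<noteq> 0 \<Longrightarrow> Bd {0..} 1 (\<lambda>u. dx (u V2))"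
proof -
  obtain C where C: "C \<ge> 0" and v: "\<And>u t. sol u \<Longrightarrow> t \<ge> 0 \<Longrightarrow> N (u V1) t + N (u V2) t \<le> C * exp (2 * \<Lambda> * t) * dat 1 u"
    and kin: "\<And>u t. sol u \<Longrightarrow> t \<ge> 0 \<Longrightarrow> integ (kinetic u) t \<le> C * exp (2 * \<Lambda> * t) * dat 1 u"
    using energy_bound by blast
  have BdI: "Bd {0..} 1 F" if "K \<ge> 0"
    "\<And>u t. sol u \<Longrightarrow> t \<ge> 0 \<Longrightarrow> N (F u) t \<le> K * (C * exp (2 * \<Lambda> * t) * dat 1 u)" for F K
    unfolding Bd_def using that C by (intro exI[of _ "K * C"]) (auto simp: mult.assoc)
  have pair: "Bd {0..} 1 F" "Bd {0..} 1 G"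
    if FG: "\<And>u t. sol u \<Longrightarrow> t \<ge> 0 \<Longrightarrow> N (F u) t + N (G u) t \<le> C * exp (2 * \<Lambda> * t) * dat 1 u" for F G
  proof -
    have "N (F u) t \<le> C * exp (2 * \<Lambda> * t) * dat 1 u" "N (G u) t \<le> C * exp (2 * \<Lambda> * t) * dat 1 u"
      if "sol u" "t \<ge> 0" for u t
      using FG[OF that] N_nonneg[of "F u" t] N_nonneg[of "G u" t] by simp_all
    then show "Bd {0..} 1 F" "Bd {0..} 1 G"
      using BdI[of 1] by simp_all
  qed
  show "Bd {0..} 1 (\<lambda>u. u V1)" "Bd {0..} 1 (\<lambda>u. u V2)"
    by (rule pair[OF v]; assumption)+
  show "Bd {0..} 1 (\<lambda>u. dt (u V1))" "Bd {0..} 1 (\<lambda>u. dt (u V2))"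
    by (rule pair[OF order_trans[OF N_le_kinetic(1) kin]]; assumption)+
  show "Bd {0..} 1 (\<lambda>u. kappa * dt (u Q))"
  proof -
    obtain M where M: "M > 0" "\<And>t x y. \<bar>val (rho * kappa) t x y\<bar> \<le> M"
      using coef_bounded[of "rho * kappa"] coefs coef_ring(6) by metis
    have "N (kappa * dt (u Q)) t \<le> M * integ (kappa * (dt (u Q))\<^sup>2) t" for u t
      unfolding N_def
    proof (rule integ_bound)
      fix x y
      have "val (rho * kappa) t x y * (val kappa t x y * (val (dt (u Q)) t x y)\<^sup>2)
          \<le> M * (val kappa t x y * (val (dt (u Q)) t x y)\<^sup>2)"
        using M(2)[of t x y] by (intro mult_right_mono) (auto simp: kappa_nonneg)
      then show "val (rho * (kappa * dt (u Q))\<^sup>2) t x y \<le> M * val (kappa * (dt (u Q))\<^sup>2) t x y"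
        by (simp add: val_simps power2_eq_square ac_simps)
    qed
    moreover have "M * integ (kappa * (dt (u Q))\<^sup>2) t \<le> M * (C * exp (2 * \<Lambda> * t) * dat 1 u)" if "sol u" "t \<ge> 0" for u t
      using M(1) kin[OF that] N_le_kinetic(2)[of u t] by (intro mult_left_mono) auto
    ultimately show ?thesis
      using M(1) by (intro BdI[of M]) (blast intro: order_trans less_imp_le)+
  qed
  assume b1: "b1 \<noteq> 0"
  obtain M where M: "M \<ge> 0" "\<And>f t. N f t \<le> M * integ (f\<^sup>2) t"
    using N_le_integ by metis
  show "Bd {0..} 1 (\<lambda>u. dx (u V2))"
  proof (rule BdI[of "M / b1\<^sup>2"])
    fix u t assume "sol u" "(t :: real) \<ge> 0"
    from order_trans[OF N_le_kinetic(3) kin[OF this]]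
    have "integ ((dx (u V2))\<^sup>2) t \<le> C * exp (2 * \<Lambda> * t) * dat 1 u / b1\<^sup>2"
      using b1 by (simp add: field_simps)
    from order_trans[OF M(2) mult_left_mono[OF this M(1)]]
    show "N (dx (u V2)) t \<le> M / b1\<^sup>2 * (C * exp (2 * \<Lambda> * t) * dat 1 u)"
      by simp
  qed (use M(1) in simp)
  obtain c where c: "c > 0" "\<And>t x y. c \<le> 1 - b1\<^sup>2 * val kappa t x y"
    using w_pos by blast
  \<comment> \<open>\<open>P\<close> collects the coefficient of \<open>(u V1)\<^sup>2\<close> in
    \<open>growth\<close> and the one produced by Young's inequality with weight
    \<open>c / 2\<close> for the mixed term. Half of the coercive term, with the constant
    \<open>e\<close> below, remains.\<close>
  define P where "P = (g\<^sup>2 *\<^sub>R (kappa * rho\<^sup>2) + (2 * b1\<^sup>2 / c * g\<^sup>2) *\<^sub>R (kappa\<^sup>2 * rho\<^sup>2)) - g *\<^sub>R dx rho"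
  have "coef P"
    unfolding P_def by (intro coef_ring coef_dx coefs)
  then obtain L where L: "L \<ge> 0" "\<And>f t. \<bar>integ (P * f\<^sup>2) t\<bar> \<le> L * N f t"
    using coef_quadratic[of P] by metis
  obtain C' where C': "C' \<ge> 0" "\<And>u. sol u \<Longrightarrow> \<bar>integ (kinetic u - growth u) 0\<bar> \<le> C' * dat 1 u"
    using initial_energy_bound by blast
  define e where "e = b1\<^sup>2 * c / 2"
  have e: "e > 0"
    using b1 c(1) by (simp add: e_def)
  have dxv: "e * integ ((dx (u V1))\<^sup>2) t \<le> - integ (growth u) t + integ (P * (u V1)\<^sup>2) t" for u t
  proof -
    have "integ (e *\<^sub>R (dx (u V1))\<^sup>2) t \<le> integ (- growth u + P * (u V1)\<^sup>2) t"
    proof (rule integ_mono)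
      fix x y
      define k r d v where "k = val kappa t x y" and "r = val rho t x y" and "d = val (dx (u V1)) t x y" and "v = val (u V1) t x y"
      have "2 * d * (- k * g * r * v) \<le> (c / 2) * d\<^sup>2 + (- k * g * r * v)\<^sup>2 / (c / 2)"
        by (rule young) (use c(1) in simp)
      then have "b1\<^sup>2 * (2 * d * (- k * g * r * v)) \<le> b1\<^sup>2 * ((c / 2) * d\<^sup>2 + (- k * g * r * v)\<^sup>2 / (c / 2))"
        by (rule mult_left_mono) simp
      then have "b1\<^sup>2 * (2 * d * (- k * g * r * v)) \<le>
          b1\<^sup>2 * (c * d\<^sup>2) / 2 + b1\<^sup>2 * ((- k * g * r * v)\<^sup>2 / (c / 2))"
        by (simp add: distrib_left)
      moreover have "e * d\<^sup>2 = b1\<^sup>2 * (c * d\<^sup>2) / 2"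
        by (simp add: e_def)
      moreover have "b1\<^sup>2 * (c * d\<^sup>2) \<le> b1\<^sup>2 * ((1 - b1\<^sup>2 * k) * d\<^sup>2)"
        using c(2)[of t x y] by (intro mult_left_mono mult_right_mono) (simp_all add: k_def)
      moreover have "b1\<^sup>2 * ((- k * g * r * v)\<^sup>2 / (c / 2)) = (2 * b1\<^sup>2 / c * g\<^sup>2) * (k\<^sup>2 * r\<^sup>2) * v\<^sup>2"
        by (simp add: power_mult_distrib field_simps)
      moreover have "k * (g * (r * v) - b1\<^sup>2 * d)\<^sup>2 - b1\<^sup>2 * d\<^sup>2 =
          g\<^sup>2 * (k * r\<^sup>2) * v\<^sup>2 + b1\<^sup>2 * (2 * d * (- k * g * r * v)) - b1\<^sup>2 * ((1 - b1\<^sup>2 * k) * d\<^sup>2)"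
        by (simp add: power2_eq_square algebra_simps)
      ultimately have "e * d\<^sup>2 \<le> - (k * (g * (r * v) - b1\<^sup>2 * d)\<^sup>2 - b1\<^sup>2 * d\<^sup>2)
          + (g\<^sup>2 * (k * r\<^sup>2) * v\<^sup>2 + (2 * b1\<^sup>2 / c * g\<^sup>2) * (k\<^sup>2 * r\<^sup>2) * v\<^sup>2)"
        by linarith
      then show "val (e *\<^sub>R (dx (u V1))\<^sup>2) t x y \<le> val (- growth u + P * (u V1)\<^sup>2) t x y"
        by (simp add: growth_def pot_def P_def val_simps k_def r_def d_def v_def algebra_simps)
    qed
    then show ?thesis
      by (simp add: integ_linear)
  qed
  show "Bd {0..} 1 (\<lambda>u. dx (u V1))"
  proof -
    have "N (dx (u V1)) t \<le> (M / e * (C' + L * C)) * exp (2 * \<Lambda> * t) * dat 1 u" if u: "sol u" and t: "t \<ge> 0" for u t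
    proof -
      have "N (u V1) t \<le> C * exp (2 * \<Lambda> * t) * dat 1 u"
        using v[OF u t] N_nonneg[of "u V2" t] by simp
      from mult_left_mono[OF this L(1)] L(2)[of "u V1" t]
      have 1: "integ (P * (u V1)\<^sup>2) t \<le> L * (C * exp (2 * \<Lambda> * t) * dat 1 u)"
        by linarith
      have "C' * dat 1 u * 1 \<le> C' * dat 1 u * exp (2 * \<Lambda> * t)"
        using C'(1) t Lambda_pos by (intro mult_left_mono) (auto simp: dat_nonneg)
      \<comment> \<open>As the kinetic part is nonnegative, conservation bounds minus the growth
        term by the initial energy.\<close>
      with energy_eq[OF u t] C'(2)[OF u] N_le_kinetic(4)[of u t]
      have 2: "- integ (growth u) t \<le> C' * dat 1 u * exp (2 * \<Lambda> * t)"
        by linarith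
      have "integ ((dx (u V1))\<^sup>2) t \<le> (C' + L * C) * exp (2 * \<Lambda> * t) * dat 1 u / e"
        using dxv[of u t] 1 2 e by (simp add: field_simps)
      from order_trans[OF M(2) mult_left_mono[OF this M(1)]] show ?thesis
        by simp
    qed
    then show ?thesis
      unfolding Bd_def using M(1) e C C'(1) L(1) by (intro exI[of _ "M / e * (C' + L * C)"]) auto
  qed
qed


lemma Bdx_base:
  "Bdx {0..} 0 1 (\<lambda>u. u V1)" "Bdx {0..} 0 1 (\<lambda>u. u V2)"
  "Bdx {0..} 0 1 (\<lambda>u. dt (u V1))" "Bdx {0..} 0 1 (\<lambda>u. dt (u V2))"
  "Bdx {0..} 0 1 (\<lambda>u. kappa * dt (u Q))"
  "b1 \<noteq> 0 \<Longrightarrow> Bdx {0..} 0 1 (\<lambda>u. dx (u V1))" "b1 \<noteq> 0 \<Longrightarrow> Bdx {0..} 0 1 (\<lambda>u. dx (u V2))"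
proof -
  note d = derivation_simps coef_simps dx_dt dy_dt dy_dx
  show "Bdx {0..} 0 1 (\<lambda>u. u V1)"
    by (rule tangential_lift[OF Bd_base(1)]; simp add: d)
  show "Bdx {0..} 0 1 (\<lambda>u. u V2)"
    by (rule tangential_lift[OF Bd_base(2)]; simp add: d)
  show "Bdx {0..} 0 1 (\<lambda>u. dt (u V1))"
    by (rule tangential_lift[OF Bd_base(3)]; simp add: d)
  show "Bdx {0..} 0 1 (\<lambda>u. dt (u V2))"
    by (rule tangential_lift[OF Bd_base(4)]; simp add: d)
  show "Bdx {0..} 0 1 (\<lambda>u. kappa * dt (u Q))"
    by (rule tangential_lift[OF Bd_base(5)]; simp add: d)
  show "Bdx {0..} 0 1 (\<lambda>u. dx (u V1))" if "b1 \<noteq> 0"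
    by (rule tangential_lift[OF Bd_base(6)[OF that]]; simp add: d)
  show "Bdx {0..} 0 1 (\<lambda>u. dx (u V2))" if "b1 \<noteq> 0"
    by (rule tangential_lift[OF Bd_base(7)[OF that]]; simp add: d)
qed

end

section \<open>Recovering the normal derivatives\<close>

context linear_mhd
begin

text \<open>The energy controls \<open>dt (u Q)\<close> only through this multiple, which vanishes
  for incompressible flow.\<close>

definition R :: "state \<Rightarrow> sfield" where "R u = kappa * dt (u Q)"

lemma divergence_eq:
  "sol u \<Longrightarrow> \<delta> u = - R u - g *\<^sub>R (kappa * rho * u V1) + b1\<^sup>2 *\<^sub>R (kappa * dx (u V1))"
  by (simp add: solD(4) R_def pot_def algebra_simps)

text \<open>\<open>dx (u V1)\<close> occurs on both sides of the divergence equation. Collecting it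
  leaves a factor that \<open>w\<close> inverts.\<close>

lemma dx_V1:
  assumes "sol u"
  shows "dx (u V1) = w * (- R u - g *\<^sub>R (kappa * rho * u V1) - dy (u V2))"
proof -
  have "(1 - b1\<^sup>2 *\<^sub>R kappa) * dx (u V1) = - R u - g *\<^sub>R (kappa * rho * u V1) - dy (u V2)"
    using divergence_eq[OF assms] by (simp add: \<delta>_def algebra_simps)
  then have "w * (1 - b1\<^sup>2 *\<^sub>R kappa) * dx (u V1) = w * (- R u - g *\<^sub>R (kappa * rho * u V1) - dy (u V2))"
    by (simp only: mult.assoc)
  then show ?thesis
    unfolding w by simp
qed

text \<open>Differentiating \<open>kappa\<close> would leave an uncontrolled multiple of
  \<open>dt (u Q)\<close>; \<open>lam\<close> rewrites it as a multiple of
  \<open>R u\<close>.\<close>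

lemma dx_R:
  assumes "sol u"
  shows "dx (R u) = lam * R u - kappa * (rho * dt (dt (u V1)) + b1\<^sup>2 *\<^sub>R dx (dy (u V2))
    + g *\<^sub>R (dx rho * u V1 + rho * \<delta> u))"
proof -
  have "dx (dt (u Q)) = - (rho * dt (dt (u V1)) + b1\<^sup>2 *\<^sub>R dx (dy (u V2)) + g *\<^sub>R (dx rho * u V1 + rho * \<delta> u))"
    unfolding second_order(1)[OF assms] by simp
  then show ?thesis
    by (simp only: R_def derivation_mult lam mult.assoc mult_minus_right diff_conv_add_uminus)
qed

text \<open>Subtracting \<open>dy\<close> of the first second-order equation from \<open>dx\<close>
  of the second eliminates \<open>dt (u Q)\<close>. For \<open>b1 = 0\<close> this is a vorticity
  equation; for \<open>b1 \<noteq> 0\<close> it is solved for the third derivative.\<close>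

lemma curl_eq:
  assumes "sol u"
  shows "b1\<^sup>2 *\<^sub>R dx (dx (dx (u V2))) = dx rho * dt (dt (u V2)) + rho * dt (dt (dx (u V2)))
    - rho * dy (dt (dt (u V1))) - b1\<^sup>2 *\<^sub>R dy (dy (dx (u V2)))
    - g *\<^sub>R (dx rho * dy (u V1) + rho * (dy (dx (u V1)) + dy (dy (u V2))))"
  using arg_cong[OF second_order(1)[OF assms], of dy] arg_cong[OF second_order(2)[OF assms], of dx]
  by (simp add: derivation_simps coef_simps \<delta>_def dx_dt dy_dt dy_dx algebra_simps)

definition \<alpha> :: sfield where "\<alpha> = g *\<^sub>R (kappa * rho) - irho * dx rho"

lemma coef_alpha: "coef \<alpha>"
  unfolding \<alpha>_def by (intro coef_rules)

text \<open>
  For \<open>b1 = 0\<close>, subtracting \<open>\<alpha> v\<^sub>2\<close> from the vorticity removes the term with \<open>dt (dt v\<^sub>2)\<close> from the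
  vorticity equation.
\<close>

definition W :: "state \<Rightarrow> sfield" where "W u = dx (u V2) - dy (u V1) - \<alpha> * u V2"

lemma dt_dt_W:
  assumes "sol u" "b1 = 0"
  shows "dt (dt (W u)) = - (g *\<^sub>R (\<alpha> * dy (u V1)))"
proof -
  let ?\<omega> = "dt (dt (dx (u V2))) - dt (dt (dy (u V1)))"
  \<comment> \<open>The second momentum equation replaces \<open>dy (R u)\<close> by a multiple of
    \<open>dt (dt (u V2))\<close>; this contributes the first summand of
    \<open>\<alpha>\<close>.\<close>
  have \<delta>y: "dy (\<delta> u) = kappa * (rho * dt (dt (u V2))) - g *\<^sub>R (kappa * rho * dy (u V1))"
    unfolding second_order(2)[OF assms(1)] using arg_cong[OF divergence_eq[OF assms(1)], of dy] assms(2)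
    by (simp add: R_def derivation_simps coef_simps dy_dt)
  have "rho * ?\<omega> = - (dx rho * dt (dt (u V2))) + g *\<^sub>R (dx rho * dy (u V1)) + g *\<^sub>R (rho * dy (\<delta> u))"
    using curl_eq[OF assms(1)] assms(2) by (simp add: \<delta>_def derivation_simps dy_dt algebra_simps)
  from rho_cancel[OF this]
  have "?\<omega> = irho * (- (dx rho * dt (dt (u V2))) + g *\<^sub>R (dx rho * dy (u V1))) + g *\<^sub>R ((irho * rho) * dy (\<delta> u))"
    by (simp add: algebra_simps)
  then have \<omega>: "?\<omega> = \<alpha> * dt (dt (u V2)) - g *\<^sub>R (\<alpha> * dy (u V1))"
    unfolding irho \<delta>y by (simp add: \<alpha>_def algebra_simps)
  have "dt (dt (W u)) = ?\<omega> - \<alpha> * dt (dt (u V2))"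
    by (simp add: W_def derivation_simps coef_derivatives[OF coef_alpha] dx_dt dy_dt)
  then show ?thesis
    unfolding \<omega> by simp
qed

text \<open>\<open>R\<close> enters the formula for \<open>dx (u V1)\<close> undifferentiated, so it
  may cost two derivatives of the data while the velocity costs one.\<close>

lemma Bdx_V1_step:
  assumes "Bdx {0..} n 1 (\<lambda>u. u V1)" "Bdx {0..} n 1 (\<lambda>u. u V2)" "Bdx {0..} n 2 R"
  shows "Bdx {0..} (Suc n) 1 (\<lambda>u. u V1)"
proof (rule Bdx_Suc[OF Bdx_base(1)])
  have "Bdx {0..} n (Suc 1) R"
    using assms(3) by (simp add: numeral_2_eq_2)
  then show "Bdx {0..} n (Suc 1) (\<lambda>u. dx (u V1))"
    by (intro Bdx_congI[OF dx_V1] Bdx_rules Bdx_dy assms(2) Bdx_mono[OF assms(1)]) simp_all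
qed

lemma Bdx_R_step:
  assumes "Bdx {0..} (Suc n) 1 (\<lambda>u. u V1)" "Bdx {0..} (Suc n) 1 (\<lambda>u. u V2)" "Bdx {0..} n 2 R"
  shows "Bdx {0..} (Suc n) 2 R"
proof (rule Bdx_Suc)
  show "Bdx {0..} 0 2 R"
    using Bdx_mono[OF Bdx_base(5), of 2 0] by (simp add: R_def[abs_def])
  have v: "Bdx {0..} n 1 (\<lambda>u. u V1)" "Bdx {0..} n (Suc 2) (\<lambda>u. u V1)"
    by (rule Bdx_mono[OF assms(1)]; simp)+
  have 1: "Bdx {0..} n (Suc 2) (\<lambda>u. dt (dt (u V1)))"
    using Bdx_dt[OF Bdx_dt[OF v(1)]] by (simp add: numeral_2_eq_2)
  have 2: "Bdx {0..} n (Suc 2) (\<lambda>u. dx (dy (u V2)))"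
    using Bdx_dx[OF Bdx_dy[OF assms(2)]] by (simp add: numeral_2_eq_2)
  have 3: "Bdx {0..} n (Suc 2) \<delta>"
    unfolding \<delta>_def[abs_def]
    by (intro Bdx_add Bdx_mono[OF Bdx_dx[OF assms(1)]] Bdx_mono[OF Bdx_dy[OF assms(2)]]) simp_all
  have 4: "Bdx {0..} n (Suc 2) R"
    by (rule Bdx_mono[OF assms(3)]) simp_all
  show "Bdx {0..} n (Suc 2) (\<lambda>u. dx (R u))"
    by (intro Bdx_congI[OF dx_R] Bdx_rules 1 2 3 4 v(2))
qed

text \<open>The second time derivative of \<open>W\<close> involves only \<open>dy (u V1)\<close>,
  so \<open>W\<close> is bounded by integrating twice in time, with unchanged rate. Its own initial
  values cost one derivative of the data, those of \<open>dt (W u)\<close> two.\<close>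

lemma Bdx_V2_step_no_field:
  assumes "b1 = 0" "Bdx {0..} n 1 (\<lambda>u. u V1)" "Bdx {0..} n 1 (\<lambda>u. u V2)"
  shows "Bdx {0..} (Suc n) 1 (\<lambda>u. u V2)"
proof (rule Bdx_Suc[OF Bdx_base(2)])
  have 0: "Bdx {0} n 2 W" "Bdx {0} n 2 (\<lambda>u. dt (W u))"
  proof -
    have "Bdx {0} n (Suc 0) (\<lambda>u. u V2)"
      by (rule Bdx_mono[OF Bdx_initial]) auto
    then have "Bdx {0} n 1 W"
      unfolding W_def[abs_def] One_nat_def
      by (intro Bdx_diff Bdx_coef coef_alpha Bdx_dx Bdx_dy Bdx_initial) simp_all
    then show "Bdx {0} n 2 W" "Bdx {0} n 2 (\<lambda>u. dt (W u))"
      using Bdx_dt[of "{0}" n 1 W] by (auto intro: Bdx_mono simp: numeral_2_eq_2)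
  qed
  have "Bdx {0..} n 2 (\<lambda>u. dy (u V1))"
    using Bdx_dy[OF assms(2)] by (simp add: numeral_2_eq_2)
  then have "Bdx {0..} n 2 (\<lambda>u. dt (dt (W u)))"
    by (intro Bdx_congI[OF dt_dt_W[OF _ assms(1)]] Bdx_rules coef_alpha)
  then have W: "Bdx {0..} n (Suc 1) W"
    using Bdx_time_integration[OF Bdx_time_integration[OF _ 0(2)] 0(1)] by (simp add: numeral_2_eq_2)
  have "dx (u V2) = W u + \<alpha> * u V2 + dy (u V1)" for u
    by (simp add: W_def)
  then show "Bdx {0..} n (Suc 1) (\<lambda>u. dx (u V2))"
    by (simp only:, intro Bdx_add Bdx_coef coef_alpha W Bdx_mono[OF assms(3)] Bdx_dy assms(2)) simp_all
qed

lemma Bdx_dx_dx_dx_V2: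
  assumes "b1 \<noteq> 0" "Bdx T n (Suc k) (\<lambda>u. dx (u V2))" "Bdx T n (Suc k) (\<lambda>u. dt (u V1))"
    "Bdx T n (Suc k) (\<lambda>u. u V2)" "Bdx T n (Suc (Suc k)) (\<lambda>u. u V1)" "Bdx T n (Suc (Suc k)) (\<lambda>u. dx (u V1))"
  shows "Bdx T n (Suc (Suc (Suc k))) (\<lambda>u. dx (dx (dx (u V2))))"
proof -
  have eq: "dx (dx (dx (u V2))) = (1 / b1\<^sup>2) *\<^sub>R (dx rho * dt (dt (u V2)) + rho * dt (dt (dx (u V2)))
    - rho * dy (dt (dt (u V1))) - b1\<^sup>2 *\<^sub>R dy (dy (dx (u V2)))
    - g *\<^sub>R (dx rho * dy (u V1) + rho * (dy (dx (u V1)) + dy (dy (u V2)))))" if "sol u" for u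
    unfolding curl_eq[OF that, symmetric] using assms(1) by simp
  show ?thesis
    by (intro Bdx_congI[OF eq] Bdx_rules Bdx_dt Bdx_dy assms(2-6))
qed

text \<open>The curl equation yields the third derivative in \<open>x\<close> but not the second.
  The first is bounded by the energy and the second by the Poincare inequality for the periodic
  field \<open>b1 *\<^sub>R dx (u V2)\<close>, hence the three cases for \<open>n\<close>.\<close>

lemma Bdx_V2_step_field:
  assumes "b1 \<noteq> 0" "Bdx {0..} n 1 (\<lambda>u. u V1)" "Bdx {0..} n 1 (\<lambda>u. u V2)"
  shows "Bdx {0..} (Suc n) 1 (\<lambda>u. u V2)"
proof -
  note base = Bdx_base(1-4) Bdx_base(6,7)[OF assms(1)]
  have 1: "Bdx {0..} 0 (Suc 1) (\<lambda>u. dx (u V2))"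
    by (rule Bdx_mono[OF base(6)]) simp_all
  have "Bdx {0..} 0 (Suc (Suc 0)) (\<lambda>u. u V1)" "Bdx {0..} 0 (Suc (Suc 0)) (\<lambda>u. dx (u V1))"
    by (rule Bdx_mono[OF base(1)] Bdx_mono[OF base(5)]; simp)+
  \<comment> \<open>Here \<open>k = 0\<close>: the energy bounds \<open>dx (u V2)\<close> by one
    derivative of the data rather than two. The third derivative thus costs three derivatives of the
    data, no more than the second derivative is allowed to cost.\<close>
  from Bdx_dx_dx_dx_V2[OF assms(1) base(6,3,2)[unfolded One_nat_def] this]
  have "Bdx {0..} 0 (Suc (Suc 1)) (\<lambda>u. dx (dx (dx (u V2))))"
    by simp
  then have "Bdx {0..} 0 (Suc (Suc 1)) (\<lambda>u. b1 *\<^sub>R dx (dx (dx (u V2))))"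
    by (rule Bdx_scaleR)
  then have "Bdx {0..} 0 (Suc (Suc 1)) (\<lambda>u. dx (dx (b1 *\<^sub>R dx (u V2))))"
    by (simp add: derivation_simps)
  then have "Bdx {0..} 0 (Suc (Suc 1)) (\<lambda>u. dx (b1 *\<^sub>R dx (u V2)))"
    by (rule Bdx_poincare[rotated]) (rule perx_b1_dx_V2)
  from Bdx_scaleR[OF this, of "1 / b1"] have 2: "Bdx {0..} 0 (Suc (Suc 1)) (\<lambda>u. dx (dx (u V2)))"
    using assms(1) by (simp add: derivation_simps)
  consider "n = 0" | "n = 1" | l where "n = Suc (Suc l)"
    by (cases n; cases "n - 1") auto
  then show ?thesis
  proof cases
    case 1
    then show ?thesis
      using Bdx_Suc[OF base(2) \<open>Bdx {0..} 0 (Suc 1) (\<lambda>u. dx (u V2))\<close>] by simp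
  next
    case 2
    then show ?thesis
      using Bdx_Suc[OF base(2) Bdx_Suc[OF 1 \<open>Bdx {0..} 0 (Suc (Suc 1)) (\<lambda>u. dx (dx (u V2)))\<close>]] by simp
  next
    case 3
    have v: "Bdx {0..} (Suc (Suc l)) 1 (\<lambda>u. u V1)" "Bdx {0..} (Suc (Suc l)) 1 (\<lambda>u. u V2)"
      using assms(2,3) 3 by simp_all
    have "Bdx {0..} l (Suc (Suc (Suc 1))) (\<lambda>u. dx (dx (dx (u V2))))"
    proof (rule Bdx_dx_dx_dx_V2[OF assms(1)])
      show "Bdx {0..} l (Suc 1) (\<lambda>u. dx (u V2))" "Bdx {0..} l (Suc (Suc 1)) (\<lambda>u. dx (u V1))"
        by (rule Bdx_mono[OF Bdx_dx[OF v(2)]] Bdx_mono[OF Bdx_dx[OF v(1)]]; simp)+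
      show "Bdx {0..} l (Suc 1) (\<lambda>u. dt (u V1))"
        by (rule Bdx_mono[OF Bdx_dt[OF v(1)]]; simp)
      show "Bdx {0..} l (Suc 1) (\<lambda>u. u V2)" "Bdx {0..} l (Suc (Suc 1)) (\<lambda>u. u V1)"
        by (rule Bdx_mono[OF v(2)] Bdx_mono[OF v(1)]; simp)+
    qed
    then show ?thesis
      using Bdx_Suc[OF base(2) Bdx_Suc[OF 1 Bdx_Suc[OF 2]]] 3 by simp
  qed
qed

text \<open>The order within a step matters: \<open>u V2\<close> and \<open>u V1\<close> at level
  \<open>Suc n\<close> use only level \<open>n\<close>, while \<open>R\<close> at level
  \<open>Suc n\<close> uses both of them at that level.\<close>

lemma Bdx_velocity:
  "Bdx {0..} n 1 (\<lambda>u. u V1) \<and> Bdx {0..} n 1 (\<lambda>u. u V2) \<and> Bdx {0..} n 2 R"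
proof (induction n)
  case 0
  show ?case
    using Bdx_base(1,2) Bdx_mono[OF Bdx_base(5), of 2 0] by (simp add: R_def[abs_def])
next
  case (Suc n)
  then have n: "Bdx {0..} n 1 (\<lambda>u. u V1)" "Bdx {0..} n 1 (\<lambda>u. u V2)" "Bdx {0..} n 2 R"
    by simp_all
  have "Bdx {0..} (Suc n) 1 (\<lambda>u. u V2)"
    using Bdx_V2_step_no_field[OF _ n(1,2)] Bdx_V2_step_field[OF _ n(1,2)] by (cases "b1 = 0") simp_all
  then show ?case
    using Bdx_V1_step[OF n] Bdx_R_step[OF Bdx_V1_step[OF n] _ n(3)] by simp
qed

lemma Bdx_field:
  assumes "v \<noteq> Q"
  shows "Bdx {0..} n 2 (\<lambda>u. u v)"
proof -
  have V: "Bdx {0..} m 1 (\<lambda>u. u V1)" "Bdx {0..} m 1 (\<lambda>u. u V2)" for m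
    using Bdx_velocity by blast+
  have D: "Bdx {0..} n 2 (\<lambda>u. dx (u V2))" "Bdx {0..} n 2 (\<lambda>u. dy (u V2))" "Bdx {0..} n 2 (\<lambda>u. u V1)"
    "Bdx {0..} n 2 (\<lambda>u. u V2)" "Bdx {0..} n 2 \<delta>"
  proof -
    show "Bdx {0..} n 2 (\<lambda>u. dx (u V2))" "Bdx {0..} n 2 (\<lambda>u. dy (u V2))"
      using Bdx_dx[OF V(2)[of "Suc n"]] Bdx_dy[OF V(2)[of n]] by (simp_all add: numeral_2_eq_2)
    then show "Bdx {0..} n 2 \<delta>"
      unfolding \<delta>_def[abs_def] using Bdx_dx[OF V(1)[of "Suc n"]]
      by (intro Bdx_add) (simp_all add: numeral_2_eq_2)
    show "Bdx {0..} n 2 (\<lambda>u. u V1)"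
      by (rule Bdx_mono[OF V(1)[of n]]) simp_all
    show "Bdx {0..} n 2 (\<lambda>u. u V2)"
      by (rule Bdx_mono[OF V(2)[of n]]) simp_all
  qed
  have int: "Bdx {0..} n 2 (\<lambda>u. u v)" if "Bdx {0..} n 2 (\<lambda>u. dt (u v))" "v \<noteq> Q" for v
    by (rule Bdx_time_integration[OF that(1) Bdx_mono[OF Bdx_initial[OF that(2)]]]) auto
  \<comment> \<open>\<open>u M1\<close> comes first because it is the forcing in the equation for
    \<open>u V3\<close>.\<close>
  have M1: "Bdx {0..} n 2 (\<lambda>u. u M1)"
    by (rule int, rule Bdx_congI[OF solD(5)], assumption) (intro Bdx_rules D, simp)
  show ?thesis
  proof (cases v)
    case Sigma
    show ?thesis
      unfolding Sigma by (rule int, rule Bdx_congI[OF solD(3)], assumption) (intro Bdx_rules D, simp)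
  next
    case V3
    show ?thesis
      unfolding V3
      by (rule int, rule Bdx_congI[OF rho_cancel[OF solD(7)]], assumption) (intro Bdx_rules M1, simp)
  next
    case M2
    show ?thesis
      unfolding M2 by (rule int, rule Bdx_congI[OF solD(6)], assumption) (intro Bdx_rules D, simp)
  next
    case M3
    show ?thesis
      unfolding M3 by (rule int, rule Bdx_congI[OF solD(8)], assumption) (intro Bdx_rules D, simp)
  qed (use D M1 assms in auto)
qed

lemma growth_bound:
  obtains C where "C \<ge> 0" "\<And>u t. sol u \<Longrightarrow> t \<ge> 0 \<Longrightarrow>
    (\<Sum>(i, j)\<in>{(i, j). i + j \<le> k}. \<Sum>v\<in>- {Q}. N ((dx ^^ i) ((dy ^^ j) (u v))) t)
      \<le> C * (exp (2 * \<Lambda> * t) * dat (k + 2) u)"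
proof -
  \<comment> \<open>Solution and time form one pair, so that \<open>sum_uniform_bound\<close> gives
    a constant uniform in both.\<close>
  have "\<exists>C\<ge>0. \<forall>ut. sol (fst ut) \<and> snd ut \<ge> 0 \<longrightarrow>
    (\<Sum>p\<in>{p. fst p + snd p \<le> k}. \<Sum>v\<in>- {Q}. N ((dx ^^ fst p) ((dy ^^ snd p) (fst ut v))) (snd ut))
      \<le> C * (exp (2 * \<Lambda> * snd ut) * dat (k + 2) (fst ut))"
  proof (rule sum_uniform_bound, rule finite_le_pairs[unfolded case_prod_beta], rule sum_uniform_bound)
    fix p v assume p: "p \<in> {p. fst p + snd p \<le> k}" and v: "v \<in> - {Q}"
    have "Bds {0..} (fst p) (2 + 0) (\<lambda>u. (dt ^^ 0) (u v))"
      using Bdx_field[of v "fst p"] v unfolding Bdx_def by blast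
    then have "Bd {0..} (fst p + snd p + (2 + 0)) (\<lambda>u. (dx ^^ fst p) ((dy ^^ snd p) ((dt ^^ 0) (u v))))"
      unfolding Bds_def by blast
    then have "Bd {0..} (k + 2) (\<lambda>u. (dx ^^ fst p) ((dy ^^ snd p) ((dt ^^ 0) (u v))))"
      by (rule Bd_mono) (use p in simp)
    then obtain C where "C \<ge> 0" "\<And>u t. sol u \<Longrightarrow> t \<ge> 0 \<Longrightarrow>
        N ((dx ^^ fst p) ((dy ^^ snd p) (u v))) t \<le> C * exp (2 * \<Lambda> * t) * dat (k + 2) u"
      by (auto simp: Bd_def)
    then show "\<exists>C\<ge>0. \<forall>ut. sol (fst ut) \<and> snd ut \<ge> 0 \<longrightarrow>
        N ((dx ^^ fst p) ((dy ^^ snd p) (fst ut v))) (snd ut)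
        \<le> C * (exp (2 * \<Lambda> * snd ut) * dat (k + 2) (fst ut))"
      by (intro exI[of _ C]) (simp add: mult.assoc)
  qed (simp add: vars_except_Q)
  then obtain C where C: "C \<ge> 0" "\<And>ut. sol (fst ut) \<and> snd ut \<ge> 0 \<Longrightarrow>
    (\<Sum>p\<in>{p. fst p + snd p \<le> k}. \<Sum>v\<in>- {Q}. N ((dx ^^ fst p) ((dy ^^ snd p) (fst ut v))) (snd ut))
      \<le> C * (exp (2 * \<Lambda> * snd ut) * dat (k + 2) (fst ut))"
    by blast
  show thesis
    by (rule that[OF C(1)], unfold case_prod_beta, use C(2)[of "(_, _)"] in simp)
qed

end

section \<open>Coefficients of an equilibrium\<close>

lemma has_vector_derivative_vector_3:
  assumes "(f1 has_real_derivative d1) (at x within S)" "(f2 has_real_derivative d2) (at x within S)"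
    "(f3 has_real_derivative d3) (at x within S)"
  shows "((\<lambda>r. vector [f1 r, f2 r, f3 r] :: real^3) has_vector_derivative vector [d1, d2, d3]) (at x within S)"
proof -
  have *: "(f has_derivative (\<lambda>r. r * d)) (at x within S)" if "(f has_real_derivative d) (at x within S)" for f d
    using that by (simp add: has_field_derivative_def mult_commute_abs)
  show ?thesis
    unfolding has_vector_derivative_def
    by (subst has_derivative_componentwise_within)
      (auto simp: Basis_vec_def inner_axis forall_3 vector_3 intro!: *[OF assms(1)] *[OF assms(2)] *[OF assms(3)])
qed

lemma Dx_val:
  assumes "t \<ge> 0" "x \<in> {0..2 * pi}" "\<And>x. x \<in> {0..2 * pi} \<Longrightarrow> F x y = val G t x y"
  shows "Dx F x y = val (dx G) t x y"
  by (rule Dx_eqI[OF has_vector_derivative_transform[OF assms(2) _ has_vector_derivative_val(2)]])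
    (use assms in auto)

lemma Dy_val:
  assumes "t \<ge> 0" "x \<in> {0..2 * pi}" "\<And>y. F x y = val G t x y"
  shows "Dy F x y = val (dy G) t x y"
  by (rule Dy_eqI) (use has_vector_derivative_val(3)[OF assms(1,2), of G y UNIV] assms(3) in simp)

lemma Dt_val:
  assumes "t \<ge> 0" "x \<in> {0..2 * pi}" "\<And>t. t \<ge> 0 \<Longrightarrow> F t x y = val G t x y"
  shows "Dt F t x y = val (dt G) t x y"
  by (rule Dt_eqI[OF has_vector_derivative_transform[OF _ _ has_vector_derivative_val(1)]])
    (use assms in auto)

abbreviation vec3 :: "sfield \<Rightarrow> sfield \<Rightarrow> sfield \<Rightarrow> real \<Rightarrow> real \<Rightarrow> real \<Rightarrow> real^3" where
  "vec3 f1 f2 f3 t x y \<equiv> vector [val f1 t x y, val f2 t x y, val f3 t x y]"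

lemma Dx_vec3:
  assumes "t \<ge> 0" "x \<in> {0..2 * pi}" "\<And>x. x \<in> {0..2 * pi} \<Longrightarrow> F x y = vec3 f1 f2 f3 t x y"
  shows "Dx F x y = vec3 (dx f1) (dx f2) (dx f3) t x y"
  by (rule Dx_eqI[OF has_vector_derivative_transform[OF assms(2) _
          has_vector_derivative_vector_3[OF has_derivative_val(2) has_derivative_val(2) has_derivative_val(2)]]])
    (use assms in auto)

lemma Dy_vec3:
  assumes "t \<ge> 0" "x \<in> {0..2 * pi}" "\<And>y. F x y = vec3 f1 f2 f3 t x y"
  shows "Dy F x y = vec3 (dy f1) (dy f2) (dy f3) t x y"
  by (rule Dy_eqI)
    (use has_vector_derivative_vector_3[OF has_derivative_val(3)[OF assms(1,2), of f1 y]
        has_derivative_val(3)[OF assms(1,2), of f2 y] has_derivative_val(3)[OF assms(1,2), of f3 y]] assms(3) in simp)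

lemma Dt_vec3:
  assumes "t \<ge> 0" "x \<in> {0..2 * pi}" "\<And>t. t \<ge> 0 \<Longrightarrow> F t x y = vec3 f1 f2 f3 t x y"
  shows "Dt F t x y = vec3 (dt f1) (dt f2) (dt f3) t x y"
  by (rule Dt_eqI[OF has_vector_derivative_transform[OF _ _
          has_vector_derivative_vector_3[OF has_derivative_val(1) has_derivative_val(1) has_derivative_val(1)]]])
    (use assms in auto)

text \<open>A continuous nonnegative function with integral zero vanishes on the cell; periodicity
  carries this to all \<open>y\<close>.\<close>

lemma integ_square_eq_0:
  assumes "integ (f\<^sup>2) t = 0" "x \<in> {0..2 * pi}"
  shows "val f t x y = 0"
proof -
  have 0: "val f t x y = 0" if "x \<in> {0..2 * pi}" "y \<in> {0..2 * pi}" for x y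
  proof -
    have c: "continuous_on (cbox (0, 0) (2 * pi, 2 * pi)) (\<lambda>z. val (f\<^sup>2) t (fst z) (snd z))"
      by (intro continuous_on_val continuous_intros)
    have ne: "box (0 :: real, 0 :: real) (2 * pi, 2 * pi) \<noteq> {}"
      by (auto simp: box_ne_empty Basis_prod_def)
    have "integral (cbox (0, 0) (2 * pi, 2 * pi)) (\<lambda>z. val (f\<^sup>2) t (fst z) (snd z)) = 0"
      using assms(1) by (simp add: integ_def)
    then have "\<forall>z\<in>cbox (0, 0) (2 * pi, 2 * pi). val (f\<^sup>2) t (fst z) (snd z) = 0"
      by (subst (asm) integral_cbox_eq_0_iff[OF c ne]) (simp_all add: val_simps)
    then have "val (f\<^sup>2) t (fst (x, y)) (snd (x, y)) = 0"
      using that by (auto simp: cbox_Pair_eq)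
    then show ?thesis
      by (simp add: val_simps)
  qed
  have per: "val f t x (y + 2 * pi * of_int n) = val f t x y" for y n
  proof (induction n rule: int_induct[where k = 0])
    case (step1 i)
    then show ?case
      using val_periodic[of f t x "y + 2 * pi * of_int i"] by (simp add: algebra_simps)
  next
    case (step2 i)
    then show ?case
      using val_periodic[of f t x "y + 2 * pi * of_int (i - 1)"] by (simp add: algebra_simps)
  qed simp
  define n where "n = - \<lfloor>y / (2 * pi)\<rfloor>"
  have "y + 2 * pi * of_int n = 2 * pi * frac (y / (2 * pi))"
    by (simp add: n_def frac_def field_simps)
  then have "y + 2 * pi * of_int n \<in> {0..2 * pi}"
    using frac_ge_0[of "y / (2 * pi)"] frac_lt_1[of "y / (2 * pi)"] by (simp add: mult_left_le)
  from 0[OF assms(2) this] show ?thesis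
    by (simp add: per)
qed

lemma val_in_L2: "(\<lambda>x y. val f t x y) \<in> L2_D"
proof -
  have "set_borel_measurable lborel D (\<lambda>z. val f t (fst z) (snd z))"
    using set_integrable_D_val[of f t] unfolding set_integrable_def set_borel_measurable_def
    by (rule borel_measurable_integrable)
  then show ?thesis
    using set_integrable_D_val[of "f\<^sup>2" t] by (simp add: L2_D_def val_simps)
qed

text \<open>The test functions are periodic, so the boundary terms cancel in the integration by
  parts. This makes smooth velocity components admissible in the supremum.\<close>

lemma weak_derivatives_val:
  assumes "t \<ge> 0"
  shows "perx f \<Longrightarrow> weak_Dx (val f t) (val (dx f) t)" "weak_Dy (val f t) (val (dy f) t)"
proof -
  have emb: "val (embed (\<lambda>t. \<phi>)) t x y = \<phi> x y" if "\<phi> \<in> periodic_test" "x \<in> {0..2 * pi}" for \<phi> x y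
    using that assms by (intro val_embed) (auto simp: periodic_test_def)
  have px: "perx (embed (\<lambda>t. \<phi>))" if "\<phi> \<in> periodic_test" for \<phi>
    using that by (simp add: perx_def embed.rep_eq clamp_def periodic_test_def periodic_x_def)
  have D: "Dx \<phi> x y = val (dx (embed (\<lambda>t. \<phi>))) t x y" "Dy \<phi> x y = val (dy (embed (\<lambda>t. \<phi>))) t x y"
    if "\<phi> \<in> periodic_test" "x \<in> {0..2 * pi}" for \<phi> x y
    using that assms emb by (auto intro!: Dx_val Dy_val)
  show "weak_Dx (val f t) (val (dx f) t)" if f: "perx f"
    unfolding weak_Dx_def
  proof (intro conjI ballI val_in_L2)
    fix \<phi> assume \<phi>: "\<phi> \<in> periodic_test"
    let ?g = "embed (\<lambda>t. \<phi>)"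
    have "integral_D (\<lambda>x y. val f t x y * Dx \<phi> x y) = integ (f * dx ?g) t"
      "integral_D (\<lambda>x y. val (dx f) t x y * \<phi> x y) = integ (dx f * ?g) t"
      by (rule integral_D_val; simp add: val_simps D emb \<phi>)+
    moreover have "integ (dx (f * ?g)) t = 0"
      by (intro integ_dx perx_ring f px \<phi> assms)
    ultimately show "integral_D (\<lambda>x y. val f t x y * Dx \<phi> x y) = - integral_D (\<lambda>x y. val (dx f) t x y * \<phi> x y)"
      by (simp add: derivation_simps integ_linear)
  qed
  show "weak_Dy (val f t) (val (dy f) t)"
    unfolding weak_Dy_def
  proof (intro conjI ballI val_in_L2)
    fix \<phi> assume \<phi>: "\<phi> \<in> periodic_test"
    let ?g = "embed (\<lambda>t. \<phi>)"
    have "integral_D (\<lambda>x y. val f t x y * Dy \<phi> x y) = integ (f * dy ?g) t"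
      "integral_D (\<lambda>x y. val (dy f) t x y * \<phi> x y) = integ (dy f * ?g) t"
      by (rule integral_D_val; simp add: val_simps D emb \<phi>)+
    moreover have "integ (dy (f * ?g)) t = 0"
      by (intro integ_dy assms)
    ultimately show "integral_D (\<lambda>x y. val f t x y * Dy \<phi> x y) = - integral_D (\<lambda>x y. val (dy f) t x y * \<phi> x y)"
      by (simp add: derivation_simps integ_linear)
  qed
qed

section \<open>The coefficients of the linear system and the variational bound\<close>

locale mhd_equilibrium =
  fixes E :: equilibrium
  assumes steady: "steady_state E"
begin

definition rho :: sfield where "rho = embed (\<lambda>t x y. density E x)"

definition p0 :: sfield where "p0 = embed (\<lambda>t x y. pressure E x)"

definition bz :: sfield where
  "bz = (case orientation E of Along_z \<Rightarrow> embed (\<lambda>t x y. bfield E x) | Along_x \<Rightarrow> 0)"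

text \<open>A field along \<open>x\<close> is constant in a steady state, so its value at
  \<open>0\<close> represents it.\<close>

definition b1 :: real where
  "b1 = (case orientation E of Along_z \<Rightarrow> 0 | Along_x \<Rightarrow> bfield E 0)"

definition irho :: sfield where "irho = recip rho"

text \<open>In the compressible case this is the denominator
  \<open>\<gamma> p\<^sub>0 + B\<^sub>0\<^sup>2\<close> in \<open>H\<close>.\<close>

definition stiffness :: sfield where
  "stiffness = adiabatic E *\<^sub>R p0 + bz\<^sup>2 + b1\<^sup>2 *\<^sub>R 1"

definition kappa :: sfield where
  "kappa = (case flow E of Incompressible \<Rightarrow> 0 | Compressible \<Rightarrow> recip stiffness)"

text \<open>The inverse of \<open>kappa\<close> in the compressible case. It recovers
  \<open>kappa\<close> times a square from the square of \<open>kappa\<close> times the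
  field.\<close>

definition mu :: sfield where
  "mu = (case flow E of Incompressible \<Rightarrow> 0 | Compressible \<Rightarrow> stiffness)"

text \<open>The logarithmic derivative of \<open>kappa\<close>, found by differentiating
  \<open>kappa * stiffness = 1\<close>; it is \<open>0\<close> for incompressible flow.\<close>

definition lam :: sfield where "lam = - (kappa * dx stiffness)"

definition c2 :: sfield where "c2 = adiabatic E *\<^sub>R (p0 * irho)"

definition w :: sfield where "w = recip (1 - b1\<^sup>2 *\<^sub>R kappa)"

lemma smooth_profiles:
  "smooth (\<lambda>t x y. density E x)" "smooth (\<lambda>t x y. bfield E x)" "smooth (\<lambda>t x y. pressure E x)"
  using steady by (auto simp: steady_state_def)

lemma val_profile: "smooth (\<lambda>t x y. h x) \<Longrightarrow> t \<ge> 0 \<Longrightarrow> x \<in> {0..2 * pi} \<Longrightarrow>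
    val (embed (\<lambda>t x y. h x)) t x y = h x"
  by (rule val_embed) (auto simp: periodic_y_def)

lemma val_coefficients:
  assumes "t \<ge> 0" "x \<in> {0..2 * pi}"
  shows "val rho t x y = density E x" "val p0 t x y = pressure E x"
    "B0 E x = vector [b1, 0, val bz t x y]" "(bfield E x)\<^sup>2 = (val bz t x y)\<^sup>2 + b1\<^sup>2"
proof -
  have x: "orientation E = Along_x \<Longrightarrow> bfield E x = bfield E 0"
    using steady assms by (auto simp: steady_state_def)
  show "val rho t x y = density E x" "val p0 t x y = pressure E x"
    using assms smooth_profiles by (simp_all add: rho_def p0_def val_profile)
  show "B0 E x = vector [b1, 0, val bz t x y]" "(bfield E x)\<^sup>2 = (val bz t x y)\<^sup>2 + b1\<^sup>2"
    using assms smooth_profiles x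
    by (cases "orientation E"; simp add: B0_def b1_def bz_def val_profile val_simps)+
qed

lemma coef_basic: "coef rho" "coef p0" "coef bz" "coef stiffness"
proof -
  show *: "coef rho" "coef p0" "coef bz"
    using smooth_profiles coef_ring(1)
    by (auto simp: rho_def p0_def bz_def coef_embed split: orientation.split)
  then show "coef stiffness"
    unfolding stiffness_def by (intro coef_ring)
qed

lemma rho_pos: "t \<ge> 0 \<Longrightarrow> x \<in> {0..2 * pi} \<Longrightarrow> 0 < val rho t x y"
  using steady by (auto simp: steady_state_def val_coefficients intro: less_le_trans)

lemma irho: "irho * rho = 1" "coef irho"
  unfolding irho_def using rho_pos by (auto intro!: recip_mult coef_recip coef_basic simp: less_imp_neq[symmetric])

lemma compressible_pressure:
  assumes "flow E = Compressible"
  shows "cstar E > 0" "adiabatic E > 0"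
    "\<And>x. x \<in> {0..2 * pi} \<Longrightarrow> pressure E x = cstar E * density E x powr adiabatic E"
    "t \<ge> 0 \<Longrightarrow> x \<in> {0..2 * pi} \<Longrightarrow> 0 < adiabatic E * val p0 t x y"
proof -
  show *: "cstar E > 0" "adiabatic E > 0"
    "\<And>x. x \<in> {0..2 * pi} \<Longrightarrow> pressure E x = cstar E * density E x powr adiabatic E"
    using steady assms by (auto simp: steady_state_def)
  show "0 < adiabatic E * val p0 t x y" if "t \<ge> 0" "x \<in> {0..2 * pi}"
    using * rho_pos[OF that, of y] that by (simp add: val_coefficients[OF that])
qed

lemma stiffness_pos:
  assumes "flow E = Compressible" "t \<ge> 0" "x \<in> {0..2 * pi}"
  shows "0 < val stiffness t x y"
  using compressible_pressure(4)[OF assms, of y]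
  by (simp add: stiffness_def val_simps add_pos_nonneg)

lemma kappa_compressible:
  assumes "flow E = Compressible"
  shows "kappa * stiffness = 1" "val kappa t x y = 1 / val stiffness t x y" "coef kappa"
proof -
  have nz: "val stiffness t x y \<noteq> 0" if "t \<ge> 0" "x \<in> {0..2 * pi}" for t x y
    using stiffness_pos[OF assms that, of y] by simp
  show "kappa * stiffness = 1" "val kappa t x y = 1 / val stiffness t x y" "coef kappa"
    using recip_mult[of stiffness, OF nz] val_recip[of stiffness, OF nz] coef_recip[OF coef_basic(4) nz]
    by (simp_all add: kappa_def assms inverse_eq_divide)
qed

lemma coef_kappa: "coef kappa" "coef mu" "coef lam" "coef c2"
proof -
  show *: "coef kappa"
    using kappa_compressible(3) coef_ring(1) by (cases "flow E") (auto simp: kappa_def)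
  show "coef mu"
    using coef_basic(4) coef_ring(1) by (auto simp: mu_def split: flow.split)
  show "coef lam" "coef c2"
    unfolding lam_def c2_def
    by (simp_all add: coef_ring coef_dx coef_basic * irho(2))
qed

lemma kappa_nonneg: "0 \<le> val kappa t x y"
proof (cases "flow E")
  case Incompressible
  then show ?thesis
    by (simp add: kappa_def val_simps)
next
  case Compressible
  have "0 < val stiffness t x y"
    using stiffness_pos[OF Compressible clamp_point] val_clamp[of stiffness t x y] by simp
  then show ?thesis
    by (simp add: kappa_compressible(2)[OF Compressible])
qed

lemma mu: "mu * kappa * kappa = kappa"
proof (cases "flow E")
  case Compressible
  have "mu * kappa * kappa = (kappa * stiffness) * kappa"
    by (simp add: mu_def Compressible ac_simps)
  then show ?thesis
    by (simp add: kappa_compressible(1)[OF Compressible])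
qed (simp add: kappa_def)

lemma dx_kappa: "dx kappa = lam * kappa"
proof (cases "flow E")
  case Compressible
  note k = kappa_compressible(1)[OF Compressible]
  have "dx kappa * stiffness + kappa * dx stiffness = 0"
    using arg_cong[OF k, of dx] by (simp add: derivation_simps)
  then have "(dx kappa * stiffness) * kappa = - (kappa * dx stiffness) * kappa"
    by (simp add: eq_neg_iff_add_eq_0 flip: distrib_right)
  moreover have "(dx kappa * stiffness) * kappa = dx kappa * (kappa * stiffness)"
    by (simp only: ac_simps)
  ultimately show ?thesis
    by (simp add: k lam_def)
qed (simp add: kappa_def derivation_simps)

text \<open>In the compressible case the stiffness exceeds \<open>b1\<^sup>2\<close> by at least the
  positive term \<open>adiabatic E *\<^sub>R p0\<close>; in the incompressible case the value is
  \<open>1\<close>.\<close>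

lemma one_minus_kappa_pos:
  assumes "t \<ge> 0" "x \<in> {0..2 * pi}"
  shows "0 < val (1 - b1\<^sup>2 *\<^sub>R kappa) t x y"
proof (cases "flow E")
  case Incompressible
  then show ?thesis
    by (simp add: kappa_def val_simps)
next
  case Compressible
  note pos = stiffness_pos[OF Compressible assms, of y]
  have "b1\<^sup>2 < val stiffness t x y"
    using compressible_pressure(4)[OF Compressible assms, of y]
    by (simp add: stiffness_def val_simps add_pos_nonneg)
  with pos show ?thesis
    by (simp add: val_simps kappa_compressible(2)[OF Compressible])
qed

lemma w: "w * (1 - b1\<^sup>2 *\<^sub>R kappa) = 1" "coef w"
  "\<exists>c>0. \<forall>t x y. c \<le> 1 - b1\<^sup>2 * val kappa t x y"
proof -
  have c: "coef (1 - b1\<^sup>2 *\<^sub>R kappa)"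
    by (intro coef_ring coef_kappa)
  have nz: "val (1 - b1\<^sup>2 *\<^sub>R kappa) t x y \<noteq> 0" if "t \<ge> 0" "x \<in> {0..2 * pi}" for t x y
    using one_minus_kappa_pos[OF that, of y] by simp
  show "w * (1 - b1\<^sup>2 *\<^sub>R kappa) = 1" "coef w"
    unfolding w_def using nz by (intro recip_mult coef_recip c; simp)+
  show "\<exists>c>0. \<forall>t x y. c \<le> 1 - b1\<^sup>2 * val kappa t x y"
    using coef_bounded_below[OF c one_minus_kappa_pos] by (simp add: val_simps)
qed

lemma val_dx_rho:
  assumes "t \<ge> 0" "x \<in> {0..2 * pi}"
  shows "val (dx rho) t x y = vector_derivative (density E) (at x within {0..2 * pi})"
  using Dx_val[of t x "\<lambda>x y. density E x" y rho] assms by (simp add: Dx_def val_coefficients)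

text \<open>One formula covers the four types: incompressible flow removes the terms with
  \<open>kappa\<close>, and a field along \<open>z\<close> those with \<open>b1\<close>. Hence
  \<open>w'\<close> has to be the derivative only for a field along \<open>x\<close>.\<close>

lemma H_val:
  assumes "t \<ge> 0" "x \<in> {0..2 * pi}" "orientation E = Along_x \<longrightarrow> w' = val (dx f) t x y"
  shows "H E x (val f t x y) w' =
    val (kappa * (gravity E *\<^sub>R (rho * f) - b1\<^sup>2 *\<^sub>R dx f)\<^sup>2 - b1\<^sup>2 *\<^sub>R (dx f)\<^sup>2
      - gravity E *\<^sub>R (dx rho * f\<^sup>2)) t x y"
proof -
  have a: "adiabatic E * pressure E x + (bfield E x)\<^sup>2 = val stiffness t x y"
    using val_coefficients[OF assms(1,2), of y] by (simp add: stiffness_def val_simps)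
  have z: "orientation E = Along_z \<Longrightarrow> b1 = 0" "orientation E = Along_x \<Longrightarrow> (bfield E x)\<^sup>2 = b1\<^sup>2"
    using val_coefficients(4)[OF assms(1,2), of y] by (simp_all add: b1_def bz_def val_simps)
  have k: "flow E = Incompressible \<Longrightarrow> kappa = 0"
    "flow E = Compressible \<Longrightarrow> val kappa t x y = 1 / val stiffness t x y"
    by (simp add: kappa_def) (rule kappa_compressible(2))
  show ?thesis
    unfolding H_def Let_def a using assms(3)
    by (cases "flow E"; cases "orientation E")
      (simp_all add: z k val_simps val_dx_rho[OF assms(1,2)] val_coefficients(1)[OF assms(1,2)]
        power_mult_distrib algebra_simps)
qed

text \<open>A field whose square has nonzero integral is a trial function, so its quotient is at
  most the supremum. The zero function is excluded from \<open>trial\<close> and is treated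
  separately; both integrals are then harmless.\<close>

lemma growth_sup:
  assumes "\<Lambda> > 0" "Lambda_sq E = ereal (\<Lambda>\<^sup>2)" "perx f" "t \<ge> 0"
  shows "integ (kappa * (gravity E *\<^sub>R (rho * f) - b1\<^sup>2 *\<^sub>R dx f)\<^sup>2 - b1\<^sup>2 *\<^sub>R (dx f)\<^sup>2
      - gravity E *\<^sub>R (dx rho * f\<^sup>2)) t \<le> \<Lambda>\<^sup>2 * integ (rho * f\<^sup>2) t"
    (is "integ ?h t \<le> _")
proof (cases "integ (f\<^sup>2) t = 0")
  case True
  have f: "val f t x y = 0" if "x \<in> {0..2 * pi}" for x y
    using integ_square_eq_0[OF True that] .
  have df: "val (dx f) t x y = 0" if "x \<in> {0..2 * pi}" for x y
    using Dx_val[of t x "\<lambda>x y. 0" y f] Dx_val[of t x "\<lambda>x y. 0" y 0] assms(4) that f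
    by (simp add: derivation_simps val_simps)
  have "integ ?h t = integral_D (\<lambda>x y. val 0 t x y)"
    by (rule integral_D_val[symmetric]) (simp add: val_simps f df)
  also have "\<dots> = 0"
    using integral_D_val[of _ 0 t] integ_linear(5) by metis
  finally show ?thesis
    using integ_nonneg[of "rho * f\<^sup>2" t] rho_pos[OF clamp_point] val_clamp[of rho]
    by (simp add: val_simps less_imp_le)
next
  case False
  define w' where "w' = (case orientation E of Along_z \<Rightarrow> (\<lambda>x y. 0) | Along_x \<Rightarrow> val (dx f) t)"
  have "\<not> (AE z\<in>D in lborel. val f t (fst z) (snd z) = 0)"
  proof
    assume AE: "AE z\<in>D in lborel. val f t (fst z) (snd z) = 0"
    have "integ (f\<^sup>2) t = integral_D (\<lambda>x y. val (f\<^sup>2) t x y)"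
      by (rule integral_D_val[symmetric]) simp
    also have "\<dots> = (LINT z:D|lborel. 0)"
      unfolding integral_D_def set_lebesgue_integral_def
      using AE set_integrable_D_val[of "f\<^sup>2" t]
      by (intro integral_cong_AE)
        (auto simp: set_integrable_def val_simps indicator_def split: if_splits intro: borel_measurable_integrable)
    finally show False
      using False by simp
  qed
  then have "(val f t, w') \<in> trial E"
    using val_in_L2[of f t] weak_derivatives_val[OF assms(4)] assms(3)
    by (auto simp: trial_def w'_def split: orientation.split)
  then have "ereal (integral_D (\<lambda>x y. H E x (val f t x y) (w' x y)) / integral_D (\<lambda>x y. density E x * (val f t x y)\<^sup>2))
      \<le> Lambda_sq E"
    unfolding Lambda_sq_def by (intro SUP_upper2[of "(val f t, w')"]) auto
  moreover have "integral_D (\<lambda>x y. H E x (val f t x y) (w' x y)) = integ ?h t"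
    by (rule integral_D_val, rule H_val) (use assms(4) in \<open>auto simp: w'_def\<close>)
  moreover have "integral_D (\<lambda>x y. density E x * (val f t x y)\<^sup>2) = integ (rho * f\<^sup>2) t"
    by (rule integral_D_val) (use assms(4) in \<open>simp add: val_simps val_coefficients\<close>)
  ultimately have le: "integ ?h t / integ (rho * f\<^sup>2) t \<le> \<Lambda>\<^sup>2"
    by (simp add: assms(2))
  have "0 < integ (rho * f\<^sup>2) t"
  proof -
    obtain c where c: "c > 0" "\<And>t x y. c \<le> val rho t x y"
      using coef_bounded_below[OF coef_basic(1) rho_pos] by blast
    have "integ (c *\<^sub>R f\<^sup>2) t \<le> integ (rho * f\<^sup>2) t"
      by (rule integ_mono) (simp add: val_simps mult_right_mono c(2))
    moreover have "0 \<le> integ (f\<^sup>2) t"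
      by (rule integ_nonneg) (simp add: val_simps)
    ultimately show ?thesis
      using c(1) False by (simp add: integ_linear) (smt (verit) mult_pos_pos)
  qed
  then show ?thesis
    using le by (simp add: field_simps)
qed

lemma linear_mhd:
  assumes "\<Lambda> > 0" "Lambda_sq E = ereal (\<Lambda>\<^sup>2)"
  shows "linear_mhd rho irho kappa mu lam c2 bz w (gravity E) b1 \<Lambda>"
  by unfold_locales
    (use assms coef_basic coef_kappa irho w kappa_nonneg mu dx_kappa growth_sup
      coef_bounded_below[OF coef_basic(1) rho_pos] in auto)

end

section \<open>Solutions as scalar fields\<close>

lemma smooth_component: "smooth f \<Longrightarrow> smooth (\<lambda>t x y. f t x y $ i)"
  unfolding smooth_def using Ck_bounded_linear[OF bounded_linear_vec_nth] by blast

lemma vector_3_eq: "(v :: real^3) = vector [v $ 1, v $ 2, v $ 3]"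
  by (simp add: vec_eq_iff forall_3)

lemma vector_3_eq_iff: "(vector [a, b, c] :: real^3) = vector [a', b', c'] \<longleftrightarrow> a = a' \<and> b = b' \<and> c = c'"
  by (auto simp: vec_eq_iff forall_3)

lemma cross3_vector: "cross3 (vector [a, b, c]) (vector [a', b', c']) =
    vector [b * c' - c * b', c * a' - a * c', a * b' - b * a']"
  by (simp add: cross3_def)

lemma vector_3_linear:
  "vector [a, b, c] + vector [a', b', c'] = (vector [a + a', b + b', c + c'] :: real^3)"
  "vector [a, b, c] - vector [a', b', c'] = (vector [a - a', b - b', c - c'] :: real^3)"
  "r *\<^sub>R vector [a, b, c] = (vector [r * a, r * b, r * c] :: real^3)"
  by (simp_all add: vec_eq_iff forall_3)

context mhd_equilibrium
begin

definition fields :: "(real \<Rightarrow> real \<Rightarrow> real \<Rightarrow> real) \<Rightarrow> (real \<Rightarrow> real \<Rightarrow> real \<Rightarrow> real^3) \<Rightarrow>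
    (real \<Rightarrow> real \<Rightarrow> real \<Rightarrow> real^3) \<Rightarrow> (real \<Rightarrow> real \<Rightarrow> real \<Rightarrow> real) \<Rightarrow> state" where
  "fields \<sigma> v B p i = (case i of
      Sigma \<Rightarrow> embed \<sigma>
    | V1 \<Rightarrow> embed (\<lambda>t x y. v t x y $ 1) | V2 \<Rightarrow> embed (\<lambda>t x y. v t x y $ 2) | V3 \<Rightarrow> embed (\<lambda>t x y. v t x y $ 3)
    | M1 \<Rightarrow> embed (\<lambda>t x y. B t x y $ 1) | M2 \<Rightarrow> embed (\<lambda>t x y. B t x y $ 2) | M3 \<Rightarrow> embed (\<lambda>t x y. B t x y $ 3)
    | Q \<Rightarrow> embed p + bz * embed (\<lambda>t x y. B t x y $ 3) + b1 *\<^sub>R embed (\<lambda>t x y. B t x y $ 1))"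

text \<open>These are consequences of the power law for the pressure: the second is its logarithmic
  derivative cleared of denominators, and the third identifies the factor in the linearized pressure
  law with the squared speed of sound.\<close>

lemma compressible_coefficients:
  assumes "flow E = Compressible"
  shows "c2 * rho = adiabatic E *\<^sub>R p0" "adiabatic E *\<^sub>R p0 * dx rho = rho * dx p0"
    "t \<ge> 0 \<Longrightarrow> x \<in> {0..2 * pi} \<Longrightarrow>
      cstar E * adiabatic E * density E x powr (adiabatic E - 1) = val c2 t x y"
proof -
  show c2: "c2 * rho = adiabatic E *\<^sub>R p0"
    using irho(1) by (simp add: c2_def mult.assoc)
  show "adiabatic E *\<^sub>R p0 * dx rho = rho * dx p0"
  proof (rule sfield_eqI)
    fix t x y :: real assume t: "t \<ge> 0" and x: "x \<in> {0..2 * pi}"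
    let ?r = "density E" and ?a = "adiabatic E"
    have r: "?r x > 0"
      using rho_pos[OF t x, of y] val_coefficients(1)[OF t x] by simp
    have "((\<lambda>x. val rho t x y) has_real_derivative val (dx rho) t x y) (at x within {0..2 * pi})"
      by (rule has_derivative_val(2)[OF t x])
    then have d: "(?r has_real_derivative val (dx rho) t x y) (at x within {0..2 * pi})"
      by (rule has_field_derivative_transform_within[of _ _ _ _ 1])
        (use x t in \<open>auto simp: val_coefficients\<close>)
    have "((\<lambda>x. cstar E * ?r x powr ?a) has_real_derivative
        cstar E * (?a * ?r x powr (?a - 1) * val (dx rho) t x y)) (at x within {0..2 * pi})"
      by (rule derivative_eq_intros d refl r | simp add: r powr_diff)+
    then have "((\<lambda>x. val p0 t x y) has_real_derivative
        cstar E * (?a * ?r x powr (?a - 1) * val (dx rho) t x y)) (at x within {0..2 * pi})"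
      by (rule has_field_derivative_transform_within[of _ _ _ _ 1])
        (use x t in \<open>auto simp: val_coefficients compressible_pressure[OF assms]\<close>)
    then have "val (dx p0) t x y = cstar E * (?a * ?r x powr (?a - 1) * val (dx rho) t x y)"
      by (rule val_derivative_eqI(2)[OF t x])
    moreover have "?r x powr ?a = ?r x powr (?a - 1) * ?r x"
      using r by (simp add: powr_diff)
    ultimately show "val (adiabatic E *\<^sub>R p0 * dx rho) t x y = val (rho * dx p0) t x y"
      by (simp add: val_simps val_coefficients[OF t x] compressible_pressure(3)[OF assms x])
  qed
  assume t: "t \<ge> 0" and x: "x \<in> {0..2 * pi}"
  have r: "density E x > 0"
    using rho_pos[OF t x, of y] val_coefficients(1)[OF t x] by simp
  have "val (c2 * rho) t x y = val (adiabatic E *\<^sub>R p0) t x y"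
    by (simp only: c2)
  then have "val c2 t x y * density E x = adiabatic E * (cstar E * density E x powr adiabatic E)"
    by (simp add: val_simps val_coefficients[OF t x] compressible_pressure(3)[OF assms x])
  then show "cstar E * adiabatic E * density E x powr (adiabatic E - 1) = val c2 t x y"
    using r by (simp add: powr_diff field_simps)
qed

text \<open>The force balance of the steady state; the constant component \<open>b1\<close> drops
  out on differentiation.\<close>

lemma equilibrium_balance: "dx p0 + bz * dx bz = gravity E *\<^sub>R rho"
proof (rule sfield_eqI)
  fix t x y :: real assume t: "t \<ge> 0" and x: "x \<in> {0..2 * pi}"
  define f where "f = p0 + (1/2) *\<^sub>R (bz\<^sup>2 + b1\<^sup>2 *\<^sub>R 1)"
  have "((\<lambda>x. pressure E x + 1/2 * (norm (B0 E x))\<^sup>2) has_real_derivative density E x * gravity E)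
      (at x within {0..2 * pi})"
    using steady x by (auto simp: steady_state_def)
  moreover have "pressure E x + 1/2 * (norm (B0 E x))\<^sup>2 = val f t x y" if "x \<in> {0..2 * pi}" for x
    using val_coefficients[OF t that, of y]
    by (simp add: f_def val_simps norm_vec_def L2_set_def sum_3 vector_3)
  ultimately have "((\<lambda>x. val f t x y) has_real_derivative density E x * gravity E) (at x within {0..2 * pi})"
    using x by (auto intro: has_field_derivative_transform_within[of _ _ _ _ 1])
  then have "val (dx f) t x y = density E x * gravity E"
    by (rule val_derivative_eqI(2)[OF t x])
  then show "val (dx p0 + bz * dx bz) t x y = val (gravity E *\<^sub>R rho) t x y"
    by (simp add: f_def derivation_simps power2_eq_square val_simps val_coefficients[OF t x])
qed

lemma fields_val:
  assumes "mhd_solution E \<sigma> v B p" "t \<ge> 0" "x \<in> {0..2 * pi}"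
  defines "u \<equiv> fields \<sigma> v B p"
  shows "\<sigma> t x y = val (u Sigma) t x y"
    and "v t x y = vec3 (u V1) (u V2) (u V3) t x y"
    and "B t x y = vec3 (u M1) (u M2) (u M3) t x y"
    and "p t x y = val (u Q - bz * u M3 - b1 *\<^sub>R u M1) t x y"
proof -
  have e: "val (embed f) t x y = f t x y" if "smooth f" "\<forall>t\<ge>0. periodic_y (f t)" for f
    using that assms by (intro val_embed) auto
  have "smooth \<sigma>" "smooth p" "\<forall>t\<ge>0. periodic_y (\<sigma> t)" "\<forall>t\<ge>0. periodic_y (p t)"
    "smooth (\<lambda>t x y. v t x y $ i)" "smooth (\<lambda>t x y. B t x y $ i)"
    "\<forall>t\<ge>0. periodic_y (\<lambda>x y. v t x y $ i)" "\<forall>t\<ge>0. periodic_y (\<lambda>x y. B t x y $ i)" for i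
    using assms(1) by (auto simp: mhd_solution_def periodic_y_def intro!: smooth_component)
  note e = e[OF this(1,3)] e[OF this(2,4)] e[OF this(5,7)] e[OF this(6,8)]
  show "\<sigma> t x y = val (u Sigma) t x y" "p t x y = val (u Q - bz * u M3 - b1 *\<^sub>R u M1) t x y"
    by (simp_all add: u_def fields_def e)
  show "v t x y = vec3 (u V1) (u V2) (u V3) t x y" "B t x y = vec3 (u M1) (u M2) (u M3) t x y"
    by (simp_all add: u_def fields_def e flip: vector_3_eq)
qed

lemma fields_perx:
  assumes "mhd_solution E \<sigma> v B p"
  defines "u \<equiv> fields \<sigma> v B p"
  shows "perx (u V1)" "perx (u V2)" "perx (u Q)" "perx (u M1)" "perx (u M2)"
proof -
  have *: "perx f" if "\<And>t y. t \<ge> 0 \<Longrightarrow> val f t 0 y = val f t (2 * pi) y" for f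
    unfolding perx_def
  proof (intro allI)
    fix t y
    have "val f t 0 y = val f (max 0 t) 0 y" "val f t (2 * pi) y = val f (max 0 t) (2 * pi) y"
      using val_clamp[of f t 0 y] val_clamp[of f t "2 * pi" y] by simp_all
    then show "val f t 0 y = val f t (2 * pi) y"
      using that[of "max 0 t" y] by simp
  qed
  have d: "(0::real) \<in> {0..2 * pi}" "2 * pi \<in> {0..2 * pi}"
    by simp_all
  note val0 = fields_val[OF assms(1) _ d(1), folded u_def] and val1 = fields_val[OF assms(1) _ d(2), folded u_def]
  have per: "v t 0 y = v t (2 * pi) y" "B t 0 y = B t (2 * pi) y"
    "p t 0 y + B0 E 0 \<bullet> B t 0 y = p t (2 * pi) y + B0 E (2 * pi) \<bullet> B t (2 * pi) y" if "t \<ge> 0" for t y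
    using assms(1) that unfolding mhd_solution_def periodic_x_def by blast+
  show "perx (u V1)" "perx (u V2)" "perx (u M1)" "perx (u M2)"
    using per(1,2) by (auto intro!: * simp: val0 val1 vector_3_eq_iff)
  have "p t x y + B0 E x \<bullet> B t x y = val (u Q) t x y" if "t \<ge> 0" "x \<in> {0..2 * pi}" for t x y
    using that by (simp add: fields_val[OF assms(1) that, folded u_def] val_coefficients(3)[OF that, of y]
        inner_vec_def sum_3 vector_3 val_simps)
  then show "perx (u Q)"
    using per(3) d by (intro *) metis
qed

text \<open>The pointwise vector equations become ring identities for the components. For
  compressible flow the divergence equation needs a derivation: the formula for \<open>u Q\<close>
  is differentiated in time and simplified with \<open>equilibrium_balance\<close>.\<close>

lemma fields_sol:
  assumes "mhd_solution E \<sigma> v B p" "linear_mhd rho irho kappa mu lam c2 bz w (gravity E) b1 \<Lambda>"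
  shows "linear_mhd.sol rho kappa c2 bz (gravity E) b1 (fields \<sigma> v B p)"
proof -
  interpret linear_mhd rho irho kappa mu lam c2 bz w "gravity E" b1 \<Lambda>
    by (rule assms(2))
  define u where "u = fields \<sigma> v B p"
  note val = fields_val[OF assms(1), folded u_def]
  define P where "P = u Q - bz * u M3 - b1 *\<^sub>R u M1"
  \<comment> \<open>Either the equilibrium field is along \<open>z\<close> and \<open>b1\<close> is
    \<open>0\<close>, or the third components of the perturbation vanish.\<close>
  have b1: "b1 *\<^sub>R u V3 = 0" "b1 *\<^sub>R u M3 = 0"
  proof -
    have "b1 * (v t x y $ 3) = 0" "b1 * (B t x y $ 3) = 0" if "t \<ge> 0" "x \<in> {0..2 * pi}" for t x y
      using assms(1) that by (cases "orientation E"; auto simp: b1_def mhd_solution_def)+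
    then show "b1 *\<^sub>R u V3 = 0" "b1 *\<^sub>R u M3 = 0"
      by (auto intro!: sfield_eqI simp: val_simps val)
  qed
  have const: "coef bz" "coef (b1 *\<^sub>R (1 :: sfield))"
    by (intro coef_basic coef_ring)+
  have eqs: "dt (u Sigma) = - (dx rho * u V1) - rho * \<delta> u"
    "rho * dt (u V1) = - (dx bz * u M3) - bz * dx (u M3) - dx P + gravity E *\<^sub>R u Sigma"
    "rho * dt (u V2) = b1 *\<^sub>R (dx (u M2) - dy (u M1)) - bz * dy (u M3) - dy P"
    "rho * dt (u V3) = dx bz * u M1 + b1 *\<^sub>R dx (u M3)"
    "dt (u M1) = - (b1 *\<^sub>R dy (u V2))" "dt (u M2) = b1 *\<^sub>R dx (u V2)"
    "dt (u M3) = dx (b1 *\<^sub>R u V3 - bz * u V1) - dy (bz * u V2)"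
    "flow E = Incompressible \<Longrightarrow> \<delta> u = 0" "flow E = Compressible \<Longrightarrow> P = c2 * u Sigma"
  proof -
    have main: "val (dt (u Sigma)) t x y = val (- (dx rho * u V1) - rho * \<delta> u) t x y
      \<and> vec3 (rho * dt (u V1)) (rho * dt (u V2)) (rho * dt (u V3)) t x y =
        vec3 (- (dx bz * u M3) - bz * dx (u M3) - dx P + gravity E *\<^sub>R u Sigma)
          (b1 *\<^sub>R (dx (u M2) - dy (u M1)) - bz * dy (u M3) - dy P) (dx bz * u M1 + b1 *\<^sub>R dx (u M3)) t x y
      \<and> vec3 (dt (u M1)) (dt (u M2)) (dt (u M3)) t x y =
        vec3 (- (b1 *\<^sub>R dy (u V2))) (b1 *\<^sub>R dx (u V2)) (dx (b1 *\<^sub>R u V3 - bz * u V1) - dy (bz * u V2)) t x y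
      \<and> (case flow E of Incompressible \<Rightarrow> val (\<delta> u) t x y = 0 | Compressible \<Rightarrow> val P t x y = val (c2 * u Sigma) t x y)"
      if t: "t \<ge> 0" and x: "x \<in> {0..2 * pi}" for t x y
    proof -
      have "linearized_mhd E \<sigma> v B p"
        using assms(1) by (simp add: mhd_solution_def)
      note L = this[unfolded linearized_mhd_def, rule_format, OF t x, of y]
      have B0: "B0 E x = vec3 (b1 *\<^sub>R 1) 0 bz t x y" if "x \<in> {0..2 * pi}" for x y
        using val_coefficients[OF t that] by (simp add: val_simps)
      have dt: "Dt \<sigma> t x y = val (dt (u Sigma)) t x y"
        "Dt v t x y = vec3 (dt (u V1)) (dt (u V2)) (dt (u V3)) t x y"
        "Dt B t x y = vec3 (dt (u M1)) (dt (u M2)) (dt (u M3)) t x y"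
        using t x by (auto intro!: Dt_val Dt_vec3 val)
      have rv: "density E x *\<^sub>R v t x y = vec3 (rho * u V1) (rho * u V2) (rho * u V3) t x y"
        if "x \<in> {0..2 * pi}" for x y
        using t that by (simp add: val val_coefficients val_simps vector_3_linear)
      have dvec: "Dx F x y = vec3 (dx f1) (dx f2) (dx f3) t x y \<and> Dy F x y = vec3 (dy f1) (dy f2) (dy f3) t x y"
        if "\<And>x y. x \<in> {0..2 * pi} \<Longrightarrow> F x y = vec3 f1 f2 f3 t x y" for F f1 f2 f3
      proof
        show "Dx F x y = vec3 (dx f1) (dx f2) (dx f3) t x y"
          by (rule Dx_vec3[OF t x]) (rule that)
        show "Dy F x y = vec3 (dy f1) (dy f2) (dy f3) t x y"
          by (rule Dy_vec3[OF t x]) (rule that[OF x])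
      qed
      have divergence: "divergence F x y = val (dx f1 + dy f2) t x y"
        and curl: "curl F x y = vec3 (dy f3) (- dx f3) (dx f2 - dy f1) t x y"
        if "\<And>x y. x \<in> {0..2 * pi} \<Longrightarrow> F x y = vec3 f1 f2 f3 t x y" for F f1 f2 f3
      proof -
        have "Dx F x y = vec3 (dx f1) (dx f2) (dx f3) t x y \<and> Dy F x y = vec3 (dy f1) (dy f2) (dy f3) t x y"
          by (rule dvec) (rule that)
        then show "divergence F x y = val (dx f1 + dy f2) t x y"
          "curl F x y = vec3 (dy f3) (- dx f3) (dx f2 - dy f1) t x y"
          by (simp_all add: divergence_def curl_def vector_3 val_simps)
      qed
      have vB: "cross3 (v t x y) (B0 E x) =
          vec3 (bz * u V2) (b1 *\<^sub>R u V3 - bz * u V1) (- (b1 *\<^sub>R u V2)) t x y"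
        if "x \<in> {0..2 * pi}" for x y
        using t that by (simp add: val B0[of x y] cross3_vector val_simps mult.commute)
      have p: "p t x y = val P t x y" if "x \<in> {0..2 * pi}" for x y
        using t that by (simp add: val P_def)
      have dp: "grad (p t) x y = vec3 (dx P) (dy P) 0 t x y"
      proof -
        have "Dx (p t) x y = val (dx P) t x y"
          by (rule Dx_val[OF t x]) (rule p)
        moreover have "Dy (p t) x y = val (dy P) t x y"
          by (rule Dy_val[OF t x]) (rule p[OF x])
        ultimately show ?thesis
          by (simp add: grad_def val_simps)
      qed
      have c: "divergence (\<lambda>x y. density E x *\<^sub>R v t x y) x y = val (dx (rho * u V1) + dy (rho * u V2)) t x y"
        "divergence (v t) x y = val (dx (u V1) + dy (u V2)) t x y"
        "curl (\<lambda>x y. B0 E x) x y = vec3 (dy bz) (- dx bz) (dx 0 - dy (b1 *\<^sub>R 1)) t x y"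
        "curl (\<lambda>x y. cross3 (v t x y) (B0 E x)) x y =
          vec3 (dy (- (b1 *\<^sub>R u V2))) (- dx (- (b1 *\<^sub>R u V2))) (dx (b1 *\<^sub>R u V3 - bz * u V1) - dy (bz * u V2)) t x y"
        "curl (B t) x y = vec3 (dy (u M3)) (- dx (u M3)) (dx (u M2) - dy (u M1)) t x y"
        by (rule divergence, rule rv, assumption) (rule divergence, rule val(2)[OF t], assumption,
            rule curl, rule B0, assumption, rule curl, rule vB, assumption, rule curl, rule val(3)[OF t], assumption)
      have z: "dx (b1 *\<^sub>R 1) = 0" "dy (b1 *\<^sub>R 1) = 0" "dy bz = 0" "dy rho = 0"
        using coef_derivatives[OF coef_basic(3)] coef_derivatives[OF coef_basic(1)]
        by (simp_all add: derivation_simps)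
      note L = L[unfolded dt c dp p[OF x] val(1)[OF t x] val(3)[OF t x] B0[OF x, of y] cross3_vector
          vector_3_linear vector_3_eq_iff z]
      show ?thesis
        using L unfolding vector_3_eq_iff
        by (cases "flow E") (simp_all add: val_simps derivation_simps z \<delta>_def val_coefficients(1)[OF t x, of y]
            compressible_coefficients(3)[OF _ t x, of y, symmetric] algebra_simps)
    qed
    then show "dt (u Sigma) = - (dx rho * u V1) - rho * \<delta> u"
      "rho * dt (u V1) = - (dx bz * u M3) - bz * dx (u M3) - dx P + gravity E *\<^sub>R u Sigma"
      "rho * dt (u V2) = b1 *\<^sub>R (dx (u M2) - dy (u M1)) - bz * dy (u M3) - dy P"
      "rho * dt (u V3) = dx bz * u M1 + b1 *\<^sub>R dx (u M3)"
      "dt (u M1) = - (b1 *\<^sub>R dy (u V2))" "dt (u M2) = b1 *\<^sub>R dx (u V2)"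
      "dt (u M3) = dx (b1 *\<^sub>R u V3 - bz * u V1) - dy (bz * u V2)"
      unfolding vector_3_eq_iff by (intro sfield_eqI; blast)+
    show "\<delta> u = 0" if "flow E = Incompressible"
      using main that by (intro sfield_eqI) (simp add: val_simps)
    show "P = c2 * u Sigma" if "flow E = Compressible"
      using main that by (intro sfield_eqI) simp
  qed
  have Q: "u Q = P + bz * u M3 + b1 *\<^sub>R u M1"
    by (simp add: P_def)
  have dbz: "dt bz = 0" "dy bz = 0"
    by (rule coef_derivatives[OF coef_basic(3)])+
  have m3: "dt (u M3) = - (dx bz * u V1) - bz * \<delta> u"
    unfolding eqs(7) b1 by (simp add: derivation_simps dbz \<delta>_def algebra_simps)
  have "rho * dt (u V1) = - dx (u Q) + b1 *\<^sub>R dx (u M1) + gravity E *\<^sub>R u Sigma"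
    unfolding eqs(2) Q by (simp add: derivation_simps algebra_simps)
  moreover have "rho * dt (u V2) = - dy (u Q) + b1 *\<^sub>R dx (u M2)"
    unfolding eqs(3) Q by (simp add: derivation_simps dbz algebra_simps)
  moreover have "rho * dt (u V3) = dx bz * u M1"
    using arg_cong[OF b1(2), of dx] unfolding eqs(4) by (simp add: derivation_simps)
  moreover have "kappa = 0 \<or> u Q = c2 * u Sigma + bz * u M3 + b1 *\<^sub>R u M1"
    unfolding Q using eqs(9) by (cases "flow E") (simp_all add: kappa_def)
  moreover have "\<delta> u = - (kappa * (dt (u Q) + pot u))"
  proof (cases "flow E")
    case Incompressible
    then show ?thesis
      using eqs(8) by (simp add: kappa_def)
  next
    case Compressible
    note cc = compressible_coefficients(1,2)[OF Compressible]
    have c2: "c2 * dx rho = dx p0"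
    proof -
      have "rho * (c2 * dx rho) = rho * dx p0"
        using cc by (simp add: mult.assoc[symmetric] mult.commute)
      then show ?thesis
        using rho_cancel irho(1) by (metis mult.assoc mult_1)
    qed
    have "c2 * dt (u Sigma) = - (dx p0 * u V1) - adiabatic E *\<^sub>R p0 * \<delta> u"
      unfolding eqs(1) c2[symmetric] cc(1)[symmetric] by (simp add: algebra_simps)
    moreover have "dt c2 = 0"
      using coef_derivatives[OF coef_kappa(4)] by simp
    ultimately have "dt (u Q) = - (dx p0 * u V1) - adiabatic E *\<^sub>R p0 * \<delta> u + bz * (- (dx bz * u V1) - bz * \<delta> u)
        - b1\<^sup>2 *\<^sub>R dy (u V2)"
      unfolding Q eqs(9)[OF Compressible] by (simp add: derivation_simps dbz m3 eqs(5) power2_eq_square)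
    \<comment> \<open>Writing \<open>dy (u V2)\<close> as \<open>\<delta> u - dx (u V1)\<close>
      completes the stiffness and produces the second term of \<open>pot\<close>.\<close>
    also have "\<dots> = - ((dx p0 + bz * dx bz) * u V1) - stiffness * \<delta> u + b1\<^sup>2 *\<^sub>R dx (u V1)"
      by (simp add: stiffness_def \<delta>_def power2_eq_square algebra_simps)
    finally have "stiffness * \<delta> u = - (dt (u Q) + pot u)"
      unfolding equilibrium_balance by (simp add: pot_def algebra_simps)
    then have "kappa * stiffness * \<delta> u = - (kappa * (dt (u Q) + pot u))"
      by (simp only: mult.assoc mult_minus_right)
    then show ?thesis
      by (simp add: kappa_compressible(1)[OF Compressible])
  qed
  ultimately show ?thesis
    unfolding sol_def u_def[symmetric] using eqs(1,5,6) m3 fields_perx[OF assms(1), folded u_def] by blast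
qed

end

section \<open>Sobolev norms in terms of scalar fields, and the growth estimate\<close>

definition tuple :: "state \<Rightarrow> real \<Rightarrow> real \<Rightarrow> real \<Rightarrow> real \<times> (real^3) \<times> (real^3)" where
  "tuple u t x y = (val (u Sigma) t x y, vec3 (u V1) (u V2) (u V3) t x y, vec3 (u M1) (u M2) (u M3) t x y)"

lemma Dx_tuple:
  assumes "t \<ge> 0" "x \<in> {0..2 * pi}" "\<And>x. x \<in> {0..2 * pi} \<Longrightarrow> F x y = tuple u t x y"
  shows "Dx F x y = tuple (\<lambda>v. dx (u v)) t x y"
proof (rule Dx_eqI)
  show "((\<lambda>r. F r y) has_vector_derivative tuple (\<lambda>v. dx (u v)) t x y) (at x within {0..2 * pi})"
  proof (rule has_vector_derivative_transform[OF assms(2)])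
    show "((\<lambda>r. tuple u t r y) has_vector_derivative tuple (\<lambda>v. dx (u v)) t x y) (at x within {0..2 * pi})"
      unfolding tuple_def
      by (intro has_vector_derivative_Pair has_vector_derivative_vector_3 has_derivative_val
          has_vector_derivative_val assms)
  qed (rule assms(3))
qed (rule assms(2))

lemma Dy_tuple:
  assumes "t \<ge> 0" "x \<in> {0..2 * pi}" "\<And>y. F x y = tuple u t x y"
  shows "Dy F x y = tuple (\<lambda>v. dy (u v)) t x y"
proof (rule Dy_eqI)
  show "((\<lambda>r. F x r) has_vector_derivative tuple (\<lambda>v. dy (u v)) t x y) (at y)"
    unfolding assms(3) tuple_def
    by (intro has_vector_derivative_Pair has_vector_derivative_vector_3 has_derivative_val
        has_vector_derivative_val assms(1,2))
qed

lemma funpow_tuple: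
  assumes "t \<ge> 0" "\<And>x y. x \<in> {0..2 * pi} \<Longrightarrow> F x y = tuple u t x y" "x \<in> {0..2 * pi}"
  shows "(Dx ^^ i) ((Dy ^^ j) F) x y = tuple (\<lambda>v. (dx ^^ i) ((dy ^^ j) (u v))) t x y"
proof -
  have "(Dy ^^ j) F x y = tuple (\<lambda>v. (dy ^^ j) (u v)) t x y" if "x \<in> {0..2 * pi}" for x y
    using that
  proof (induction j arbitrary: y)
    case (Suc j)
    have "Dy ((Dy ^^ j) F) x y = tuple (\<lambda>v. dy ((dy ^^ j) (u v))) t x y"
      by (rule Dy_tuple[OF assms(1) Suc.prems]) (rule Suc.IH[OF Suc.prems])
    then show ?case
      by simp
  qed (simp add: assms(2))
  then show ?thesis
    using assms(3)
  proof (induction i arbitrary: x)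
    case (Suc i)
    have "Dx ((Dx ^^ i) ((Dy ^^ j) F)) x y = tuple (\<lambda>v. dx ((dx ^^ i) ((dy ^^ j) (u v)))) t x y"
      by (rule Dx_tuple[OF assms(1) Suc.prems(2)]) (rule Suc.IH[OF Suc.prems(1)])
    then show ?case
      by simp
  qed simp
qed

lemma norm_tuple: "(norm (tuple u t x y))\<^sup>2 = (\<Sum>v\<in>- {Q}. (val (u v) t x y)\<^sup>2)"
  by (simp add: vars_except_Q tuple_def norm_Pair norm_vec_def L2_set_def sum_3 vector_3)

context mhd_equilibrium
begin

lemma sobolev_norm_eq:
  assumes "linear_mhd rho irho kappa mu lam c2 bz w (gravity E) b1 \<Lambda>" "t \<ge> 0"
    and F: "\<And>x y. x \<in> {0..2 * pi} \<Longrightarrow> F x y = tuple u t x y"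
  shows "sobolev_norm E k F = sqrt (\<Sum>(i, j)\<in>{(i, j). i + j \<le> k}. \<Sum>v\<in>- {Q}.
    linear_mhd.N rho ((dx ^^ i) ((dy ^^ j) (u v))) t)"
proof -
  interpret linear_mhd rho irho kappa mu lam c2 bz w "gravity E" b1 \<Lambda>
    by (rule assms(1))
  have "(weighted_norm E ((Dx ^^ i) ((Dy ^^ j) F)))\<^sup>2 = (\<Sum>v\<in>- {Q}. N ((dx ^^ i) ((dy ^^ j) (u v))) t)" for i j
  proof -
    let ?u = "\<lambda>v. (dx ^^ i) ((dy ^^ j) (u v))"
    let ?I = "integral_D (\<lambda>x y. density E x * (norm ((Dx ^^ i) ((Dy ^^ j) F) x y))\<^sup>2)"
    have fp: "(Dx ^^ i) ((Dy ^^ j) F) x y = tuple ?u t x y" if "x \<in> {0..2 * pi}" for x y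
      by (rule funpow_tuple[OF assms(2) _ that]) (rule F)
    have "?I = integ (rho * (?u Sigma)\<^sup>2 + rho * (?u V1)\<^sup>2 + rho * (?u V2)\<^sup>2 + rho * (?u V3)\<^sup>2
        + rho * (?u M1)\<^sup>2 + rho * (?u M2)\<^sup>2 + rho * (?u M3)\<^sup>2) t"
      by (rule integral_D_val)
        (simp add: fp norm_tuple vars_except_Q val_simps
          val_coefficients(1)[OF assms(2)] distrib_left)
    also have "\<dots> = (\<Sum>v\<in>- {Q}. N (?u v) t)"
      by (simp add: vars_except_Q N_def integ_linear)
    finally have "?I = (\<Sum>v\<in>- {Q}. N (?u v) t)" .
    then show ?thesis
      by (simp add: weighted_norm_def sum_nonneg N_nonneg)
  qed
  then show ?thesis
    by (simp add: sobolev_norm_def)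
qed

end

theorem theorem1:
  fixes E :: equilibrium and \<Lambda> :: real
  assumes "steady_state E"
    and "\<Lambda> > 0"
    and "Lambda_sq E = ereal (\<Lambda>\<^sup>2)"
  shows "\<forall>s::nat. \<exists>C::real. \<forall>\<sigma> v B p. mhd_solution E \<sigma> v B p \<longrightarrow>
           (\<forall>t\<ge>0. sobolev_norm E s (\<lambda>x y. (\<sigma> t x y, v t x y, B t x y))
                    \<le> C * exp (\<Lambda> * t) * sobolev_norm E (s + 2) (\<lambda>x y. (\<sigma> 0 x y, v 0 x y, B 0 x y)))"
proof
  fix s
  interpret mhd_equilibrium E
    by unfold_locales (rule assms(1))
  note lin = linear_mhd[OF assms(2,3)]
  interpret linear_mhd rho irho kappa mu lam c2 bz w "gravity E" b1 \<Lambda>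
    by (rule lin)
  obtain C where C: "C \<ge> 0" "\<And>u t. sol u \<Longrightarrow> t \<ge> 0 \<Longrightarrow>
    (\<Sum>(i, j)\<in>{(i, j). i + j \<le> s}. \<Sum>v\<in>- {Q}. N ((dx ^^ i) ((dy ^^ j) (u v))) t)
      \<le> C * (exp (2 * \<Lambda> * t) * dat (s + 2) u)"
    using growth_bound by metis
  \<comment> \<open>\<open>C\<close> bounds squared norms with the factor
    \<open>exp (2 * \<Lambda> * t)\<close>; taking roots gives \<open>sqrt C\<close> and the rate
    \<Lambda>.\<close>
  have "sobolev_norm E s (\<lambda>x y. (\<sigma> t x y, v t x y, B t x y))
      \<le> sqrt C * exp (\<Lambda> * t) * sobolev_norm E (s + 2) (\<lambda>x y. (\<sigma> 0 x y, v 0 x y, B 0 x y))"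
    if s: "mhd_solution E \<sigma> v B p" and t: "t \<ge> 0" for \<sigma> v B p t
  proof -
    define u where "u = fields \<sigma> v B p"
    have "(\<sigma> t x y, v t x y, B t x y) = tuple u t x y" if "t \<ge> 0" "x \<in> {0..2 * pi}" for t x y
      unfolding u_def tuple_def using fields_val(1-3)[OF s that] by simp
    then have eq: "sobolev_norm E k (\<lambda>x y. (\<sigma> t x y, v t x y, B t x y)) =
        sqrt (\<Sum>(i, j)\<in>{(i, j). i + j \<le> k}. \<Sum>v\<in>- {Q}. N ((dx ^^ i) ((dy ^^ j) (u v))) t)" if "t \<ge> 0" for k t
      using that by (intro sobolev_norm_eq[OF lin])
    have "sobolev_norm E s (\<lambda>x y. (\<sigma> t x y, v t x y, B t x y)) \<le> sqrt (C * (exp (2 * \<Lambda> * t) * dat (s + 2) u))"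
      unfolding eq[OF t] u_def by (intro real_sqrt_le_mono C(2) fields_sol[OF s lin] t)
    also have "\<dots> = sqrt C * exp (\<Lambda> * t) * sqrt (dat (s + 2) u)"
    proof -
      have "exp (2 * \<Lambda> * t) = (exp (\<Lambda> * t))\<^sup>2"
        by (simp add: mult.assoc flip: exp_double)
      then show ?thesis
        by (simp add: real_sqrt_mult)
    qed
    also have "sqrt (dat (s + 2) u) = sobolev_norm E (s + 2) (\<lambda>x y. (\<sigma> 0 x y, v 0 x y, B 0 x y))"
      by (simp add: eq dat_def)
    finally show ?thesis .
  qed
  then show "\<exists>C. \<forall>\<sigma> v B p. mhd_solution E \<sigma> v B p \<longrightarrow>
      (\<forall>t\<ge>0. sobolev_norm E s (\<lambda>x y. (\<sigma> t x y, v t x y, B t x y))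
        \<le> C * exp (\<Lambda> * t) * sobolev_norm E (s + 2) (\<lambda>x y. (\<sigma> 0 x y, v 0 x y, B 0 x y)))"
    by blast
qed

end
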